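(* Let $X$ be a complex Banach space and let $A:D(A)\to X$ be the generator of a $C_0$-semigroup $T=(T(t))_{t\ge 0}$ on $X$. Put $K:=\{t\in\mathbb{R}: it\in\sigma(A)\}$. Assume that there is $a\in(0,\infty)$ with $K\subset(-a,a)$, and that there is $\theta\in(\tfrac12,\infty)$ with $\sup\{|t|^{\theta}\,\|R(it,A)\| : t\in\mathbb{R}\setminus(-a,a)\}<\infty$. Let $F\subset\mathbb{R}\setminus K$ be a closed subset of $\mathbb{R}$. Then there exists $G\in L^1(\mathbb{R},L(X))$ such that for every $\phi\in L^{\infty}(\mathbb{R},X)$ with Beurling spectrum $sp(\phi)\subset F$, the function $u:=G*\phi$ is a mild solution of $u'=Au+\phi$ on $\mathbb{R}$ which is bounded and uniformly continuous on $\mathbb{R}$ and satisfies $sp(u)\subset sp(\phi)\subset F$.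
   Context: $L(X)$ is the Banach algebra of bounded linear operators on $X$; $\sigma(A)$ is the spectrum of $A$ and $R(\lambda,A)=(\lambda-A)^{-1}$ for $\lambda\in\mathbb{C}\setminus\sigma(A)$. Convolution: $(G*\phi)(t)=\int_{\mathbb{R}}G(s)\phi(t-s)\,ds$ (Bochner integral). For $f\in L^1(\mathbb{R},\mathbb{C})$, $\widehat f(\lambda)=\int_{\mathbb{R}}f(t)e^{-i\lambda t}\,dt$. For $\phi\in L^\infty(\mathbb{R},X)$ the Beurling spectrum is $sp(\phi)=\{\omega\in\mathbb{R}: \text{for every } f\in L^1(\mathbb{R},\mathbb{C}),\ \phi*f=0 \text{ implies } \widehat f(\omega)=0\}$. A mild solution of $u'=Au+\phi$ on $\mathbb{R}$ is a function $u\in C(\mathbb{R},X)$ such that, for all $t\in\mathbb{R}$, $\int_0^t u(s)\,ds\in D(A)$ and $u(t)=u(0)+A\int_0^t u(s)\,ds+\int_0^t\phi(s)\,ds$. *)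

theory Defs
  imports "HOL-Analysis.Analysis"
begin

text \<open>The library only has real Banach spaces; a complex one is a real one whose scalar
  multiplication extends to the complex numbers, with \<open>norm\<close> homogeneous over the complex numbers.\<close>

class scaleC =
  fixes scaleC :: "complex \<Rightarrow> 'a \<Rightarrow> 'a"  (infixr \<open>*\<^sub>C\<close> 75)

class complex_banach = scaleC + banach +
  assumes scaleC_add_right: "c *\<^sub>C (x + y) = c *\<^sub>C x + c *\<^sub>C y"
    and scaleC_add_left: "(c + d) *\<^sub>C x = c *\<^sub>C x + d *\<^sub>C x"
    and scaleC_scaleC: "c *\<^sub>C d *\<^sub>C x = (c * d) *\<^sub>C x"
    and scaleC_of_real: "complex_of_real r *\<^sub>C x = r *\<^sub>R x"
    and norm_scaleC: "norm (c *\<^sub>C x) = cmod c * norm x"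

instantiation complex :: complex_banach
begin

definition scaleC_complex :: "complex \<Rightarrow> complex \<Rightarrow> complex" where
  "scaleC_complex c z = c * z"

instance
  by standard (auto simp: scaleC_complex_def algebra_simps scaleR_conv_of_real norm_mult)

end

text \<open>\<open>L(X)\<close> consists of the \<open>T :: 'a \<Rightarrow>\<^sub>L 'a\<close> (bounded and real-linear) satisfying the following
  predicate; they form a closed subspace, and the norm is the operator norm in both readings.\<close>

definition complex_linear :: "('a::complex_banach \<Rightarrow>\<^sub>L 'a) \<Rightarrow> bool" where
  "complex_linear T \<longleftrightarrow> (\<forall>c x. blinfun_apply T (c *\<^sub>C x) = c *\<^sub>C blinfun_apply T x)"

text \<open>The library's \<open>has_bochner_integral\<close> requires a second countable range type, which excludes
  nonseparable \<open>X\<close> and, typically, \<open>L(X)\<close>. The definition below is the library's with Borel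
  measurability replaced by strong measurability.\<close>

definition strongly_measurable :: "'m measure \<Rightarrow> ('m \<Rightarrow> 'b::real_normed_vector) \<Rightarrow> bool" where
  "strongly_measurable M f \<longleftrightarrow>
    (\<exists>s. (\<forall>i. simple_function M (s i)) \<and> (AE x in M. (\<lambda>i::nat. s i x) \<longlonglongrightarrow> f x))"

definition has_Bochner_integral ::
  "'m measure \<Rightarrow> ('m \<Rightarrow> 'b::real_normed_vector) \<Rightarrow> 'b \<Rightarrow> bool" where
  "has_Bochner_integral M f I \<longleftrightarrow>
    strongly_measurable M f \<and>
    (\<exists>s. (\<forall>i. Bochner_Integration.simple_bochner_integrable M (s i)) \<and>
         (\<lambda>i::nat. \<integral>\<^sup>+x. ennreal (norm (f x - s i x)) \<partial>M) \<longlonglongrightarrow> 0 \<and>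
         (\<lambda>i. Bochner_Integration.simple_bochner_integral M (s i)) \<longlonglongrightarrow> I)"

definition Bochner_integrable :: "'m measure \<Rightarrow> ('m \<Rightarrow> 'b::real_normed_vector) \<Rightarrow> bool" where
  "Bochner_integrable M f \<longleftrightarrow> (\<exists>I. has_Bochner_integral M f I)"

definition Bochner_integral :: "'m measure \<Rightarrow> ('m \<Rightarrow> 'b::real_normed_vector) \<Rightarrow> 'b" where
  "Bochner_integral M f =
    (if Bochner_integrable M f then THE I. has_Bochner_integral M f I else 0)"

definition oriented_integral :: "real \<Rightarrow> real \<Rightarrow> (real \<Rightarrow> 'b::real_normed_vector) \<Rightarrow> 'b" where
  "oriented_integral a b f =
    (if a \<le> b then Bochner_integral lborel (\<lambda>s. indicator {a..b} s *\<^sub>R f s)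
     else - Bochner_integral lborel (\<lambda>s. indicator {b..a} s *\<^sub>R f s))"

definition L_infinity :: "(real \<Rightarrow> 'b::real_normed_vector) set" where
  "L_infinity =
    {\<phi>. strongly_measurable lborel \<phi> \<and> (\<exists>C. AE t in lborel. norm (\<phi> t) \<le> C)}"

text \<open>The argument \<open>m\<close> is the bilinear product between the two range spaces.\<close>

definition convolution ::
  "('b \<Rightarrow> 'c \<Rightarrow> 'd::real_normed_vector) \<Rightarrow> (real \<Rightarrow> 'b) \<Rightarrow> (real \<Rightarrow> 'c) \<Rightarrow> real \<Rightarrow> 'd" where
  "convolution m g h t = Bochner_integral lborel (\<lambda>s. m (g s) (h (t - s)))"

definition fourier :: "(real \<Rightarrow> complex) \<Rightarrow> real \<Rightarrow> complex" where
  "fourier f \<omega> = (LINT t|lborel. f t * exp (- (\<i> * of_real \<omega> * of_real t)))"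

text \<open>For \<open>\<phi>\<close> in \<open>L_infinity\<close> and integrable \<open>f\<close> the convolution exists at every \<open>t\<close> and is
  continuous in \<open>t\<close>, so its vanishing may be stated pointwise.\<close>

definition beurling_spectrum :: "(real \<Rightarrow> 'a::complex_banach) \<Rightarrow> real set" where
  "beurling_spectrum \<phi> =
    {\<omega>. \<forall>f. integrable lborel f \<longrightarrow>
          (\<forall>t. convolution (\<lambda>x c. c *\<^sub>C x) \<phi> f t = 0) \<longrightarrow> fourier f \<omega> = 0}"

definition C0_semigroup :: "(real \<Rightarrow> 'a::complex_banach \<Rightarrow>\<^sub>L 'a) \<Rightarrow> bool" where
  "C0_semigroup T \<longleftrightarrow>
    (\<forall>t\<ge>0. complex_linear (T t)) \<and>
    T 0 = id_blinfun \<and>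
    (\<forall>s\<ge>0. \<forall>t\<ge>0. T (s + t) = T s o\<^sub>L T t) \<and>
    (\<forall>x. ((\<lambda>t. blinfun_apply (T t) x) \<longlongrightarrow> x) (at_right 0))"

text \<open>An unbounded operator is a domain \<open>D\<close> together with a function \<open>A\<close> whose values outside \<open>D\<close>
  are irrelevant.\<close>

definition is_generator ::
  "(real \<Rightarrow> 'a::complex_banach \<Rightarrow>\<^sub>L 'a) \<Rightarrow> 'a set \<Rightarrow> ('a \<Rightarrow> 'a) \<Rightarrow> bool" where
  "is_generator T D A \<longleftrightarrow>
    D = {x. \<exists>y. ((\<lambda>h. (1 / h) *\<^sub>R (blinfun_apply (T h) x - x)) \<longlongrightarrow> y) (at_right 0)} \<and>
    (\<forall>x\<in>D. ((\<lambda>h. (1 / h) *\<^sub>R (blinfun_apply (T h) x - x)) \<longlongrightarrow> A x) (at_right 0))"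

definition resolvent :: "'a::complex_banach set \<Rightarrow> ('a \<Rightarrow> 'a) \<Rightarrow> complex \<Rightarrow> 'a \<Rightarrow> 'a" where
  "resolvent D A z = inv_into D (\<lambda>x. z *\<^sub>C x - A x)"

definition spectrum :: "'a::complex_banach set \<Rightarrow> ('a \<Rightarrow> 'a) \<Rightarrow> complex set" where
  "spectrum D A =
    {z. \<not> (bij_betw (\<lambda>x. z *\<^sub>C x - A x) D UNIV \<and> bounded_linear (resolvent D A z))}"

definition mild_solution ::
  "'a::complex_banach set \<Rightarrow> ('a \<Rightarrow> 'a) \<Rightarrow> (real \<Rightarrow> 'a) \<Rightarrow> (real \<Rightarrow> 'a) \<Rightarrow> bool" where
  "mild_solution D A \<phi> u \<longleftrightarrow>
    continuous_on UNIV u \<and>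
    (\<forall>t. oriented_integral 0 t u \<in> D \<and>
         u t = u 0 + A (oriented_integral 0 t u) + oriented_integral 0 t \<phi>)"

end

theory Submission
  imports "HOL-Probability.Sinc_Integral" "HOL-Probability.Characteristic_Functions" Defs
begin

text \<open>Choose a \<open>C\<^sup>2\<close> cutoff \<open>\<eta>\<close> of compact support that is \<open>1\<close> near \<open>K\<close> and \<open>0\<close> near \<open>F\<close>, and let \<open>G\<close> be
  the inverse Fourier transform of \<open>h(t) = (1 - \<eta>(t)) R(it, A)\<close>. Since the \<open>k\<close>-th derivative of the resolvent
  decays like \<open>\<bar>t\<bar>\<close> to the power \<open>-(k + 1) \<theta>\<close> with \<open>\<theta> > 1/2\<close>, two integrations by parts bound \<open>G(s)\<close>
  by \<open>\<bar>s\<bar>\<^sup>-\<^sup>2\<close>, and one integration by parts bounds it by \<open>\<bar>s\<bar>\<close> to the power \<open>\<epsilon> - 1\<close>; hence \<open>G\<close> is integrable.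
  Formally \<open>G' = A G + \<delta> - g\<close>, where \<open>g\<close> is the inverse transform of \<open>\<eta>\<close>. A local form of Wiener's lemma
  shows that \<open>g * \<phi> = 0\<close> whenever the Beurling spectrum of \<open>\<phi>\<close> avoids the support of \<open>\<eta>\<close>, so
  \<open>u = G * \<phi>\<close> solves \<open>u' = A u + \<phi>\<close>. To give this a meaning, the equation for \<open>G\<close> is multiplied by the
  bounded operator \<open>R(ia, A)\<close> and integrated over an interval, the \<open>\<delta>\<close> coming from the Dirichlet integral.
  Neither \<open>X\<close> nor \<open>L(X)\<close> need be separable, so identities between vector-valued integrals are tested
  with bounded functionals (Hahn-Banach), which reduces them to scalar Fubini arguments.\<close>

section \<open>Norming functionals\<close>

text \<open>The threshold 1/2 stems from the first derivative of the symbol: its decay exponent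
  2\<theta> is integrable exactly for \<theta> > 1/2, while the symbol itself, with exponent
  \<theta>, need not be integrable. So the inverse transform is a limit of truncated integrals,
  taken off s = 0, and the singularity at 0 is tamed by a bound that is uniform in the truncation. A
  second obstacle is that \<open>A G\<close> cannot be written down: nothing places the range of
  G(s) in the domain of A, and G may be singular at 0. The point ia is in the resolvent set because
  K lies in the open interval (-a, a), and R(ia, A) is injective with range the domain of A. Hence
  an equation multiplied by R(ia, A) can be undone at the end: it returns both the membership of the
  integral of u in the domain and the equation for u. Finally, the Beurling spectrum yields
  information at one frequency at a time. A quantitative version near each frequency and a finite
  cover of the support of \<eta> are needed to annihilate the whole of g.\<close>

lemma hahn_banach_norming:
  fixes x0 :: "'a::real_normed_vector"
  obtains l :: "'a \<Rightarrow> real" where "bounded_linear l" "l x0 = norm x0" "\<And>y. \<bar>l y\<bar> \<le> norm y"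
proof -
  \<comment> \<open>A functional on a subspace is encoded by its graph in the product with the
    reals, ordered by inclusion. The bound implies single-valuedness: with \<open>(0, c)\<close> the
    graph contains \<open>(0, - c)\<close>, and both bounds together force
    \<open>c = 0\<close>.\<close>
  define S :: "('a \<times> real) set set" where
    "S = {g. subspace g \<and> (x0, norm x0) \<in> g \<and> (\<forall>y c. (y, c) \<in> g \<longrightarrow> c \<le> norm y)}"
  have "span {(x0, norm x0)} \<in> S"
  proof -
    have "c \<le> norm y" if "(y, c) \<in> span {(x0, norm x0)}" for y c
    proof -
      have "\<exists>k. y = k *\<^sub>R x0 \<and> c = k * norm x0"
        using that by (auto simp: span_singleton)
      then show ?thesis by (auto simp: mult_right_mono)
    qed
    then show ?thesis by (auto simp: S_def span_base)
  qed
  then have ne: "S \<noteq> {}" by blast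
  have "\<Union>C \<in> S" if C: "C \<noteq> {}" "subset.chain S C" for C
  proof -
    have CS: "C \<subseteq> S" and tot: "\<And>g h. g \<in> C \<Longrightarrow> h \<in> C \<Longrightarrow> g \<subseteq> h \<or> h \<subseteq> g"
      using C(2) by (auto simp: subset_chain_def)
    obtain g0 where "g0 \<in> C" using C(1) by blast
    then have "g0 \<in> S" using CS by blast
    have "subspace (\<Union>C)"
    proof (rule subspaceI)
      show "0 \<in> \<Union>C" using \<open>g0 \<in> C\<close> \<open>g0 \<in> S\<close> subspace_0[of g0] by (auto simp: S_def)
    next
      fix p q assume "p \<in> \<Union>C" "q \<in> \<Union>C"
      then obtain g h where gh: "g \<in> C" "p \<in> g" "h \<in> C" "q \<in> h" by blast
      then obtain k where "k \<in> C" "p \<in> k" "q \<in> k" using tot by blast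
      moreover have "subspace k" using \<open>k \<in> C\<close> CS by (auto simp: S_def)
      ultimately have "p + q \<in> k" by (simp add: subspace_add)
      then show "p + q \<in> \<Union>C" using \<open>k \<in> C\<close> by blast
    next
      fix c p assume "p \<in> \<Union>C"
      then obtain k where k: "k \<in> C" "p \<in> k" by blast
      then have "subspace k" using CS by (auto simp: S_def)
      then have "c *\<^sub>R p \<in> k" using k by (simp add: subspace_scale)
      then show "c *\<^sub>R p \<in> \<Union>C" using k by blast
    qed
    moreover have "(x0, norm x0) \<in> \<Union>C" using \<open>g0 \<in> C\<close> \<open>g0 \<in> S\<close> by (auto simp: S_def)
    moreover have "c \<le> norm y" if "(y, c) \<in> \<Union>C" for y c using that CS by (auto simp: S_def)
    ultimately show ?thesis by (simp add: S_def)
  qed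
  from subset_Zorn_nonempty[OF ne this] obtain M where M: "M \<in> S"
    and max: "\<And>N. N \<in> S \<Longrightarrow> M \<subseteq> N \<Longrightarrow> N = M" by metis
  have sub: "subspace M" and bd: "\<And>y c. (y, c) \<in> M \<Longrightarrow> c \<le> norm y" and x0: "(x0, norm x0) \<in> M"
    using M by (auto simp: S_def)
  have total: "\<exists>c. (z, c) \<in> M" for z
  proof -
    \<comment> \<open>Classical one-step extension: a value \<alpha> at \<open>z\<close> keeps the
      bound if it lies above every \<open>c - norm (y - z)\<close> and below every
      \<open>norm (y + z) - c\<close>. By \<open>key\<close> the two families do not cross, and the
      supremum of the first is chosen.\<close>
    define T where "T = {c - norm (y - z) | y c. (y, c) \<in> M}"
    define \<alpha> where "\<alpha> = Sup T"
    have key: "c - norm (y - z) \<le> norm (y' + z) - c'" if "(y, c) \<in> M" "(y', c') \<in> M" for y c y' c'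
    proof -
      have "c + c' \<le> norm (y + y')" using bd subspace_add[OF sub that] by auto
      also have "\<dots> \<le> norm (y - z) + norm (y' + z)" using norm_triangle_ineq[of "y - z" "y' + z"] by simp
      finally show ?thesis by simp
    qed
    have Tne: "T \<noteq> {}" using x0 by (auto simp: T_def)
    have Tbd: "bdd_above T" using key x0 by (fastforce simp: T_def bdd_above_def)
    have lo: "c - norm (y - z) \<le> \<alpha>" if "(y, c) \<in> M" for y c
      unfolding \<alpha>_def by (rule cSup_upper[OF _ Tbd]) (use that in \<open>auto simp: T_def\<close>)
    have hi: "\<alpha> \<le> norm (y + z) - c" if "(y, c) \<in> M" for y c
      unfolding \<alpha>_def by (rule cSup_least[OF Tne]) (use that key in \<open>auto simp: T_def\<close>)
    define N where "N = span (insert (z, \<alpha>) M)"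
    have "c \<le> norm y" if "(y, c) \<in> N" for y c
    proof -
      have "span M = M" using sub by (rule span_eq_iff[THEN iffD2])
      then have "\<exists>k. (y, c) - k *\<^sub>R (z, \<alpha>) \<in> M"
        using that by (simp only: N_def span_breakdown_eq)
      then obtain k where k: "(y, c) - k *\<^sub>R (z, \<alpha>) \<in> M" by (rule exE)
      define y1 c1 where "y1 = y - k *\<^sub>R z" and "c1 = c - k * \<alpha>"
      have yc: "y = y1 + k *\<^sub>R z" "c = c1 + k * \<alpha>" and M1: "(y1, c1) \<in> M"
        using k by (auto simp: y1_def c1_def)
      have sc: "(m *\<^sub>R y1, m * c1) \<in> M" for m using subspace_scale[OF sub M1, of m] by simp
      consider "k = 0" | "k > 0" | "k < 0" by linarith
      then show ?thesis
      proof cases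
        case 1 then show ?thesis using bd M1 yc by auto
      next
        case 2
        have "k * \<alpha> \<le> k * (norm ((1/k) *\<^sub>R y1 + z) - (1/k) * c1)"
          using hi[OF sc[of "1/k"]] 2 by (intro mult_left_mono) simp_all
        also have "\<dots> = norm (k *\<^sub>R ((1/k) *\<^sub>R y1 + z)) - c1"
          unfolding norm_scaleR using 2 by (simp add: right_diff_distrib)
        also have "k *\<^sub>R ((1/k) *\<^sub>R y1 + z) = y" using 2 yc by (simp add: scaleR_add_right)
        finally show ?thesis using yc by simp
      next
        case 3
        define m where "m = - k"
        have m: "m > 0" "k = - m" using 3 by (auto simp: m_def)
        have A: "m * ((1/m) * c1 - norm ((1/m) *\<^sub>R y1 - z)) \<le> m * \<alpha>"
          using lo[OF sc[of "1/m"]] m by (intro mult_left_mono) simp_all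
        have B: "m * ((1/m) * c1 - norm ((1/m) *\<^sub>R y1 - z)) = c1 - norm (m *\<^sub>R ((1/m) *\<^sub>R y1 - z))"
          unfolding norm_scaleR using m by (simp add: right_diff_distrib)
        have C: "m *\<^sub>R ((1/m) *\<^sub>R y1 - z) = y" using m yc by (simp add: scaleR_diff_right)
        have "c1 - norm y \<le> m * \<alpha>" using A by (simp only: B C)
        then show ?thesis using yc(2) m(2) by simp
      qed
    qed
    then have "N \<in> S" using x0 by (auto simp: S_def N_def span_base)
    moreover have "M \<subseteq> N" by (auto simp: N_def span_base)
    ultimately have "N = M" using max by blast
    then show ?thesis by (auto simp: N_def intro: span_base)
  qed
  then obtain l where l: "\<And>z. (z, l z) \<in> M" by metis
  have uniq: "c = l y" if "(y, c) \<in> M" for y c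
    using bd[of 0 "c - l y"] bd[of 0 "l y - c"] subspace_diff[OF sub that l[of y]]
      subspace_diff[OF sub l[of y] that] by auto
  have le: "\<bar>l y\<bar> \<le> norm y" for y
    using bd[OF l, of y] bd[of "-y" "- l y"] subspace_neg[OF sub l[of y]] by auto
  have "bounded_linear l"
  proof (rule bounded_linear_intro[where K = 1])
    show "l (x + y) = l x + l y" for x y
      using uniq subspace_add[OF sub l[of x] l[of y]] by auto
    show "l (r *\<^sub>R x) = r *\<^sub>R l x" for r x
      using uniq subspace_scale[OF sub l[of x], of r] by auto
    show "norm (l x) \<le> norm x * 1" for x using le by simp
  qed
  then show ?thesis using that le uniq[OF x0] by auto
qed

lemma functionals_separate:
  fixes x y :: "'a::real_normed_vector"
  assumes "\<And>l :: 'a \<Rightarrow> real. bounded_linear l \<Longrightarrow> l x = l y"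
  shows "x = y"
proof -
  obtain l :: "'a \<Rightarrow> real" where l: "bounded_linear l" "l (x - y) = norm (x - y)"
    using hahn_banach_norming by blast
  then show ?thesis using assms[OF l(1)] linear_diff[OF bounded_linear.linear[OF l(1)]] by simp
qed

section \<open>Bochner integrals without separability\<close>

text \<open>Convergence everywhere, not only almost everywhere: continuous scalar functions of such an \<open>f\<close>
  are then Borel measurable, as the integral of the library requires.\<close>

definition simple_limit :: "'m measure \<Rightarrow> ('m \<Rightarrow> 'b::real_normed_vector) \<Rightarrow> bool" where
  "simple_limit M f \<longleftrightarrow>
    (\<exists>s. (\<forall>i. simple_function M (s i)) \<and> (\<forall>x\<in>space M. (\<lambda>i::nat. s i x) \<longlonglongrightarrow> f x))"

lemma simple_limit_strongly_measurable: "simple_limit M f \<Longrightarrow> strongly_measurable M f"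
  unfolding simple_limit_def strongly_measurable_def by blast

text \<open>Function and approximations are both set to 0 on an exceptional null set. Integrals and
  convolutions do not see this change, so later proofs may assume convergence everywhere.\<close>

lemma strongly_measurable_version:
  assumes "strongly_measurable M f"
  obtains f' where "simple_limit M f'" "AE x in M. f' x = f x"
proof -
  obtain s where s: "\<And>i. simple_function M (s i)" "AE x in M. (\<lambda>i::nat. s i x) \<longlonglongrightarrow> f x"
    using assms unfolding strongly_measurable_def by blast
  obtain N where N: "{x \<in> space M. \<not> (\<lambda>i::nat. s i x) \<longlonglongrightarrow> f x} \<subseteq> N" "N \<in> null_sets M"
    using s(2) by (auto elim!: AE_E simp: null_sets_def)
  define f' where "f' x = (if x \<in> N then 0 else f x)" for x
  define s' where "s' i x = (if x \<in> N then 0 else s i x)" for i x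
  have "simple_function M (s' i)" for i
    unfolding s'_def using N(2) s(1) by (intro simple_function_If_set) auto
  moreover have "(\<lambda>i. s' i x) \<longlonglongrightarrow> f' x" if "x \<in> space M" for x
    using N(1) that by (auto simp: s'_def f'_def)
  ultimately have "simple_limit M f'" unfolding simple_limit_def by blast
  moreover have "AE x in M. f' x = f x"
    using AE_not_in[OF N(2)] by eventually_elim (auto simp: f'_def)
  ultimately show ?thesis using that by blast
qed

lemma simple_limit_compose:
  assumes "simple_limit M f" "continuous_on UNIV g"
  shows "simple_limit M (\<lambda>x. g (f x))"
proof -
  obtain s where s: "\<And>i. simple_function M (s i)" "\<And>x. x \<in> space M \<Longrightarrow> (\<lambda>i::nat. s i x) \<longlonglongrightarrow> f x"
    using assms unfolding simple_limit_def by blast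
  have "(\<lambda>i. g (s i x)) \<longlonglongrightarrow> g (f x)" if "x \<in> space M" for x
    using continuous_on_tendsto_compose[OF assms(2) s(2)[OF that]] by simp
  then show ?thesis unfolding simple_limit_def
    using s(1) by (intro exI[of _ "\<lambda>i x. g (s i x)"]) (auto intro: simple_function_compose1)
qed

lemma simple_limit_compose2:
  assumes "simple_limit M f" "simple_limit M g" "continuous_on UNIV (\<lambda>(x, y). h x y)"
  shows "simple_limit M (\<lambda>x. h (f x) (g x))"
proof -
  obtain s where s: "\<And>i. simple_function M (s i)" "\<And>x. x \<in> space M \<Longrightarrow> (\<lambda>i::nat. s i x) \<longlonglongrightarrow> f x"
    using assms unfolding simple_limit_def by blast
  obtain t where t: "\<And>i. simple_function M (t i)" "\<And>x. x \<in> space M \<Longrightarrow> (\<lambda>i::nat. t i x) \<longlonglongrightarrow> g x"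
    using assms unfolding simple_limit_def by blast
  have "(\<lambda>i. h (s i x) (t i x)) \<longlonglongrightarrow> h (f x) (g x)" if "x \<in> space M" for x
    using continuous_on_tendsto_compose[OF assms(3) tendsto_Pair[OF s(2)[OF that] t(2)[OF that]]] by simp
  then show ?thesis unfolding simple_limit_def
    using s(1) t(1) by (intro exI[of _ "\<lambda>i x. h (s i x) (t i x)"]) (auto intro: simple_function_compose2)
qed

lemma simple_limit_measurable_compose:
  assumes "simple_limit M f" and T: "T \<in> measurable N M"
  shows "simple_limit N (\<lambda>x. f (T x))"
proof -
  obtain s where s: "\<And>i. simple_function M (s i)" "\<And>x. x \<in> space M \<Longrightarrow> (\<lambda>i::nat. s i x) \<longlonglongrightarrow> f x"
    using assms unfolding simple_limit_def by blast
  have "simple_function N (\<lambda>x. s i (T x))" for i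
    using simple_function_comp[OF T s(1)[of i]] by (simp add: comp_def)
  then show ?thesis unfolding simple_limit_def
    using s(2) measurable_space[OF T] by (intro exI[of _ "\<lambda>i x. s i (T x)"]) auto
qed

lemma simple_limit_borel_measurable:
  fixes f :: "'m \<Rightarrow> 'b::{real_normed_vector, second_countable_topology}"
  assumes "simple_limit M f"
  shows "f \<in> borel_measurable M"
proof -
  obtain s where s: "\<And>i. simple_function M (s i)" "\<And>x. x \<in> space M \<Longrightarrow> (\<lambda>i::nat. s i x) \<longlonglongrightarrow> f x"
    using assms unfolding simple_limit_def by blast
  show ?thesis
    by (rule borel_measurable_LIMSEQ_metric[OF borel_measurable_simple_function[OF s(1)] s(2)])
qed

lemma borel_measurable_simple_limit:
  fixes f :: "'m \<Rightarrow> 'b::{real_normed_vector, second_countable_topology}"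
  assumes "f \<in> borel_measurable M"
  shows "simple_limit M f"
  using borel_measurable_implies_sequence_metric[OF assms, of 0] unfolding simple_limit_def by blast

lemma simple_limit_norm_measurable:
  assumes "simple_limit M f"
  shows "(\<lambda>x. norm (f x)) \<in> borel_measurable M"
  by (rule simple_limit_borel_measurable[OF simple_limit_compose[OF assms]]) (intro continuous_intros)

lemma simple_limit_diff: "simple_limit M f \<Longrightarrow> simple_limit M g \<Longrightarrow> simple_limit M (\<lambda>x. f x - g x)"
  by (erule (1) simple_limit_compose2) (auto simp: case_prod_beta intro!: continuous_intros)

lemma simple_function_simple_limit: "simple_function M s \<Longrightarrow> simple_limit M s"
  unfolding simple_limit_def by (intro exI[of _ "\<lambda>n. s"]) auto

lemma strongly_measurable_cong_AE:
  assumes "AE x in M. f x = g x" "strongly_measurable M f"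
  shows "strongly_measurable M g"
proof -
  obtain s where s: "\<And>i. simple_function M (s i)" "AE x in M. (\<lambda>i::nat. s i x) \<longlonglongrightarrow> f x"
    using assms unfolding strongly_measurable_def by blast
  have "AE x in M. (\<lambda>i::nat. s i x) \<longlonglongrightarrow> g x" using s(2) assms(1) by eventually_elim simp
  then show ?thesis using s(1) unfolding strongly_measurable_def by blast
qed

lemma has_Bochner_integral_cong_AE:
  assumes "AE x in M. f x = g x" "has_Bochner_integral M f I"
  shows "has_Bochner_integral M g I"
proof -
  have "(\<integral>\<^sup>+x. ennreal (norm (f x - s x)) \<partial>M) = (\<integral>\<^sup>+x. ennreal (norm (g x - s x)) \<partial>M)" for s
    by (rule nn_integral_cong_AE) (use assms(1) in \<open>eventually_elim, simp\<close>)
  then show ?thesis using assms strongly_measurable_cong_AE[OF assms(1)]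
    unfolding has_Bochner_integral_def by auto
qed

lemma Bochner_integral_cong_AE:
  assumes "AE x in M. f x = g x"
  shows "Bochner_integrable M f = Bochner_integrable M g" "Bochner_integral M f = Bochner_integral M g"
proof -
  have "AE x in M. g x = f x" using assms by eventually_elim simp
  then have "has_Bochner_integral M f = has_Bochner_integral M g"
    using has_Bochner_integral_cong_AE assms by blast
  then show "Bochner_integrable M f = Bochner_integrable M g" "Bochner_integral M f = Bochner_integral M g"
    by (simp_all add: Bochner_integrable_def Bochner_integral_def)
qed

abbreviation "sbintegrable \<equiv> Bochner_Integration.simple_bochner_integrable"
abbreviation "sbintegral \<equiv> Bochner_Integration.simple_bochner_integral"

text \<open>Applying \<open>l\<close> to the approximating simple functions yields approximations in
  the sense of the library's own integral. Through this bridge Fubini, dominated convergence and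
  changes of variables become available for vector-valued functions.\<close>

lemma has_Bochner_integral_functional:
  fixes l :: "'b::real_normed_vector \<Rightarrow> 'c::{banach, second_countable_topology}"
  assumes f: "simple_limit M f" and I: "has_Bochner_integral M f I" and l: "bounded_linear l"
  shows "has_bochner_integral M (\<lambda>x. l (f x)) (l I)"
proof -
  interpret l: bounded_linear l by fact
  obtain B where B: "\<And>x. norm (l x) \<le> norm x * B" "B \<ge> 0" using l.nonneg_bounded by blast
  obtain s where s: "\<And>i. sbintegrable M (s i)"
    and lim: "(\<lambda>i::nat. \<integral>\<^sup>+x. ennreal (norm (f x - s i x)) \<partial>M) \<longlonglongrightarrow> 0"
    and slim: "(\<lambda>i. sbintegral M (s i)) \<longlonglongrightarrow> I"
    using I unfolding has_Bochner_integral_def by blast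
  have sf: "simple_function M (s i)" for i using s[of i] by (auto elim: simple_bochner_integrable.cases)
  have nm: "(\<lambda>x. norm (f x - s i x)) \<in> borel_measurable M" for i
    by (intro simple_limit_norm_measurable simple_limit_diff f simple_function_simple_limit sf)
  show ?thesis
  proof (rule has_bochner_integral.intros)
    show "(\<lambda>x. l (f x)) \<in> borel_measurable M"
      by (intro simple_limit_borel_measurable simple_limit_compose[OF f]
            linear_continuous_on_compose continuous_on_id l.linear_axioms linear_continuous_on l)
    show "sbintegrable M (\<lambda>x. l (s i x))" for i
      using simple_bochner_integrable_compose2[OF _ s s, of "\<lambda>x y. l x"] by (simp add: l.zero)
    show "(\<lambda>i. \<integral>\<^sup>+x. ennreal (norm (l (f x) - l (s i x))) \<partial>M) \<longlonglongrightarrow> 0"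
    proof (rule tendsto_sandwich[OF _ _ tendsto_const])
      show "\<forall>\<^sub>F i in sequentially. (\<integral>\<^sup>+x. ennreal (norm (l (f x) - l (s i x))) \<partial>M)
          \<le> B * (\<integral>\<^sup>+x. ennreal (norm (f x - s i x)) \<partial>M)"
      proof (intro always_eventually allI)
        fix i
        have "(\<integral>\<^sup>+x. ennreal (norm (l (f x) - l (s i x))) \<partial>M)
            \<le> (\<integral>\<^sup>+x. ennreal B * ennreal (norm (f x - s i x)) \<partial>M)"
          by (intro nn_integral_mono)
             (use B in \<open>auto simp: l.diff[symmetric] ennreal_mult[symmetric] mult.commute intro!: ennreal_leI\<close>)
        also have "\<dots> = B * (\<integral>\<^sup>+x. ennreal (norm (f x - s i x)) \<partial>M)"
          using nm[of i] by (intro nn_integral_cmult) auto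
        finally show "(\<integral>\<^sup>+x. ennreal (norm (l (f x) - l (s i x))) \<partial>M)
          \<le> B * (\<integral>\<^sup>+x. ennreal (norm (f x - s i x)) \<partial>M)" .
      qed
      have "(\<lambda>i. ennreal B * (\<integral>\<^sup>+x. ennreal (norm (f x - s i x)) \<partial>M)) \<longlonglongrightarrow> ennreal B * 0"
        by (intro ennreal_tendsto_cmult lim) auto
      then show "(\<lambda>i. ennreal B * (\<integral>\<^sup>+x. ennreal (norm (f x - s i x)) \<partial>M)) \<longlonglongrightarrow> 0" by simp
    qed auto
    show "(\<lambda>i. sbintegral M (\<lambda>x. l (s i x))) \<longlonglongrightarrow> l I"
      using l.tendsto[OF slim] by (simp only: simple_bochner_integral_linear[OF l.linear_axioms s])
  qed
qed

lemma has_Bochner_integral_unique: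
  assumes "has_Bochner_integral M f I" "has_Bochner_integral M f J"
  shows "I = J"
proof (rule functionals_separate)
  fix l :: "'b \<Rightarrow> real" assume l: "bounded_linear l"
  obtain f' where f': "simple_limit M f'" "AE x in M. f' x = f x"
    using strongly_measurable_version assms(1) unfolding has_Bochner_integral_def by blast
  have ae: "AE x in M. f x = f' x" using f'(2) by eventually_elim simp
  show "l I = l J"
    using has_Bochner_integral_functional[OF f'(1) _ l] has_Bochner_integral_cong_AE[OF ae] assms
      has_bochner_integral_eq by blast
qed

lemma Bochner_integral_has: "Bochner_integrable M f \<Longrightarrow> has_Bochner_integral M f (Bochner_integral M f)"
  unfolding Bochner_integral_def Bochner_integrable_def
  by (auto simp del: split_paired_Ex intro: theI has_Bochner_integral_unique)

lemma Bochner_integral_functional: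
  fixes l :: "'b::real_normed_vector \<Rightarrow> 'c::{banach, second_countable_topology}"
  assumes "simple_limit M f" "Bochner_integrable M f" "bounded_linear l"
  shows "integrable M (\<lambda>x. l (f x))" "l (Bochner_integral M f) = (LINT x|M. l (f x))"
  using has_Bochner_integral_functional[OF assms(1) Bochner_integral_has[OF assms(2)] assms(3)]
  by (auto simp: has_bochner_integral_iff)

lemma Bochner_integrableI:
  fixes f :: "'m \<Rightarrow> 'b::banach"
  assumes f: "simple_limit M f" and int: "integrable M (\<lambda>x. norm (f x))"
  shows "Bochner_integrable M f"
proof -
  obtain s where s: "\<And>i. simple_function M (s i)" "\<And>x. x \<in> space M \<Longrightarrow> (\<lambda>i::nat. s i x) \<longlonglongrightarrow> f x"
    using f unfolding simple_limit_def by blast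
  have nf[measurable]: "(\<lambda>x. norm (f x)) \<in> borel_measurable M" by (rule simple_limit_norm_measurable[OF f])
  have [measurable]: "(\<lambda>x. norm (s i x)) \<in> borel_measurable M" for i
    by (intro simple_limit_norm_measurable simple_function_simple_limit s)
  \<comment> \<open>Truncation makes the approximations dominated by \<open>2 * norm (f x)\<close>.
    Any factor above 1 would do: where \<open>f x \<noteq> 0\<close> the original approximations
    eventually obey the bound, and where \<open>f x = 0\<close> the truncated ones vanish.\<close>
  define A where "A i = {x \<in> space M. norm (s i x) \<le> 2 * norm (f x)}" for i
  have [measurable]: "A i \<in> sets M" for i unfolding A_def by measurable
  define t where "t i x = (if x \<in> A i then s i x else 0)" for i x
  have t: "simple_function M (t i)" for i
    unfolding t_def using s(1) by (intro simple_function_If_set) auto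
  have tle: "norm (t i x) \<le> 2 * norm (f x)" for i x by (auto simp: t_def A_def)
  have tlim: "(\<lambda>i. t i x) \<longlonglongrightarrow> f x" if x: "x \<in> space M" for x
  proof (cases "f x = 0")
    case True
    then have "t i x = 0" for i using tle[of i x] by simp
    then show ?thesis using True by simp
  next
    case False
    have "\<forall>\<^sub>F i in sequentially. norm (s i x) < 2 * norm (f x)"
      using False by (intro order_tendstoD(2)[OF tendsto_norm[OF s(2)[OF x]]]) auto
    then have "\<forall>\<^sub>F i in sequentially. s i x = t i x"
      by eventually_elim (auto simp: t_def A_def x)
    then show ?thesis by (rule Lim_transform_eventually[OF s(2)[OF x]])
  qed
  have diffm: "(\<lambda>x. norm (f x - t i x)) \<in> borel_measurable M" for i
    by (intro simple_limit_norm_measurable simple_limit_diff f simple_function_simple_limit t)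
  have dle: "norm (f x - t i x) \<le> 3 * norm (f x)" for i x
    using tle[of i x] norm_triangle_ineq4[of "f x" "t i x"] by linarith
  let ?N = "\<lambda>i. \<integral>\<^sup>+x. ennreal (norm (f x - t i x)) \<partial>M"
  have sbi: "sbintegrable M (t i)" for i
  proof (rule simple_bochner_integrableI_bounded[OF t])
    have "(\<integral>\<^sup>+x. ennreal (norm (t i x)) \<partial>M) \<le> (\<integral>\<^sup>+x. ennreal (norm (2 * norm (f x))) \<partial>M)"
      by (intro nn_integral_mono ennreal_leI) (simp add: tle)
    also have "\<dots> < \<infinity>"
      using integrable_mult_right[OF int, of 2] unfolding integrable_iff_bounded by blast
    finally show "(\<integral>\<^sup>+x. ennreal (norm (t i x)) \<partial>M) < \<infinity>" .
  qed
  have lim: "?N \<longlonglongrightarrow> 0"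
  proof -
    have "(\<lambda>i::nat. LINT x|M. norm (f x - t i x)) \<longlonglongrightarrow> (LINT x|M. 0)"
    proof (rule integral_dominated_convergence[where w = "\<lambda>x. 3 * norm (f x)"])
      show "AE x in M. (\<lambda>i. norm (f x - t i x)) \<longlonglongrightarrow> 0"
      proof (rule AE_I2)
        fix x assume "x \<in> space M"
        then have "(\<lambda>i. norm (f x - t i x)) \<longlonglongrightarrow> norm (f x - f x)" by (intro tendsto_intros tlim)
        then show "(\<lambda>i. norm (f x - t i x)) \<longlonglongrightarrow> 0" by simp
      qed
      show "AE x in M. norm (norm (f x - t i x)) \<le> 3 * norm (f x)" for i
        using dle[of _ i] by simp
    qed (use int diffm in auto)
    moreover have "?N i = ennreal (LINT x|M. norm (f x - t i x))" for i
    proof (rule nn_integral_eq_integral)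
      show "integrable M (\<lambda>x. norm (f x - t i x))"
        using dle[of _ i]
        by (intro Bochner_Integration.integrable_bound[OF integrable_mult_right[OF int, of 3] diffm] AE_I2) simp
    qed auto
    ultimately show ?thesis using tendsto_ennrealI[of "\<lambda>i. LINT x|M. norm (f x - t i x)" 0] by simp
  qed
  let ?I = "\<lambda>i. sbintegral M (t i)"
  have "Cauchy ?I"
  proof (rule metric_CauchyI)
    fix e :: real assume e: "e > 0"
    have "\<forall>\<^sub>F i in sequentially. ?N i < ennreal (e/2)"
      using order_tendstoD(2)[OF lim, of "ennreal (e/2)"] e by simp
    then obtain n0 where n0: "\<And>i. i \<ge> n0 \<Longrightarrow> ?N i < ennreal (e/2)"
      by (auto simp: eventually_sequentially)
    have "dist (?I i)
        (?I j) < e" if "i \<ge> n0" "j \<ge> n0" for i j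
    proof -
      have sd: "sbintegrable M (\<lambda>x. norm (t i x - t j x))"
        using simple_bochner_integrable_compose2[OF _ sbi[of i] sbi[of j], of "\<lambda>x y. norm (x - y)"] by simp
      have sd': "sbintegrable M (\<lambda>x. t i x - t j x)"
        using simple_bochner_integrable_compose2[OF _ sbi[of i] sbi[of j], of "(-)"] by simp
      have "ennreal (norm (?I i
          - ?I j))
          \<le> ennreal (sbintegral M (\<lambda>x. norm (t i x - t j x)))"
        using simple_bochner_integral_norm_bound[OF sd'] simple_bochner_integral_diff[OF sbi[of i] sbi[of j]]
        by (intro ennreal_leI) simp
      also have "\<dots> = (\<integral>\<^sup>+x. ennreal (norm (t i x - t j x)) \<partial>M)"
        by (rule simple_bochner_integral_eq_nn_integral[OF sd]) auto
      also have "\<dots> \<le> (\<integral>\<^sup>+x. ennreal (norm (f x - t i x)) + ennreal (norm (f x - t j x)) \<partial>M)"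
      proof (intro nn_integral_mono)
        fix x
        have "norm (t i x - t j x) \<le> norm (f x - t i x) + norm (f x - t j x)"
          using norm_triangle_ineq4[of "f x - t j x" "f x - t i x"] by simp
        then show "ennreal (norm (t i x - t j x)) \<le> ennreal (norm (f x - t i x)) + ennreal (norm (f x - t j x))"
          by (simp add: ennreal_leI flip: ennreal_plus)
      qed
      also have "\<dots> = ?N i + ?N j"
        by (intro nn_integral_add) (use diffm in auto)
      also have "\<dots> < ennreal (e/2) + ennreal (e/2)"
        by (intro add_strict_mono n0 that)
      also have "\<dots> = ennreal e" using e by (simp flip: ennreal_plus)
      finally show ?thesis using e by (simp add: dist_norm ennreal_less_iff)
    qed
    then show "\<exists>M0. \<forall>m\<ge>M0. \<forall>n\<ge>M0. dist (?I m)
        (?I n) < e" by blast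
  qed
  then obtain I where "?I \<longlonglongrightarrow> I"
    using Cauchy_convergent convergent_def by blast
  then show ?thesis
    unfolding Bochner_integrable_def has_Bochner_integral_def
    using simple_limit_strongly_measurable[OF f] sbi lim by blast
qed

lemma norm_Bochner_integral_le:
  fixes f :: "'m \<Rightarrow> 'b::banach"
  assumes f: "simple_limit M f" and int: "integrable M (\<lambda>x. norm (f x))"
  shows "norm (Bochner_integral M f) \<le> (LINT x|M. norm (f x))"
proof -
  obtain l :: "'b \<Rightarrow> real" where l: "bounded_linear l" "l (Bochner_integral M f) = norm (Bochner_integral M f)"
     "\<And>y. \<bar>l y\<bar> \<le> norm y" using hahn_banach_norming by blast
  have "norm (Bochner_integral M f) = (LINT x|M. l (f x))"
    using Bochner_integral_functional[OF f Bochner_integrableI[OF f int] l(1)] l(2) by simp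
  also have "\<dots> \<le> (LINT x|M. norm (f x))"
    using Bochner_integral_functional[OF f Bochner_integrableI[OF f int] l(1)] int l(3)
    by (intro integral_mono) (auto simp: abs_le_iff)
  finally show ?thesis .
qed

section \<open>Functions on the line: reflection, continuity off 0, bounded representatives\<close>

lemma AE_lborel_reflect:
  fixes t :: real
  assumes "AE x in lborel. P x"
  shows "AE x in lborel. P (t - x)"
proof -
  obtain N where N: "{x. \<not> P x} \<subseteq> N" "N \<in> null_sets lborel"
    using assms by (auto elim!: AE_E simp: null_sets_def)
  have "AE x in lborel. t + (-1) * x \<notin> N"
    using N(2) by (intro AE_borel_affine AE_not_in) (auto simp: null_sets_def)
  then show ?thesis by eventually_elim (use N(1) in auto)
qed

lemma simple_limit_reflect:
  fixes f :: "real \<Rightarrow> 'b::real_normed_vector"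
  shows "simple_limit lborel f \<Longrightarrow> simple_limit lborel (\<lambda>s. f (t - s))"
  by (erule simple_limit_measurable_compose) simp

text \<open>Composing \<open>f\<close> with simple functions that converge to the identity of the
  line approximates it. The point 0 is a separate piece because the kernels below are controlled
  only away from it.\<close>

lemma simple_limit_continuous_off_0:
  fixes f :: "real \<Rightarrow> 'b::real_normed_vector"
  assumes "\<And>t. t \<noteq> 0 \<Longrightarrow> isCont f t"
  shows "simple_limit lborel f"
proof -
  obtain r :: "nat \<Rightarrow> real \<Rightarrow> real" where r: "\<And>i. simple_function lborel (r i)" "\<And>t. (\<lambda>i. r i t) \<longlonglongrightarrow> t"
    using borel_measurable_implies_sequence_metric[of "\<lambda>t. t" lborel 0] by auto
  have "simple_function lborel (\<lambda>t. if t \<in> {0} then f 0 else f (r i t))" for i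
    by (intro simple_function_If_set simple_function_compose1[OF r(1)]) auto
  moreover have "(\<lambda>i. if t \<in> {0} then f 0 else f (r i t)) \<longlonglongrightarrow> f t" for t
    using isCont_tendsto_compose[OF assms r(2)] by (cases "t = 0") auto
  ultimately show ?thesis
    unfolding simple_limit_def by (intro exI[of _ "\<lambda>i t. if t \<in> {0} then f 0 else f (r i t)"]) simp
qed

lemma simple_limit_continuous:
  fixes f :: "real \<Rightarrow> 'b::real_normed_vector"
  shows "continuous_on UNIV f \<Longrightarrow> simple_limit lborel f"
  by (rule simple_limit_continuous_off_0) (auto simp: continuous_on_eq_continuous_at)

text \<open>A truncation at the essential bound, on top of the change on a null set, gives a bound
  at every point, as the pointwise estimates of convolutions require.\<close>

lemma L_infinity_version:
  assumes "\<phi> \<in> L_infinity"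
  obtains \<phi>' C where "simple_limit lborel \<phi>'" "\<And>t. norm (\<phi>' t) \<le> C" "AE t in lborel. \<phi>' t = \<phi> t"
proof -
  obtain C where sm: "strongly_measurable lborel \<phi>" and C: "AE t in lborel. norm (\<phi> t) \<le> C"
    using assms unfolding L_infinity_def by blast
  obtain p where p: "simple_limit lborel p" "AE x in lborel. p x = \<phi> x"
    using strongly_measurable_version[OF sm] by blast
  have [measurable]: "(\<lambda>x. norm (p x)) \<in> borel_measurable lborel" by (rule simple_limit_norm_measurable[OF p(1)])
  have "simple_limit lborel (\<lambda>t. (if norm (p t) \<le> C then 1 else 0 :: real) *\<^sub>R p t)"
    by (rule simple_limit_compose2[OF borel_measurable_simple_limit p(1)])
       (measurable, auto simp: case_prod_beta intro!: continuous_intros)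
  moreover have "norm ((if norm (p t) \<le> C then 1 else 0 :: real) *\<^sub>R p t) \<le> max C 0" for t by auto
  moreover have "AE t in lborel. (if norm (p t) \<le> C then 1 else 0 :: real) *\<^sub>R p t = \<phi> t"
    using p(2) C by eventually_elim auto
  ultimately show ?thesis using that by blast
qed

lemma convolution_cong_AE:
  assumes "AE x in lborel. g x = g' x" "AE x in lborel. h x = h' x"
  shows "convolution m g h = convolution m g' h'"
proof (rule ext)
  fix t
  have "AE s in lborel. m (g s) (h (t - s)) = m (g' s) (h' (t - s))"
    using assms(1) AE_lborel_reflect[OF assms(2), of t] by eventually_elim simp
  then show "convolution m g h t = convolution m g' h' t"
    unfolding convolution_def by (rule Bochner_integral_cong_AE(2))
qed

lemma (in bounded_bilinear) simple_limit_prod: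
  assumes "simple_limit M f" "simple_limit M g"
  shows "simple_limit M (\<lambda>x. prod (f x) (g x))"
  by (rule simple_limit_compose2[OF assms])
     (auto simp: case_prod_beta intro!: continuous_on continuous_intros)

lemma integrable_norm_bilinear:
  assumes b: "bounded_bilinear b" and f: "simple_limit lborel f" "integrable lborel (\<lambda>s. norm (f s))"
    and g: "simple_limit lborel g" "\<And>s. norm (g s) \<le> C"
  shows "simple_limit lborel (\<lambda>s. b (f s) (g s))" "integrable lborel (\<lambda>s. norm (b (f s) (g s)))"
proof -
  interpret b: bounded_bilinear b by fact
  obtain K where K: "\<And>x y. norm (b x y) \<le> norm x * norm y * K" "K > 0" using b.pos_bounded by blast
  show sl: "simple_limit lborel (\<lambda>s. b (f s) (g s))" by (rule b.simple_limit_prod[OF f(1) g(1)])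
  have C: "C \<ge> 0" using g(2)[of undefined] norm_ge_zero[of "g undefined"] by linarith
  show "integrable lborel (\<lambda>s. norm (b (f s) (g s)))"
  proof (rule Bochner_Integration.integrable_bound[OF integrable_mult_right[OF f(2), of "C * K"]
        simple_limit_norm_measurable[OF sl]], rule AE_I2)
    fix s
    have "norm (b (f s) (g s)) \<le> norm (f s) * norm (g s) * K" by (rule K)
    also have "\<dots> \<le> norm (f s) * C * K" using K(2) g(2) by (intro mult_right_mono mult_left_mono) auto
    finally show "norm (norm (b (f s) (g s))) \<le> norm (C * K * norm (f s))" using K(2) C
      by (simp add: mult_ac)
  qed
qed

section \<open>Complex scalars\<close>

lemma scaleC_bounded_bilinear: "bounded_bilinear ((*\<^sub>C) :: complex \<Rightarrow> 'a::complex_banach \<Rightarrow> 'a)"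
proof (rule bounded_bilinear.intro)
  show "(r *\<^sub>R c) *\<^sub>C x = r *\<^sub>R (c *\<^sub>C x)" for r c and x :: 'a
    unfolding scaleR_conv_of_real[of r c] by (simp add: scaleC_of_real[symmetric] scaleC_scaleC)
  show "c *\<^sub>C (r *\<^sub>R x) = r *\<^sub>R (c *\<^sub>C x)" for r c and x :: 'a
    by (simp add: scaleC_of_real[symmetric] scaleC_scaleC mult.commute)
  show "\<exists>K. \<forall>c x. norm (c *\<^sub>C x :: 'a) \<le> norm c * norm x * K"
    by (intro exI[of _ 1]) (simp add: norm_scaleC)
qed (auto simp: scaleC_add_left scaleC_add_right)

interpretation scaleC: bounded_bilinear "(*\<^sub>C) :: complex \<Rightarrow> 'a::complex_banach \<Rightarrow> 'a"
  by (rule scaleC_bounded_bilinear)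

lemmas [continuous_intros] = scaleC.continuous_on scaleC.continuous
lemmas [tendsto_intros] = scaleC.tendsto

lemma scaleC_one [simp]: "1 *\<^sub>C x = (x :: 'a::complex_banach)"
  using scaleC_of_real[of 1 x] by simp

text \<open>The symbol of the kernel is operator-valued, and the theory of inverse transforms is
  developed once for all complex Banach spaces. The instance consists of real-linear operators;
  complex linearity of the kernel is recovered in \<open>G_complex_linear\<close>.\<close>

instantiation blinfun :: (real_normed_vector, complex_banach) complex_banach
begin

definition scaleC_blinfun :: "complex \<Rightarrow> ('a \<Rightarrow>\<^sub>L 'b) \<Rightarrow> ('a \<Rightarrow>\<^sub>L 'b)" where
  "scaleC_blinfun c T = Blinfun (\<lambda>x. c *\<^sub>C blinfun_apply T x)"

lemma scaleC_blinfun_apply: "blinfun_apply (c *\<^sub>C T) x = c *\<^sub>C blinfun_apply (T :: 'a \<Rightarrow>\<^sub>L 'b) x"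
  unfolding scaleC_blinfun_def
  by (subst bounded_linear_Blinfun_apply)
     (auto intro: bounded_linear_compose[OF scaleC.bounded_linear_right blinfun.bounded_linear_right])

instance
proof
  fix c d :: complex and r :: real and x y :: "'a \<Rightarrow>\<^sub>L 'b"
  show "c *\<^sub>C (x + y) = c *\<^sub>C x + c *\<^sub>C y" "(c + d) *\<^sub>C x = c *\<^sub>C x + d *\<^sub>C x"
    "c *\<^sub>C d *\<^sub>C x = (c * d) *\<^sub>C x" "complex_of_real r *\<^sub>C x = r *\<^sub>R x"
    by (auto intro!: blinfun_eqI simp: scaleC_blinfun_apply blinfun.add_left blinfun.scaleR_left
        scaleC_add_right scaleC_add_left scaleC_scaleC scaleC_of_real)
  show "norm (c *\<^sub>C x) = cmod c * norm x"
  proof (rule antisym)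
    have le: "norm (c *\<^sub>C T) \<le> cmod c * norm T" for c and T :: "'a \<Rightarrow>\<^sub>L 'b"
      by (rule norm_blinfun_bound)
         (auto simp: scaleC_blinfun_apply norm_scaleC mult.assoc intro!: mult_left_mono norm_blinfun)
    show "norm (c *\<^sub>C x) \<le> cmod c * norm x" by (rule le)
    show "cmod c * norm x \<le> norm (c *\<^sub>C x)"
    proof (cases "c = 0")
      case False
      have "x = inverse c *\<^sub>C (c *\<^sub>C x)"
        using False by (auto intro!: blinfun_eqI simp: scaleC_blinfun_apply scaleC_scaleC)
      then have "norm x \<le> cmod (inverse c) * norm (c *\<^sub>C x)" using le by metis
      then show ?thesis using False by (simp add: norm_divide field_simps)
    qed simp
  qed
qed

end

lemma scaleC_complex [simp]: "(c :: complex) *\<^sub>C z = c * z"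
  by (simp add: scaleC_complex_def)

text \<open>The complex-linear functional with real part \<open>l\<close>. It carries the real
  Hahn-Banach theorem over to functionals through which complex scalars can be pulled.\<close>

definition complexify :: "('a::complex_banach \<Rightarrow> real) \<Rightarrow> 'a \<Rightarrow> complex" where
  "complexify l x = Complex (l x) (- l (\<i> *\<^sub>C x))"

lemma complexify:
  assumes "bounded_linear l"
  shows "bounded_linear (complexify l)" "complexify l (c *\<^sub>C x) = c * complexify l x"
proof -
  interpret l: bounded_linear l by fact
  have eq: "complexify l = (\<lambda>x. l x *\<^sub>R 1 - l (\<i> *\<^sub>C x) *\<^sub>R \<i>)"
    by (auto simp: complexify_def fun_eq_iff complex_eq_iff)
  show "bounded_linear (complexify l)" unfolding eq
    by (intro bounded_linear_sub bounded_linear_scaleR_const assms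
        bounded_linear_compose[OF assms] scaleC.bounded_linear_right)
  have "c *\<^sub>C x = Re c *\<^sub>R x + Im c *\<^sub>R (\<i> *\<^sub>C x)" for c and x :: 'a
    unfolding scaleC_of_real[symmetric] scaleC_scaleC scaleC_add_left[symmetric]
    by (subst complex_eq[of c]) (simp add: mult.commute)
  then have *: "l (c *\<^sub>C x) = Re c * l x + Im c * l (\<i> *\<^sub>C x)" for c x
    by (metis l.add l.scaleR real_scaleR_def)
  show "complexify l (c *\<^sub>C x) = c * complexify l x"
    unfolding complexify_def scaleC_scaleC *[of c] *[of "\<i> * c"] by (simp add: complex_eq_iff)
qed

lemma complex_functionals_separate:
  fixes x y :: "'a::complex_banach"
  assumes "\<And>l. bounded_linear l \<Longrightarrow> (\<And>c x. l (c *\<^sub>C x) = c * l x) \<Longrightarrow> l x = l y"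
  shows "x = y"
proof (rule functionals_separate)
  fix l :: "'a \<Rightarrow> real" assume l: "bounded_linear l"
  have "complexify l x = complexify l y" using assms complexify[OF l] by blast
  then show "l x = l y" by (simp add: complexify_def)
qed

section \<open>Inverse Fourier transforms of vector-valued symbols\<close>

lemma set_integrable_lborel_nonneg:
  fixes f :: "real \<Rightarrow> real"
  assumes "f integrable_on S" "f \<in> borel_measurable borel" "S \<in> sets borel" "\<And>x. x \<in> S \<Longrightarrow> 0 \<le> f x"
  shows "set_integrable lborel S f"
proof -
  have "f absolutely_integrable_on S" using nonnegative_absolutely_integrable_1 assms(1,4) by blast
  then show ?thesis
    unfolding set_integrable_def using assms(2,3) by (subst integrable_completion[symmetric]) auto
qed

lemma integrable_real_reflect:
  fixes f :: "real \<Rightarrow> 'b::{banach, second_countable_topology}"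
  shows "integrable lborel f \<Longrightarrow> integrable lborel (\<lambda>x. f (t - x))"
  using lborel_integrable_real_affine[of f "-1" t] by simp

lemma integral_real_reflect:
  fixes f :: "real \<Rightarrow> 'b::{banach, second_countable_topology}"
  shows "(LINT x|lborel. f (t - x)) = (LINT x|lborel. f x)"
  using lborel_integral_real_affine[of "-1" f t] by simp

lemma integrable_real_shift:
  fixes f :: "real \<Rightarrow> 'b::{banach, second_countable_topology}"
  shows "integrable lborel f \<Longrightarrow> integrable lborel (\<lambda>x. f (x + t))"
  using lborel_integrable_real_affine[of f 1 t] by (simp add: add.commute)

lemma integral_real_shift:
  fixes f :: "real \<Rightarrow> 'b::{banach, second_countable_topology}"
  shows "(LINT x|lborel. f (x + t)) = (LINT x|lborel. f x)"
  using lborel_integral_real_affine[of 1 f t] by (simp add: add.commute)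

lemma integrable_even_extension:
  fixes f :: "real \<Rightarrow> real"
  assumes "integrable lborel (\<lambda>x. indicator {0..} x * f x)"
    and "\<And>x. norm (g x) \<le> f \<bar>x\<bar>" and "g \<in> borel_measurable lborel"
  shows "integrable lborel (g :: real \<Rightarrow> real)"
proof (rule Bochner_Integration.integrable_bound)
  show "integrable lborel (\<lambda>x. indicator {0..} x * f x + indicator {0..} (0 - x) * f (0 - x))"
    by (intro Bochner_Integration.integrable_add assms(1)) (rule integrable_real_reflect[OF assms(1)])
  have "norm (g x) \<le> indicator {0..} x * f x + indicator {0..} (0 - x) * f (0 - x)" for x
    using assms(2)[of x] norm_ge_zero[of "g x"] by (cases "x = 0"; cases "x > 0") (auto simp: indicator_def)
  then show "AE x in lborel. norm (g x) \<le> norm (indicator {0..} x * f x + indicator {0..} (0 - x) * f (0 - x))"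
    by (intro AE_I2) (smt (verit) real_norm_def)
qed (use assms in auto)

lemma integrable_powr_tail:
  assumes "\<epsilon> > 0"
  shows "integrable lborel (\<lambda>t::real. (1 + \<bar>t\<bar>) powr (-1 - \<epsilon>))"
proof (rule integrable_even_extension[where f = "\<lambda>t. (1 + t) powr (-1 - \<epsilon>)"])
  have "set_integrable lborel {1..} (\<lambda>t::real. t powr (-1 - \<epsilon>))"
    using has_integral_powr_to_inf[of "-1 - \<epsilon>" 1] assms
    by (intro set_integrable_lborel_nonneg) (auto simp: has_integral_iff)
  then have "integrable lborel (\<lambda>t::real. indicator {1..} (t + 1) *\<^sub>R (t + 1) powr (-1 - \<epsilon>))"
    unfolding set_integrable_def by (rule integrable_real_shift)
  also have "(\<lambda>t::real. indicator {1..} (t + 1) *\<^sub>R (t + 1) powr (-1 - \<epsilon>))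
      = (\<lambda>t. indicator {0..} t * (1 + t) powr (-1 - \<epsilon>))"
    by (auto simp: fun_eq_iff indicator_def add.commute)
  finally show "integrable lborel (\<lambda>t::real. indicator {0..} t * (1 + t) powr (-1 - \<epsilon>))" .
qed auto

lemma integrable_powr_min:
  assumes "\<epsilon> > 0"
  shows "integrable lborel (\<lambda>t::real. indicator {-1..1} t * \<bar>t\<bar> powr (\<epsilon> - 1))"
proof (rule integrable_even_extension[where f = "\<lambda>t. indicator {0..1} t * t powr (\<epsilon> - 1)"])
  have "set_integrable lborel {0..1} (\<lambda>t::real. t powr (\<epsilon> - 1))"
    using has_integral_powr_from_0[of "\<epsilon> - 1" 1] assms
    by (intro set_integrable_lborel_nonneg) (auto simp: has_integral_iff)
  also have "?this \<longleftrightarrow> integrable lborel (\<lambda>t::real. indicator {0..} t * (indicator {0..1} t * t powr (\<epsilon> - 1)))"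
    unfolding set_integrable_def by (intro Bochner_Integration.integrable_cong) (auto simp: indicator_def)
  finally show "integrable lborel (\<lambda>t::real. indicator {0..} t * (indicator {0..1} t * t powr (\<epsilon> - 1)))" .
qed (auto simp: indicator_def)

text \<open>Interpolates between the bound \<open>\<bar>x\<bar>\<close>, good for small
  \<open>x\<close>, and the bound 2, good for large \<open>x\<close>.\<close>

lemma norm_cis_minus_1_le_powr:
  assumes "0 < \<epsilon>" "\<epsilon> \<le> 1"
  shows "norm (cis x - 1) \<le> 2 * \<bar>x\<bar> powr \<epsilon>"
proof -
  have eq: "norm (cis x - 1) = 2 * \<bar>sin (x / 2)\<bar>"
    using dist_exp_i_1[of x] by (simp add: cis_conv_exp)
  show ?thesis
  proof (cases "\<bar>x\<bar> \<le> 1")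
    case True
    have "norm (cis x - 1) \<le> \<bar>x\<bar>" using eq abs_sin_x_le_abs_x[of "x/2"] by simp
    also have "\<bar>x\<bar> \<le> \<bar>x\<bar> powr \<epsilon>"
    proof (cases "x = 0")
      case False
      then have "\<bar>x\<bar> powr 1 \<le> \<bar>x\<bar> powr \<epsilon>" using True assms by (intro powr_mono') auto
      then show ?thesis using False by simp
    qed simp
    finally show ?thesis using powr_ge_zero[of "\<bar>x\<bar>" \<epsilon>] by linarith
  next
    case False
    have "norm (cis x - 1) \<le> 2" using eq abs_sin_le_one[of "x/2"] by simp
    moreover have "1 \<le> \<bar>x\<bar> powr \<epsilon>" using False assms by (intro ge_one_powr_ge_zero) auto
    ultimately show ?thesis by linarith
  qed
qed

lemma has_vector_derivative_cis:
  "((\<lambda>t. cis (s * t)) has_vector_derivative (\<i> * of_real s * cis (s * t))) (at t within S)"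
proof -
  have "((\<lambda>z. exp (\<i> * (of_real s * z))) has_field_derivative
      (\<i> * of_real s * exp (\<i> * (of_real s * of_real t)))) (at (of_real t))"
    by (auto intro!: derivative_eq_intros)
  from has_vector_derivative_real_field[OF this]
  show ?thesis by (simp add: cis_conv_exp)
qed

lemma continuous_on_vector_derivative:
  "(\<And>t. (h has_vector_derivative h1 t) (at t)) \<Longrightarrow> continuous_on A h"
  by (auto intro!: continuous_at_imp_continuous_on has_vector_derivative_continuous)

section \<open>Truncated inverse Fourier integrals and their limits\<close>

definition partial_inv_fourier :: "(real \<Rightarrow> 'e::complex_banach) \<Rightarrow> real \<Rightarrow> real \<Rightarrow> 'e" where
  "partial_inv_fourier h N s = (1 / (2 * pi)) *\<^sub>R integral {-N..N} (\<lambda>t. cis (s * t) *\<^sub>C h t)"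

text \<open>Symmetric truncations are used because a symbol that decays like a small power need not
  be integrable. Where the sequence diverges the value of \<open>lim\<close> is unspecified, so
  pointwise facts are stated for \<open>s \<noteq> 0\<close>.\<close>

definition inv_fourier :: "(real \<Rightarrow> 'e::complex_banach) \<Rightarrow> real \<Rightarrow> 'e" where
  "inv_fourier h s = lim (\<lambda>n. partial_inv_fourier h (real n) s)"

lemma scaleC_cis_integrable:
  fixes h :: "real \<Rightarrow> 'e::complex_banach"
  assumes "continuous_on UNIV h"
  shows "continuous_on A (\<lambda>t. cis (s * t) *\<^sub>C h t)"
    "(\<lambda>t. cis (s * t) *\<^sub>C h t) integrable_on {a..b}"
proof -
  show *: "continuous_on A (\<lambda>t. cis (s * t) *\<^sub>C h t)" for A
    by (intro continuous_intros continuous_on_subset[OF assms]) auto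
  show "(\<lambda>t. cis (s * t) *\<^sub>C h t) integrable_on {a..b}"
    using integrable_continuous_interval[OF *] .
qed

lemma fourier_integral_by_parts:
  fixes h h1 :: "real \<Rightarrow> 'e::complex_banach"
  assumes d: "\<And>t. (h has_vector_derivative h1 t) (at t)" and c: "continuous_on UNIV h1" and N: "0 \<le> N"
  shows "(\<i> * of_real s) *\<^sub>C integral {-N..N} (\<lambda>t. cis (s * t) *\<^sub>C h t)
    = cis (s * N) *\<^sub>C h N - cis (- (s * N)) *\<^sub>C h (-N) - integral {-N..N} (\<lambda>t. cis (s * t) *\<^sub>C h1 t)"
proof -
  have ch: "continuous_on UNIV h"
    using d by (rule continuous_on_vector_derivative)
  have "((\<lambda>t. cis (s * t) *\<^sub>C h1 t + (\<i> * of_real s * cis (s * t)) *\<^sub>C h t) has_integral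
      (cis (s * N) *\<^sub>C h N - cis (s * (-N)) *\<^sub>C h (-N))) {-N..N}"
    by (rule fundamental_theorem_of_calculus)
       (use N d in \<open>auto intro!: scaleC.has_vector_derivative has_vector_derivative_cis
          intro: has_vector_derivative_at_within\<close>)
  moreover have "((\<lambda>t. cis (s * t) *\<^sub>C h1 t) has_integral integral {-N..N} (\<lambda>t. cis (s * t) *\<^sub>C h1 t)) {-N..N}"
    using scaleC_cis_integrable(2)[OF c] by (rule integrable_integral)
  ultimately have "((\<lambda>t. (cis (s * t) *\<^sub>C h1 t + (\<i> * of_real s * cis (s * t)) *\<^sub>C h t) - cis (s * t) *\<^sub>C h1 t) has_integral
      (cis (s * N) *\<^sub>C h N - cis (s * (-N)) *\<^sub>C h (-N)) - integral {-N..N} (\<lambda>t. cis (s * t) *\<^sub>C h1 t)) {-N..N}"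
    by (rule has_integral_diff)
  then have 1: "((\<lambda>t. (\<i> * of_real s) *\<^sub>C (cis (s * t) *\<^sub>C h t)) has_integral
      (cis (s * N) *\<^sub>C h N - cis (s * (-N)) *\<^sub>C h (-N)) - integral {-N..N} (\<lambda>t. cis (s * t) *\<^sub>C h1 t)) {-N..N}"
    by (simp add: scaleC_scaleC)
  have 2: "((\<lambda>t. (\<i> * of_real s) *\<^sub>C (cis (s * t) *\<^sub>C h t)) has_integral
      (\<i> * of_real s) *\<^sub>C integral {-N..N} (\<lambda>t. cis (s * t) *\<^sub>C h t)) {-N..N}"
    using has_integral_linear[OF integrable_integral[OF scaleC_cis_integrable(2)[OF ch]]
        scaleC.bounded_linear_right[of "\<i> * of_real s"]] by (simp add: comp_def)
  show ?thesis using has_integral_unique[OF 1 2] by simp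
qed

lemma Bochner_integral_diff:
  fixes f g :: "'m \<Rightarrow> 'b::banach"
  assumes f: "simple_limit M f" "integrable M (\<lambda>x. norm (f x))"
    and g: "simple_limit M g" "integrable M (\<lambda>x. norm (g x))"
  shows "integrable M (\<lambda>x. norm (f x - g x))"
    "Bochner_integral M f - Bochner_integral M g = Bochner_integral M (\<lambda>x. f x - g x)"
proof -
  have sl: "simple_limit M (\<lambda>x. f x - g x)" by (rule simple_limit_diff[OF f(1) g(1)])
  show int: "integrable M (\<lambda>x. norm (f x - g x))"
    by (rule Bochner_Integration.integrable_bound[OF Bochner_Integration.integrable_add[OF f(2) g(2)]
          simple_limit_norm_measurable[OF sl]]) (auto intro: norm_triangle_ineq4)
  show "Bochner_integral M f - Bochner_integral M g = Bochner_integral M (\<lambda>x. f x - g x)"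
  proof (rule functionals_separate)
    fix l :: "'b \<Rightarrow> real" assume l: "bounded_linear l"
    interpret l: bounded_linear l by fact
    show "l (Bochner_integral M f - Bochner_integral M g) = l (Bochner_integral M (\<lambda>x. f x - g x))"
      using Bochner_integral_functional[OF f(1) Bochner_integrableI[OF f] l]
        Bochner_integral_functional[OF g(1) Bochner_integrableI[OF g] l]
        Bochner_integral_functional[OF sl Bochner_integrableI[OF sl int] l]
      by (simp add: l.diff)
  qed
qed

text \<open>The Henstock-Kurzweil integral serves for calculus on compact intervals, the Bochner
  integral for the whole line. A functional that norms the difference of the two reduces the
  comparison to scalars, where both integrals agree on an interval.\<close>

lemma continuous_integral_tail:
  fixes f :: "real \<Rightarrow> 'b::banach"
  assumes f: "continuous_on UNIV f" and m: "integrable lborel m" and le: "\<And>t. norm (f t) \<le> m t"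
  shows "norm (Bochner_integral lborel f - integral {a..b} f) \<le> (LINT t|lborel. indicator (- {a..b}) t * m t)"
proof -
  let ?D = "Bochner_integral lborel f - integral {a..b} f"
  obtain l :: "'b \<Rightarrow> real" where l: "bounded_linear l" "l ?D = norm ?D" "\<And>y. \<bar>l y\<bar> \<le> norm y"
    using hahn_banach_norming by blast
  interpret l: bounded_linear l by fact
  have sl: "simple_limit lborel f" by (rule simple_limit_continuous[OF f])
  have int: "integrable lborel (\<lambda>t. norm (f t))"
    by (rule Bochner_Integration.integrable_bound[OF m simple_limit_norm_measurable[OF sl]])
       (use le in \<open>auto intro!: AE_I2 order_trans[OF _ abs_ge_self]\<close>)
  note F = Bochner_integral_functional[OF sl Bochner_integrableI[OF sl int] l(1)]
  have set: "set_integrable lborel {a..b} (\<lambda>t. l (f t))"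
    unfolding set_integrable_def using F(1) by (intro integrable_mult_indicator) auto
  have "l (integral {a..b} f) = integral {a..b} (l \<circ> f)"
    using integral_linear[OF integrable_continuous_interval l(1), of a b f] continuous_on_subset[OF f] by auto
  also have "\<dots> = (LINT t|lborel. indicator {a..b} t * l (f t))"
    using set_borel_integral_eq_integral(2)[OF set] by (simp add: set_lebesgue_integral_def comp_def)
  finally have "norm ?D = (LINT t|lborel. l (f t)) - (LINT t|lborel. indicator {a..b} t * l (f t))"
    using l(2) F(2) by (simp add: l.diff)
  also have "\<dots> = (LINT t|lborel. l (f t) - indicator {a..b} t * l (f t))"
    using F(1) set by (simp add: set_integrable_def)
  also have "\<dots> \<le> (LINT t|lborel. indicator (- {a..b}) t * m t)"
  proof (rule integral_mono)
    show "integrable lborel (\<lambda>t. l (f t) - indicator {a..b} t * l (f t))"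
      using F(1) set by (simp add: set_integrable_def)
    show "integrable lborel (\<lambda>t. indicator (- {a..b}) t * m t)"
      using integrable_mult_indicator[OF _ m, of "- {a..b}"] by simp
    show "l (f t) - indicator {a..b} t * l (f t) \<le> indicator (- {a..b}) t * m t" for t
      using l(3)[of "f t"] le[of t] by (auto simp: indicator_def)
  qed
  finally show ?thesis .
qed

lemma continuous_integral_exhaustion:
  fixes f :: "real \<Rightarrow> 'b::banach"
  assumes f: "continuous_on UNIV f" and m: "integrable lborel m" and le: "\<And>t. norm (f t) \<le> m t"
  shows "(\<lambda>n. integral {- real n..real n} f) \<longlonglongrightarrow> Bochner_integral lborel f"
proof -
  have "(\<lambda>n. LINT t|lborel. indicator (- {- real n..real n}) t * m t) \<longlonglongrightarrow> (LINT t::real|lborel. 0)"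
  proof (rule integral_dominated_convergence[where w = "\<lambda>t. norm (m t)"])
    show "AE t in lborel. (\<lambda>n. indicator (- {- real n..real n}) t * m t) \<longlonglongrightarrow> 0"
    proof (rule AE_I2, rule tendsto_eventually)
      fix t :: real
      show "\<forall>\<^sub>F n in sequentially. indicator (- {- real n..real n}) t * m t = 0"
        using eventually_ge_at_top[of "nat \<lceil>\<bar>t\<bar>\<rceil>"] by eventually_elim (auto simp: indicator_def; linarith)
    qed
  qed (use m in \<open>auto simp: indicator_def intro!: AE_I2\<close>)
  then have lim: "(\<lambda>n. LINT t|lborel. indicator (- {- real n..real n}) t * m t) \<longlonglongrightarrow> 0" by simp
  have "(\<lambda>n. Bochner_integral lborel f - integral {- real n..real n} f) \<longlonglongrightarrow> 0"
    by (rule Lim_null_comparison[OF _ lim]) (use continuous_integral_tail[OF assms] in auto)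
  then have "(\<lambda>n. Bochner_integral lborel f - (Bochner_integral lborel f - integral {- real n..real n} f))
      \<longlonglongrightarrow> Bochner_integral lborel f - 0" by (intro tendsto_intros)
  then show ?thesis by simp
qed

text \<open>The exponents are matched to the integrations by parts. Estimating
  \<open>cis (s * t) - 1\<close> costs a factor \<open>\<bar>t\<bar> powr \<epsilon>\<close>, after
  which \<open>- 1 - 2 * \<epsilon>\<close> for \<open>h1\<close> still leaves the integrable
  exponent \<open>- 1 - \<epsilon>\<close>. The exponent \<open>- \<epsilon>\<close> for
  \<open>h\<close> just balances the same factor in the boundary terms, and \<open>h2\<close> only
  has to be integrable.\<close>

locale fourier_symbol =
  fixes h h1 h2 :: "real \<Rightarrow> 'e::complex_banach" and \<epsilon> C :: real
  assumes eps: "0 < \<epsilon>" "\<epsilon> \<le> 1"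
    and d0: "\<And>t. (h has_vector_derivative h1 t) (at t)"
    and d1: "\<And>t. (h1 has_vector_derivative h2 t) (at t)"
    and c2: "continuous_on UNIV h2"
    and b0: "\<And>t. norm (h t) \<le> C * (1 + \<bar>t\<bar>) powr (-\<epsilon>)"
    and b1: "\<And>t. norm (h1 t) \<le> C * (1 + \<bar>t\<bar>) powr (-1 - 2 * \<epsilon>)"
    and b2: "\<And>t. norm (h2 t) \<le> C * (1 + \<bar>t\<bar>) powr (-1 - \<epsilon>)"
begin

definition m :: "real \<Rightarrow> real" where "m t = C * (1 + \<bar>t\<bar>) powr (-1 - \<epsilon>)"

definition M0 :: real where "M0 = (LINT t|lborel. m t)"

text \<open>The transform of the derivative, which converges absolutely. For
  \<open>s \<noteq> 0\<close> the transform of \<open>h\<close> is a constant multiple of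
  \<open>J s\<close> divided by \<open>s\<close>, so continuity and decay at infinity are read off
  from \<open>J\<close>.\<close>

definition J :: "real \<Rightarrow> 'e" where "J s = Bochner_integral lborel (\<lambda>t. cis (s * t) *\<^sub>C h1 t)"

lemma C_nonneg: "0 \<le> C"
  using order_trans[OF norm_ge_zero b0[of 0]] by simp

lemma c0: "continuous_on A h" and c1: "continuous_on A h1"
  using continuous_on_vector_derivative d0 d1 by blast+

lemma m_integrable: "integrable lborel m"
  unfolding m_def using integrable_powr_tail[OF eps(1)] by simp

lemma m_nonneg: "0 \<le> m t"
  unfolding m_def using C_nonneg by simp

lemma h1_le_m: "norm (h1 t) \<le> m t"
proof -
  have "(1 + \<bar>t\<bar>) powr (-1 - 2 * \<epsilon>) \<le> (1 + \<bar>t\<bar>) powr (-1 - \<epsilon>)"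
    using eps by (intro powr_mono) auto
  then show ?thesis using b1[of t] C_nonneg unfolding m_def
    by (meson mult_left_mono order_trans)
qed

lemma h2_le_m: "norm (h2 t) \<le> m t"
  using b2 by (simp add: m_def)

lemma h1_le: "norm (h1 t) \<le> C"
proof -
  have "(1 + \<bar>t\<bar>) powr (-1-2*\<epsilon>) \<le> (1 + \<bar>t\<bar>) powr 0" using eps by (intro powr_mono) auto
  then have "(1 + \<bar>t\<bar>) powr (-1-2*\<epsilon>) \<le> 1" by (simp add: add_nonneg_eq_0_iff)
  then show ?thesis using b1[of t] C_nonneg mult_left_mono[of "(1 + \<bar>t\<bar>) powr (-1-2*\<epsilon>)" 1 C] by simp
qed

lemma norm_integral_le_M0:
  fixes f :: "real \<Rightarrow> 'b::banach"
  assumes "f integrable_on {-N..N}" "\<And>t. norm (f t) \<le> c * m t" "c \<ge> 0"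
  shows "norm (integral {-N..N} f) \<le> c * M0"
proof -
  have s: "set_integrable lborel {-N..N} (\<lambda>t. c * m t)"
    unfolding set_integrable_def using m_integrable by (intro integrable_mult_indicator) auto
  have "norm (integral {-N..N} f) \<le> integral {-N..N} (\<lambda>t. c * m t)"
    using assms(2) set_borel_integral_eq_integral(1)[OF s]
    by (intro Henstock_Kurzweil_Integration.integral_norm_bound_integral assms(1)) auto
  also have "\<dots> = (LINT t|lborel. indicator {-N..N} t * (c * m t))"
    using set_borel_integral_eq_integral(2)[OF s] unfolding set_lebesgue_integral_def real_scaleR_def by simp
  also have "\<dots> \<le> (LINT t|lborel. c * m t)"
    using s m_integrable m_nonneg assms(3)
    by (intro integral_mono) (auto simp: set_integrable_def indicator_def)
  finally show ?thesis by (simp add: M0_def)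
qed

text \<open>Subtracting the case \<open>s = 0\<close> of the integration by parts replaces \<open>cis\<close> by \<open>cis - 1\<close>, which
  gains a factor \<open>\<bar>s\<bar> powr \<epsilon>\<close>.\<close>

lemma partial_bound:
  assumes N: "0 \<le> N" and s: "s \<noteq> 0"
  shows "norm (partial_inv_fourier h N s) \<le> (4 * C + 2 * M0) * \<bar>s\<bar> powr (\<epsilon> - 1)"
proof -
  let ?I = "integral {-N..N} (\<lambda>t. cis (s * t) *\<^sub>C h t)"
  have int: "(\<lambda>t. cis (s * t) *\<^sub>C h1 t) integrable_on {-N..N}" "h1 integrable_on {-N..N}"
    using scaleC_cis_integrable(2)[OF c1] integrable_continuous_interval[OF c1] by auto
  have cisd: "(\<lambda>t. cis (s * t) *\<^sub>C h1 t - h1 t) = (\<lambda>t. (cis (s * t) - 1) *\<^sub>C h1 t)"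
    by (simp add: scaleC.diff_left)
  have "0 = h N - h (-N) - integral {-N..N} h1"
    using fourier_integral_by_parts[OF d0 c1 N, of 0] by (simp add: scaleC.zero_left)
  then have "(\<i> * of_real s) *\<^sub>C ?I
      = (cis (s * N) *\<^sub>C h N - cis (- (s * N)) *\<^sub>C h (-N) - integral {-N..N} (\<lambda>t. cis (s * t) *\<^sub>C h1 t))
        - (h N - h (-N) - integral {-N..N} h1)"
    using fourier_integral_by_parts[OF d0 c1 N, of s] by simp
  also have "\<dots> = (cis (s * N) - 1) *\<^sub>C h N - (cis (- (s * N)) - 1) *\<^sub>C h (-N)
      - (integral {-N..N} (\<lambda>t. cis (s * t) *\<^sub>C h1 t) - integral {-N..N} h1)"
    by (simp add: scaleC.diff_left)
  also have "integral {-N..N} (\<lambda>t. cis (s * t) *\<^sub>C h1 t) - integral {-N..N} h1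
      = integral {-N..N} (\<lambda>t. (cis (s * t) - 1) *\<^sub>C h1 t)"
    using Henstock_Kurzweil_Integration.integral_diff[OF int] cisd by simp
  finally have eq: "(\<i> * of_real s) *\<^sub>C ?I = (cis (s * N) - 1) *\<^sub>C h N - (cis (- (s * N)) - 1) *\<^sub>C h (-N)
      - integral {-N..N} (\<lambda>t. (cis (s * t) - 1) *\<^sub>C h1 t)" .
  \<comment> \<open>The growth of \<open>cis x - 1\<close> like \<open>N powr \<epsilon>\<close> is
    cancelled by the decay of \<open>h\<close> at the endpoints, so that the bound does not depend
    on \<open>N\<close>.\<close>
  have bd: "norm ((cis x - 1) *\<^sub>C h y) \<le> 2 * C * \<bar>s\<bar> powr \<epsilon>" if "\<bar>x\<bar> = \<bar>s\<bar> * N" "\<bar>y\<bar> = N" for x y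
  proof -
    have "norm (cis x - 1) \<le> 2 * (\<bar>s\<bar> powr \<epsilon> * N powr \<epsilon>)"
      using norm_cis_minus_1_le_powr[OF eps, of x] that N by (simp add: powr_mult)
    then have "norm ((cis x - 1) *\<^sub>C h y) \<le> (2 * (\<bar>s\<bar> powr \<epsilon> * N powr \<epsilon>)) * (C * (1 + N) powr (-\<epsilon>))"
      using b0[of y] that C_nonneg by (auto simp: norm_scaleC intro!: mult_mono)
    also have "\<dots> = 2 * C * \<bar>s\<bar> powr \<epsilon> * (N powr \<epsilon> * (1 + N) powr (-\<epsilon>))" by simp
    also have "\<dots> \<le> 2 * C * \<bar>s\<bar> powr \<epsilon> * 1"
    proof (rule mult_left_mono)
      have "N powr \<epsilon> \<le> (1 + N) powr \<epsilon>" using N eps by (intro powr_mono2) auto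
      then show "N powr \<epsilon> * (1 + N) powr (-\<epsilon>) \<le> 1"
        using N by (simp add: powr_minus field_simps)
    qed (use C_nonneg in auto)
    finally show ?thesis by simp
  qed
  have bi: "norm ((cis (s * t) - 1) *\<^sub>C h1 t) \<le> (2 * \<bar>s\<bar> powr \<epsilon>) * m t" for t
  proof -
    have "norm (cis (s * t) - 1) \<le> 2 * (\<bar>s\<bar> powr \<epsilon> * \<bar>t\<bar> powr \<epsilon>)"
      using norm_cis_minus_1_le_powr[OF eps, of "s * t"] by (simp add: powr_mult abs_mult)
    then have "norm ((cis (s * t) - 1) *\<^sub>C h1 t)
        \<le> (2 * (\<bar>s\<bar> powr \<epsilon> * \<bar>t\<bar> powr \<epsilon>)) * (C * (1 + \<bar>t\<bar>) powr (-1 - 2 * \<epsilon>))"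
      using b1[of t] C_nonneg by (auto simp: norm_scaleC intro!: mult_mono)
    also have "\<dots> \<le> (2 * (\<bar>s\<bar> powr \<epsilon> * (1 + \<bar>t\<bar>) powr \<epsilon>)) * (C * (1 + \<bar>t\<bar>) powr (-1 - 2 * \<epsilon>))"
      using C_nonneg eps by (intro mult_right_mono mult_left_mono powr_mono2) auto
    also have "\<dots> = 2 * \<bar>s\<bar> powr \<epsilon> * (C * ((1 + \<bar>t\<bar>) powr \<epsilon> * (1 + \<bar>t\<bar>) powr (-1 - 2 * \<epsilon>)))" by simp
    also have "(1 + \<bar>t\<bar>) powr \<epsilon> * (1 + \<bar>t\<bar>) powr (-1 - 2 * \<epsilon>) = (1 + \<bar>t\<bar>) powr (-1 - \<epsilon>)"
      unfolding powr_add[symmetric] by (rule arg_cong2[of _ _ _ _ "(powr)"]) simp_all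
    finally show ?thesis by (simp add: m_def)
  qed
  have "\<bar>s\<bar> * norm ?I = norm ((\<i> * of_real s) *\<^sub>C ?I)" by (simp add: norm_scaleC norm_mult)
  also have "\<dots> \<le> norm ((cis (s * N) - 1) *\<^sub>C h N) + norm ((cis (- (s * N)) - 1) *\<^sub>C h (-N))
      + norm (integral {-N..N} (\<lambda>t. (cis (s * t) - 1) *\<^sub>C h1 t))"
    unfolding eq by (meson add_mono norm_triangle_ineq4 order_refl order_trans)
  also have "\<dots> \<le> 2 * C * \<bar>s\<bar> powr \<epsilon> + 2 * C * \<bar>s\<bar> powr \<epsilon> + (2 * \<bar>s\<bar> powr \<epsilon>) * M0"
    using N integrable_diff[OF int] cisd
    by (intro add_mono bd norm_integral_le_M0 bi) (auto simp: abs_mult)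
  finally have *: "\<bar>s\<bar> * norm ?I \<le> (4 * C + 2 * M0) * \<bar>s\<bar> powr \<epsilon>" by (simp add: algebra_simps)
  have "norm ?I \<le> (4 * C + 2 * M0) * (\<bar>s\<bar> powr (\<epsilon> - 1))"
    using * s by (simp add: powr_diff field_simps)
  moreover have "norm (partial_inv_fourier h N s) \<le> norm ?I"
    unfolding partial_inv_fourier_def using pi_gt3 mult_right_mono[of "1 / (2 * pi)" 1 "norm ?I"] by simp
  ultimately show ?thesis by linarith
qed

lemma J_exhaustion: "(\<lambda>n. integral {- real n..real n} (\<lambda>t. cis (s * t) *\<^sub>C h1 t)) \<longlonglongrightarrow> J s"
  unfolding J_def
  by (rule continuous_integral_exhaustion[OF scaleC_cis_integrable(1)[OF c1] m_integrable])
     (simp add: norm_scaleC h1_le_m)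

lemma partial_limit_J:
  assumes s: "s \<noteq> 0"
  shows "(\<lambda>n. partial_inv_fourier h (real n) s) \<longlonglongrightarrow> (1 / (2 * pi)) *\<^sub>R ((1 / (\<i> * of_real s)) *\<^sub>C (0 - J s))"
proof -
  let ?B = "\<lambda>n. cis (s * real n) *\<^sub>C h (real n) - cis (- (s * real n)) *\<^sub>C h (- real n)"
  have lim: "(\<lambda>n. 2 * (C * (1 + real n) powr (-\<epsilon>))) \<longlonglongrightarrow> 0" using eps by real_asymp
  have "norm (?B n) \<le> 2 * (C * (1 + real n) powr (-\<epsilon>))" for n
    using norm_triangle_ineq4[of "cis (s * real n) *\<^sub>C h (real n)" "cis (- (s * real n)) *\<^sub>C h (- real n)"]
      b0[of "real n"] b0[of "- real n"] by (simp add: norm_scaleC)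
  then have B: "?B \<longlonglongrightarrow> 0" by (intro Lim_null_comparison[OF always_eventually lim] allI)
  have "partial_inv_fourier h (real n) s = (1 / (2 * pi)) *\<^sub>R ((1 / (\<i> * of_real s)) *\<^sub>C
      (?B n - integral {- real n..real n} (\<lambda>t. cis (s * t) *\<^sub>C h1 t)))" for n
    unfolding partial_inv_fourier_def using s
    by (subst fourier_integral_by_parts[OF d0 c1, symmetric]) (simp_all add: scaleC_scaleC)
  then show ?thesis
    using tendsto_scaleR[OF tendsto_const scaleC.tendsto[OF tendsto_const tendsto_diff[OF B J_exhaustion[of s]]],
      of "1 / (2 * pi)" "1 / (\<i> * of_real s)"] by simp
qed

lemma inv_fourier_J: "s \<noteq> 0 \<Longrightarrow> inv_fourier h s = (1 / (2 * pi)) *\<^sub>R ((1 / (\<i> * of_real s)) *\<^sub>C (0 - J s))"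
  unfolding inv_fourier_def by (rule limI[OF partial_limit_J])

lemma partial_limit: "s \<noteq> 0 \<Longrightarrow> (\<lambda>n. partial_inv_fourier h (real n) s) \<longlonglongrightarrow> inv_fourier h s"
  using partial_limit_J inv_fourier_J by simp

lemma inv_fourier_bound_small: "s \<noteq> 0 \<Longrightarrow> norm (inv_fourier h s) \<le> (4 * C + 2 * M0) * \<bar>s\<bar> powr (\<epsilon> - 1)"
  by (rule tendsto_upperbound[OF tendsto_norm[OF partial_limit]]) (auto simp: partial_bound)

text \<open>The second integration by parts, from \<open>h1\<close> to \<open>h2\<close>. It takes
  place on truncated integrals, where each boundary term is at most \<open>C\<close> and the
  remaining integral at most \<open>M0\<close>, for every \<open>n\<close>.\<close>

lemma J_bound: "\<bar>s\<bar> * norm (J s) \<le> 2 * C + M0"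
proof (rule tendsto_upperbound)
  show "(\<lambda>n. \<bar>s\<bar> * norm (integral {- real n..real n} (\<lambda>t. cis (s * t) *\<^sub>C h1 t))) \<longlonglongrightarrow> \<bar>s\<bar> * norm (J s)"
    by (intro tendsto_intros J_exhaustion)
  show "\<forall>\<^sub>F n in sequentially. \<bar>s\<bar> * norm (integral {- real n..real n} (\<lambda>t. cis (s * t) *\<^sub>C h1 t)) \<le> 2 * C + M0"
  proof (intro always_eventually allI)
    fix n
    let ?I = "integral {- real n..real n} (\<lambda>t. cis (s * t) *\<^sub>C h1 t)"
    let ?I2 = "integral {- real n..real n} (\<lambda>t. cis (s * t) *\<^sub>C h2 t)"
    have "norm ?I2 \<le> 1 * M0"
      using scaleC_cis_integrable(2)[OF c2] h2_le_m by (intro norm_integral_le_M0) (auto simp: norm_scaleC)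
    moreover have "norm (cis (s * real n) *\<^sub>C h1 (real n)) \<le> C" "norm (cis (- (s * real n)) *\<^sub>C h1 (- real n)) \<le> C"
      using h1_le by (auto simp: norm_scaleC)
    moreover have "norm (a - b - c) \<le> norm a + norm b + norm c" for a b c :: 'e
      by (meson add_mono norm_triangle_ineq4 order_refl order_trans)
    ultimately have "norm ((\<i> * of_real s) *\<^sub>C ?I) \<le> C + C + M0"
      unfolding fourier_integral_by_parts[OF d1 c2 of_nat_0_le_iff] by (smt (verit))
    then show "\<bar>s\<bar> * norm ?I \<le> 2 * C + M0" by (simp add: norm_scaleC norm_mult)
  qed
qed auto

lemma inv_fourier_bound_large:
  assumes "s \<noteq> 0"
  shows "norm (inv_fourier h s) \<le> (2 * C + M0) * \<bar>s\<bar> powr -2"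
proof -
  have "norm (inv_fourier h s) = (1 / (2 * pi)) * (norm (J s) / \<bar>s\<bar>)"
    by (simp add: inv_fourier_J[OF assms] norm_scaleC norm_divide norm_mult)
  also have "\<dots> \<le> 1 * (norm (J s) / \<bar>s\<bar>)" using pi_gt3 by (intro mult_right_mono) auto
  also have "norm (J s) / \<bar>s\<bar> \<le> ((2 * C + M0) / \<bar>s\<bar>) / \<bar>s\<bar>"
    using J_bound[of s] assms by (intro divide_right_mono) (auto simp: field_simps)
  also have "\<dots> = (2 * C + M0) * \<bar>s\<bar> powr -2"
    using assms by (simp add: powr_minus powr_numeral field_simps power2_eq_square)
  finally show ?thesis by simp
qed

lemma isCont_J: "isCont J s"
  unfolding continuous_at_sequentially
proof (intro allI impI)
  fix x :: "nat \<Rightarrow> real" assume x: "x \<longlonglongrightarrow> s"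
  have sl: "simple_limit lborel (\<lambda>t. cis (s * t) *\<^sub>C h1 t)" for s
    by (rule simple_limit_continuous[OF scaleC_cis_integrable(1)[OF c1]])
  have int: "integrable lborel (\<lambda>t. norm (cis (s * t) *\<^sub>C h1 t))" for s
    by (rule Bochner_Integration.integrable_bound[OF m_integrable simple_limit_norm_measurable[OF sl]])
       (auto simp: norm_scaleC h1_le_m intro!: AE_I2 order_trans[OF _ abs_ge_self])
  have "(\<lambda>n. LINT t|lborel. norm (cis (x n * t) *\<^sub>C h1 t - cis (s * t) *\<^sub>C h1 t)) \<longlonglongrightarrow> (LINT t::real|lborel. 0)"
  proof (rule integral_dominated_convergence[where w = "\<lambda>t. 2 * m t"])
    show "AE t in lborel. (\<lambda>n. norm (cis (x n * t) *\<^sub>C h1 t - cis (s * t) *\<^sub>C h1 t)) \<longlonglongrightarrow> 0"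
    proof (rule AE_I2)
      fix t
      have "(\<lambda>n. norm (cis (x n * t) *\<^sub>C h1 t - cis (s * t) *\<^sub>C h1 t))
          \<longlonglongrightarrow> norm (cis (s * t) *\<^sub>C h1 t - cis (s * t) *\<^sub>C h1 t)"
        by (intro tendsto_intros x isCont_tendsto_compose[of _ cis])
      then show "(\<lambda>n. norm (cis (x n * t) *\<^sub>C h1 t - cis (s * t) *\<^sub>C h1 t)) \<longlonglongrightarrow> 0" by simp
    qed
    show "AE t in lborel. norm (norm (cis (x n * t) *\<^sub>C h1 t - cis (s * t) *\<^sub>C h1 t)) \<le> 2 * m t" for n
    proof (rule AE_I2)
      fix t
      have "norm (cis (x n * t) *\<^sub>C h1 t - cis (s * t) *\<^sub>C h1 t)
          \<le> norm (cis (x n * t) *\<^sub>C h1 t) + norm (cis (s * t) *\<^sub>C h1 t)" by (rule norm_triangle_ineq4)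
      then show "norm (norm (cis (x n * t) *\<^sub>C h1 t - cis (s * t) *\<^sub>C h1 t)) \<le> 2 * m t"
        using h1_le_m[of t] by (simp add: norm_scaleC)
    qed
    show "(\<lambda>t. norm (cis (x n * t) *\<^sub>C h1 t - cis (s * t) *\<^sub>C h1 t)) \<in> borel_measurable lborel" for n
      by (intro simple_limit_norm_measurable simple_limit_diff sl)
  qed (use m_integrable in auto)
  then have lim: "(\<lambda>n. LINT t|lborel. norm (cis (x n * t) *\<^sub>C h1 t - cis (s * t) *\<^sub>C h1 t)) \<longlonglongrightarrow> 0" by simp
  have "(\<lambda>n. J (x n) - J s) \<longlonglongrightarrow> 0"
  proof (rule Lim_null_comparison[OF _ lim], intro always_eventually allI)
    fix n
    show "norm (J (x n) - J s) \<le> (LINT t|lborel. norm (cis (x n * t) *\<^sub>C h1 t - cis (s * t) *\<^sub>C h1 t))"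
      unfolding J_def Bochner_integral_diff(2)[OF sl int sl int]
      by (rule norm_Bochner_integral_le[OF simple_limit_diff[OF sl sl] Bochner_integral_diff(1)[OF sl int sl int]])
  qed
  then have "(\<lambda>n. (J (x n) - J s) + J s) \<longlonglongrightarrow> 0 + J s" by (intro tendsto_intros)
  then show "(J \<circ> x) \<longlonglongrightarrow> J s" by (simp add: comp_def)
qed

lemma isCont_inv_fourier:
  assumes "s \<noteq> 0"
  shows "isCont (inv_fourier h) s"
proof -
  have "isCont (\<lambda>s. (1 / (2 * pi)) *\<^sub>R ((1 / (\<i> * of_real s)) *\<^sub>C (0 - J s))) s"
    using assms by (intro continuous_intros isCont_J) auto
  moreover have "\<forall>\<^sub>F x in nhds s. inv_fourier h x = (1 / (2 * pi)) *\<^sub>R ((1 / (\<i> * of_real x)) *\<^sub>C (0 - J x))"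
    using t1_space_nhds[OF assms] by eventually_elim (rule inv_fourier_J)
  ultimately show ?thesis using isCont_cong[of "inv_fourier h"] by auto
qed

lemma simple_limit_inv_fourier: "simple_limit lborel (inv_fourier h)"
  by (rule simple_limit_continuous_off_0[OF isCont_inv_fourier])

lemma integrable_inv_fourier: "integrable lborel (\<lambda>s. norm (inv_fourier h s))"
proof (rule Bochner_Integration.integrable_bound)
  have "integrable lborel (\<lambda>t::real. (1 + \<bar>t\<bar>) powr (-1 - 1))" by (rule integrable_powr_tail) simp
  \<comment> \<open>The majorant uses the small bound on \<open>{-1..1}\<close> and the large bound
    outside. The factor 4 comes from \<open>1 + \<bar>t\<bar> \<le> 2 * \<bar>t\<bar>\<close>,
    squared, and the summand at the single point 0 absorbs the unspecified value there.\<close>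
  then show "integrable lborel (\<lambda>t::real. (4 * C + 2 * M0) * (indicator {-1..1} t * \<bar>t\<bar> powr (\<epsilon> - 1))
      + (4 * (2 * C + M0)) * (1 + \<bar>t\<bar>) powr (-1 - 1) + indicator {0} t * norm (inv_fourier h 0))"
    by (intro Bochner_Integration.integrable_add integrable_mult_right integrable_powr_min eps
          integrable_mult_left) auto
  show "(\<lambda>s. norm (inv_fourier h s)) \<in> borel_measurable lborel"
    by (rule simple_limit_norm_measurable[OF simple_limit_inv_fourier])
  have M0: "0 \<le> M0" unfolding M0_def using m_nonneg by simp
  have "norm (inv_fourier h t) \<le> (4 * C + 2 * M0) * (indicator {-1..1} t * \<bar>t\<bar> powr (\<epsilon> - 1))
      + (4 * (2 * C + M0)) * (1 + \<bar>t\<bar>) powr (-1 - 1) + indicator {0} t * norm (inv_fourier h 0)" for t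
  proof -
    consider "t = 0" | "t \<noteq> 0" "\<bar>t\<bar> \<le> 1" | "\<bar>t\<bar> > 1" by linarith
    then show ?thesis
    proof cases
      case 1 then show ?thesis using C_nonneg M0 by simp
    next
      case 2
      then show ?thesis using inv_fourier_bound_small[of t] C_nonneg M0
        by (auto simp: indicator_def abs_le_iff intro!: add_increasing2)
    next
      case 3
      have "\<bar>t\<bar> powr -2 \<le> 4 * (1 + \<bar>t\<bar>) powr -2"
      proof -
        have "(1 + \<bar>t\<bar>)\<^sup>2 \<le> (2 * \<bar>t\<bar>)\<^sup>2" using 3 by (intro power_mono) auto
        then show ?thesis using 3 by (simp add: powr_minus powr_numeral field_simps)
      qed
      then have "(2 * C + M0) * \<bar>t\<bar> powr -2 \<le> (2 * C + M0) * (4 * (1 + \<bar>t\<bar>) powr -2)"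
        using C_nonneg M0 by (intro mult_left_mono) auto
      then have "norm (inv_fourier h t) \<le> (2 * C + M0) * (4 * (1 + \<bar>t\<bar>) powr -2)"
        using inv_fourier_bound_large[of t] 3 by (elim order_trans[rotated]) auto
      then have "norm (inv_fourier h t) \<le> (4 * (2 * C + M0)) * (1 + \<bar>t\<bar>) powr (-1 - 1)" by (simp add: algebra_simps)
      moreover have "indicator {-1..1} t = (0 :: real)" "indicator {0} t = (0 :: real)"
        using 3 by (auto simp: indicator_def)
      ultimately show ?thesis by simp
    qed
  qed
  then show "AE t in lborel. norm (norm (inv_fourier h t)) \<le> norm ((4 * C + 2 * M0) * (indicator {-1..1} t * \<bar>t\<bar> powr (\<epsilon> - 1))
      + (4 * (2 * C + M0)) * (1 + \<bar>t\<bar>) powr (-1 - 1) + indicator {0} t * norm (inv_fourier h 0))"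
    by (intro AE_I2) (simp add: order_trans[OF _ abs_ge_self])
qed

text \<open>Truncations are differentiable at every \<open>s\<close>, also at 0, where the limit
  need not exist. The equation for the kernel is therefore derived for truncations and only then
  passed to the limit.\<close>

lemma partial_derivative:
  "(partial_inv_fourier h N has_vector_derivative
    partial_inv_fourier (\<lambda>t. (\<i> * of_real t) *\<^sub>C h t) N s) (at s within S)"
proof -
  have "((\<lambda>s. integral (cbox (-N) N) (\<lambda>t. cis (s * t) *\<^sub>C h t)) has_vector_derivative
      integral (cbox (-N) N) (\<lambda>t. cis (s * t) *\<^sub>C (\<i> * of_real t) *\<^sub>C h t)) (at s within UNIV)"
  proof (rule leibniz_rule_vector_derivative)
    fix x t :: real
    have "((\<lambda>x. cis (t * x)) has_vector_derivative (\<i> * of_real t * cis (t * x))) (at x)"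
      by (rule has_vector_derivative_cis)
    then have "((\<lambda>x. cis (x * t)) has_vector_derivative (\<i> * of_real t * cis (x * t))) (at x)"
      by (simp add: mult.commute)
    from scaleC.has_vector_derivative[OF this has_vector_derivative_const[of "h t"]]
    show "((\<lambda>x. cis (x * t) *\<^sub>C h t) has_vector_derivative cis (x * t) *\<^sub>C (\<i> * complex_of_real t) *\<^sub>C h t) (at x within UNIV)"
      by (simp add: scaleC_scaleC mult_ac scaleC.zero_right)
  next
    show "continuous_on (UNIV \<times> cbox (- N) N) (\<lambda>(x, t). cis (x * t) *\<^sub>C (\<i> * complex_of_real t) *\<^sub>C h t)"
      unfolding case_prod_beta
      by (intro continuous_intros continuous_on_compose2[OF c0]) auto
  qed (use scaleC_cis_integrable(2)[OF c0] in auto)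
  then have "((\<lambda>s. integral {-N..N} (\<lambda>t. cis (s * t) *\<^sub>C h t)) has_vector_derivative
      integral {-N..N} (\<lambda>t. cis (s * t) *\<^sub>C (\<i> * of_real t) *\<^sub>C h t)) (at s within S)"
    unfolding cbox_interval by (rule has_vector_derivative_at_within)
  from bounded_linear.has_vector_derivative[OF bounded_linear_scaleR_right this, of "1 / (2 * pi)"]
  show ?thesis unfolding partial_inv_fourier_def .
qed

end

section \<open>Smooth cutoff functions\<close>

lemma DERIV_max_power:
  fixes x :: real
  shows "((\<lambda>x. max 0 x ^ Suc (Suc n)) has_field_derivative (real (Suc (Suc n)) * max 0 x ^ Suc n)) (at x)"
proof -
  consider "x < 0" | "x > 0" | "x = 0" by linarith
  then show ?thesis
  proof cases
    case 1
    have "((\<lambda>x::real. 0) has_field_derivative 0) (at x)" by simp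
    then have "((\<lambda>x. max 0 x ^ Suc (Suc n)) has_field_derivative 0) (at x)"
      by (rule has_field_derivative_transform_within_open[of _ _ _ "{..<0}"]) (use 1 in auto)
    then show ?thesis using 1 by simp
  next
    case 2
    have "((\<lambda>x. x ^ Suc (Suc n)) has_field_derivative (real (Suc (Suc n)) * x ^ Suc n)) (at x)"
      by (rule DERIV_pow[of "Suc (Suc n)", simplified diff_Suc_Suc diff_zero])
    then have "((\<lambda>x. max 0 x ^ Suc (Suc n)) has_field_derivative (real (Suc (Suc n)) * x ^ Suc n)) (at x)"
      by (rule has_field_derivative_transform_within_open[of _ _ _ "{0<..}"]) (use 2 in auto)
    then show ?thesis using 2 by simp
  next
    case 3
    have "((\<lambda>h::real. \<bar>h\<bar> ^ Suc n) \<longlongrightarrow> \<bar>0\<bar> ^ Suc n) (at 0)" by (intro tendsto_intros)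
    then have lim: "((\<lambda>h::real. \<bar>h\<bar> ^ Suc n) \<longlongrightarrow> 0) (at 0)" by simp
    have "norm (max 0 h ^ Suc (Suc n) / h) \<le> \<bar>h\<bar> ^ Suc n" for h :: real
    proof (cases "h > 0")
      case False
      then have "max 0 h = 0" by simp
      then show ?thesis by (simp only: power_Suc mult_zero_left div_0 norm_zero zero_le_power abs_ge_zero
          mult_nonneg_nonneg)
    qed (simp add: max_def)
    then have "((\<lambda>h::real. max 0 h ^ Suc (Suc n) / h) \<longlongrightarrow> 0) (at 0)"
      by (intro Lim_null_comparison[OF always_eventually lim] allI)
    then show ?thesis using 3 by (simp add: DERIV_def)
  qed
qed

definition C2 :: "(real \<Rightarrow> real) \<Rightarrow> bool" where
  "C2 f \<longleftrightarrow> (\<exists>f1 f2. (\<forall>t. (f has_field_derivative f1 t) (at t)) \<and>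
    (\<forall>t. (f1 has_field_derivative f2 t) (at t)) \<and> continuous_on UNIV f2)"

lemma C2I:
  "(\<And>t. (f has_field_derivative f1 t) (at t)) \<Longrightarrow> (\<And>t. (f1 has_field_derivative f2 t) (at t)) \<Longrightarrow>
    continuous_on UNIV f2 \<Longrightarrow> C2 f"
  unfolding C2_def by blast

lemma C2E:
  assumes "C2 f"
  obtains f1 f2 where "\<And>t. (f has_field_derivative f1 t) (at t)"
    "\<And>t. (f1 has_field_derivative f2 t) (at t)" "continuous_on UNIV f2"
  using assms unfolding C2_def by blast

lemma continuous_on_DERIV: "(\<And>t. (f has_field_derivative f1 t) (at t)) \<Longrightarrow> continuous_on A (f :: real \<Rightarrow> real)"
  by (meson DERIV_isCont continuous_at_imp_continuous_on)

lemma C2_continuous: "C2 f \<Longrightarrow> continuous_on A f"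
  by (erule C2E) (rule continuous_on_DERIV)

lemma C2_const: "C2 (\<lambda>t. c)"
  by (rule C2I[where ?f1.0 = "\<lambda>t. 0" and ?f2.0 = "\<lambda>t. 0"]) auto

lemma C2_diff:
  assumes "C2 f" "C2 g"
  shows "C2 (\<lambda>t. f t - g t)"
proof -
  obtain f1 f2 where f: "\<And>t. (f has_field_derivative f1 t) (at t)"
    "\<And>t. (f1 has_field_derivative f2 t) (at t)" "continuous_on UNIV f2" using C2E[OF assms(1)] by blast
  obtain g1 g2 where g: "\<And>t. (g has_field_derivative g1 t) (at t)"
    "\<And>t. (g1 has_field_derivative g2 t) (at t)" "continuous_on UNIV g2" using C2E[OF assms(2)] by blast
  show ?thesis
    by (rule C2I[where ?f1.0 = "\<lambda>t. f1 t - g1 t" and ?f2.0 = "\<lambda>t. f2 t - g2 t"])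
       (auto intro!: derivative_intros f g continuous_intros)
qed

lemma C2_mult:
  assumes "C2 f" "C2 g"
  shows "C2 (\<lambda>t. f t * g t)"
proof -
  obtain f1 f2 where f: "\<And>t. (f has_field_derivative f1 t) (at t)"
    "\<And>t. (f1 has_field_derivative f2 t) (at t)" "continuous_on UNIV f2" using C2E[OF assms(1)] by blast
  obtain g1 g2 where g: "\<And>t. (g has_field_derivative g1 t) (at t)"
    "\<And>t. (g1 has_field_derivative g2 t) (at t)" "continuous_on UNIV g2" using C2E[OF assms(2)] by blast
  note c = continuous_on_DERIV[OF f(1)] continuous_on_DERIV[OF f(2)]
    continuous_on_DERIV[OF g(1)] continuous_on_DERIV[OF g(2)]
  have "((\<lambda>t. f t * g t) has_field_derivative f1 t * g t + f t * g1 t) (at t)" for t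
    using DERIV_mult[OF f(1) g(1), of t] by (simp add: mult.commute add.commute)
  moreover have "((\<lambda>t. f1 t * g t + f t * g1 t) has_field_derivative (f2 t * g t + f1 t * g1 t) + (f1 t * g1 t + f t * g2 t)) (at t)" for t
    using DERIV_add[OF DERIV_mult[OF f(2) g(1), of t] DERIV_mult[OF f(1) g(2), of t]]
    by (simp add: mult.commute add.commute add.left_commute)
  ultimately show ?thesis
    by (rule C2I) (intro continuous_intros c f g)
qed

lemma C2_compose:
  assumes "C2 f" "C2 g"
  shows "C2 (\<lambda>t. f (g t))"
proof -
  obtain f1 f2 where f: "\<And>t. (f has_field_derivative f1 t) (at t)"
    "\<And>t. (f1 has_field_derivative f2 t) (at t)" "continuous_on UNIV f2" using C2E[OF assms(1)] by blast
  obtain g1 g2 where g: "\<And>t. (g has_field_derivative g1 t) (at t)"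
    "\<And>t. (g1 has_field_derivative g2 t) (at t)" "continuous_on UNIV g2" using C2E[OF assms(2)] by blast
  note c = continuous_on_DERIV[OF f(1)] continuous_on_DERIV[OF f(2)]
    continuous_on_DERIV[OF g(1)] continuous_on_DERIV[OF g(2)]
  have "((\<lambda>t. f (g t)) has_field_derivative f1 (g t) * g1 t) (at t)" for t
    by (rule DERIV_chain2[OF f(1) g(1)])
  moreover have "((\<lambda>t. f1 (g t) * g1 t) has_field_derivative f2 (g t) * g1 t * g1 t + g2 t * f1 (g t)) (at t)" for t
    by (rule DERIV_mult[OF DERIV_chain2[OF f(2) g(1)] g(2)])
  ultimately show ?thesis
    by (rule C2I) (intro continuous_intros c f g continuous_on_compose2[OF f(3) c(3) subset_UNIV]
        continuous_on_compose2[OF c(2) c(3) subset_UNIV])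
qed

lemma C2_id: "C2 (\<lambda>t. t)"
  by (rule C2I[where ?f1.0 = "\<lambda>t. 1" and ?f2.0 = "\<lambda>t. 0"]) auto

lemma C2_affine: "C2 f \<Longrightarrow> C2 (\<lambda>t. f ((t - w) / r))"
  unfolding divide_inverse by (erule C2_compose[OF _ C2_mult[OF C2_diff[OF C2_id C2_const] C2_const]])

lemma C2_max_cube: "C2 (\<lambda>x. max 0 x ^ 3)"
  unfolding numeral_3_eq_3
  by (rule C2I[OF DERIV_max_power DERIV_cmult[OF DERIV_max_power]]) (intro continuous_intros)

text \<open>Two nested clamped cubes, since \<open>max 0 x ^ 3\<close> is \<open>C2\<close>. For
  \<open>\<bar>t\<bar> \<le> 1\<close> the inner cube is 0 and the value is 1; once the square of
  \<open>t\<close> reaches 2 the inner cube is at least 1 and the value is 0. The radius 2 used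
  below is a convenient round number.\<close>

definition bump :: "real \<Rightarrow> real" where
  "bump t = max 0 (1 - max 0 (t\<^sup>2 - 1) ^ 3) ^ 3"

lemma C2_bump: "C2 bump"
  unfolding bump_def[abs_def] power2_eq_square
  by (rule C2_compose[OF C2_max_cube C2_diff[OF C2_const
        C2_compose[OF C2_max_cube C2_diff[OF C2_mult[OF C2_id C2_id] C2_const]]]])

lemma bump_eq_1: "\<bar>t\<bar> \<le> 1 \<Longrightarrow> bump t = 1"
  using abs_square_le_1[of t] by (simp add: bump_def)

lemma bump_eq_0: "2 \<le> \<bar>t\<bar> \<Longrightarrow> bump t = 0"
proof -
  assume "2 \<le> \<bar>t\<bar>"
  then have "2\<^sup>2 \<le> \<bar>t\<bar>\<^sup>2" by (intro power_mono) auto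
  then have "1 \<le> max 0 (t\<^sup>2 - 1)" by simp
  then have "1 \<le> max 0 (t\<^sup>2 - 1) ^ 3" by (rule one_le_power)
  then show ?thesis by (simp add: bump_def)
qed

text \<open>Continuity bounds \<open>f\<close> on the compact middle part, where the weight is
  bounded below, so only large \<open>\<bar>t\<bar>\<close> has to be estimated.\<close>

lemma continuous_decay:
  fixes f :: "real \<Rightarrow> 'b::real_normed_vector"
  assumes f: "continuous_on UNIV f" and le: "\<And>t. \<bar>t\<bar> > M \<Longrightarrow> norm (f t) \<le> c * (1 + \<bar>t\<bar>) powr (-p)" and "0 \<le> p"
  obtains C where "0 \<le> C" "\<And>t. norm (f t) \<le> C * (1 + \<bar>t\<bar>) powr (-p)"
proof -
  have "bounded (f ` {-M..M})"
    by (intro compact_imp_bounded compact_continuous_image continuous_on_subset[OF f]) auto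
  then obtain B where B: "B > 0" "\<And>t. \<bar>t\<bar> \<le> M \<Longrightarrow> norm (f t) \<le> B"
    by (fastforce simp: bounded_pos abs_le_iff)
  have "norm (f t) \<le> (B * (1 + \<bar>M\<bar>) powr p + \<bar>c\<bar>) * (1 + \<bar>t\<bar>) powr (-p)" for t
  proof (cases "\<bar>t\<bar> \<le> M")
    case True
    have "(1 + \<bar>t\<bar>) powr p \<le> (1 + \<bar>M\<bar>) powr p" using True assms(3) by (intro powr_mono2) auto
    then have "1 \<le> (1 + \<bar>M\<bar>) powr p * (1 + \<bar>t\<bar>) powr (-p)"
      by (simp add: powr_minus field_simps add_pos_nonneg)
    then have "B * 1 \<le> B * ((1 + \<bar>M\<bar>) powr p * (1 + \<bar>t\<bar>) powr (-p))" using B(1) by (intro mult_left_mono) auto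
    moreover have "0 \<le> \<bar>c\<bar> * (1 + \<bar>t\<bar>) powr (-p)" by simp
    ultimately show ?thesis using B(2)[OF True] unfolding distrib_right by (simp only: mult.assoc)
  next
    case False
    have "norm (f t) \<le> \<bar>c\<bar> * (1 + \<bar>t\<bar>) powr (-p)"
      using le[of t] False by (intro order_trans[OF _ mult_right_mono[OF abs_ge_self]]) auto
    also have "\<dots> \<le> (B * (1 + \<bar>M\<bar>) powr p + \<bar>c\<bar>) * (1 + \<bar>t\<bar>) powr (-p)"
      using B(1) by (intro mult_right_mono) auto
    finally show ?thesis .
  qed
  then show ?thesis using that B(1) by (metis add_nonneg_nonneg mult_nonneg_nonneg less_imp_le powr_ge_zero abs_ge_zero)
qed

lemma compact_support_decay:
  fixes f :: "real \<Rightarrow> 'b::real_normed_vector"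
  assumes "continuous_on UNIV f" "\<forall>t. \<bar>t\<bar> > R \<longrightarrow> f t = 0" "0 \<le> p"
  obtains C where "0 \<le> C" "\<And>t. norm (f t) \<le> C * (1 + \<bar>t\<bar>) powr (-p)"
  by (rule continuous_decay[of f R 0 p]) (use assms in auto)

lemma vector_derivative_eq_0_outside:
  fixes f :: "real \<Rightarrow> 'b::real_normed_vector"
  assumes "(f has_vector_derivative d) (at t)" "open S" "\<And>t. t \<in> S \<Longrightarrow> f t = 0" "t \<in> S"
  shows "d = 0"
proof -
  have "((\<lambda>t. 0 :: 'b) has_vector_derivative d) (at t)"
    using has_vector_derivative_transform_within_open[OF assms(1) assms(2,4,3)] by simp
  moreover have "((\<lambda>t. 0 :: 'b) has_vector_derivative 0) (at t)" by simp
  ultimately show ?thesis using vector_derivative_unique_at by blast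
qed

lemma C2_compact_fourier_symbol:
  assumes "C2 \<eta>" "\<forall>t. \<bar>t\<bar> > R \<longrightarrow> \<eta> t = 0"
  obtains h1 h2 C where "fourier_symbol (\<lambda>t. complex_of_real (\<eta> t)) h1 h2 1 C"
proof -
  obtain f1 f2 where f: "\<And>t. (\<eta> has_field_derivative f1 t) (at t)"
    "\<And>t. (f1 has_field_derivative f2 t) (at t)" "continuous_on UNIV f2" using C2E[OF assms(1)] by blast
  have op: "open {t::real. \<bar>t\<bar> > R}" by (intro open_Collect_less continuous_intros)
  have z1: "\<forall>t. \<bar>t\<bar> > R \<longrightarrow> f1 t = 0"
    using vector_derivative_eq_0_outside[OF _ op, of \<eta>] f(1) assms(2)
    by (auto simp: has_real_derivative_iff_has_vector_derivative)
  have z2: "\<forall>t. \<bar>t\<bar> > R \<longrightarrow> f2 t = 0"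
    using vector_derivative_eq_0_outside[OF _ op, of f1] f(2) z1
    by (auto simp: has_real_derivative_iff_has_vector_derivative)
  \<comment> \<open>The exponents 1, 3 and 2 in these three bounds are \<open>\<epsilon>\<close>,
    \<open>1 + 2 * \<epsilon>\<close> and \<open>1 + \<epsilon>\<close> for
    \<open>\<epsilon> = 1\<close>.\<close>
  obtain C0 where C0: "0 \<le> C0" "\<And>t. norm (\<eta> t) \<le> C0 * (1 + \<bar>t\<bar>) powr (-1)"
    using compact_support_decay[where p = 1, OF continuous_on_DERIV[OF f(1)] assms(2) zero_le_one] by blast
  obtain C1 where C1: "0 \<le> C1" "\<And>t. norm (f1 t) \<le> C1 * (1 + \<bar>t\<bar>) powr (-3)"
    using compact_support_decay[where p = 3, OF continuous_on_DERIV[OF f(2)] z1 zero_le_numeral] by blast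
  obtain D2 where D2: "0 \<le> D2" "\<And>t. norm (f2 t) \<le> D2 * (1 + \<bar>t\<bar>) powr (-2)"
    using compact_support_decay[where p = 2, OF f(3) z2 zero_le_numeral] by blast
  have mono: "norm x \<le> c * y \<Longrightarrow> c \<le> C0 + C1 + D2 \<Longrightarrow> 0 \<le> y \<Longrightarrow> norm x \<le> (C0 + C1 + D2) * y" for x :: real and c y
    by (meson mult_right_mono order_trans)
  have "fourier_symbol (\<lambda>t. complex_of_real (\<eta> t)) (\<lambda>t. of_real (f1 t)) (\<lambda>t. of_real (f2 t)) 1 (C0 + C1 + D2)"
  proof
    show "((\<lambda>t. complex_of_real (\<eta> t)) has_vector_derivative of_real (f1 t)) (at t)"
      "((\<lambda>t. complex_of_real (f1 t)) has_vector_derivative of_real (f2 t)) (at t)" for t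
      using f(1,2) by (auto intro!: has_vector_derivative_of_real simp: has_real_derivative_iff_has_vector_derivative)
    show "continuous_on UNIV (\<lambda>t. complex_of_real (f2 t))" by (intro continuous_intros f)
    show "norm (complex_of_real (\<eta> t)) \<le> (C0 + C1 + D2) * (1 + \<bar>t\<bar>) powr - 1" for t
      using mono[OF C0(2)[of t]] C0 C1 D2 by simp
    show "norm (complex_of_real (f1 t)) \<le> (C0 + C1 + D2) * (1 + \<bar>t\<bar>) powr (- 1 - 2 * 1)" for t
      using mono[OF C1(2)[of t]] C0 C1 D2 by simp
    show "norm (complex_of_real (f2 t)) \<le> (C0 + C1 + D2) * (1 + \<bar>t\<bar>) powr (- 1 - 1)" for t
      using mono[OF D2(2)[of t]] C0 C1 D2 by simp
  qed auto
  then show ?thesis using that by blast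
qed

section \<open>Kernels of compactly supported symbols and Fourier inversion\<close>

definition C2c :: "(real \<Rightarrow> real) \<Rightarrow> bool" where
  "C2c \<eta> \<longleftrightarrow> C2 \<eta> \<and> (\<exists>R. \<forall>t. \<bar>t\<bar> > R \<longrightarrow> \<eta> t = 0)"

lemma C2c_mult: "C2c f \<Longrightarrow> C2 g \<Longrightarrow> C2c (\<lambda>t. f t * g t)"
  unfolding C2c_def using C2_mult by (metis mult_eq_0_iff)

definition kern :: "(real \<Rightarrow> real) \<Rightarrow> real \<Rightarrow> complex" where
  "kern \<eta> = inv_fourier (\<lambda>t. complex_of_real (\<eta> t))"

lemma C2c_integrable:
  assumes "C2c \<eta>"
  shows "integrable lborel \<eta>"
proof -
  obtain R where R: "\<forall>t. \<bar>t\<bar> > R \<longrightarrow> \<eta> t = 0" and C: "C2 \<eta>" using assms unfolding C2c_def by blast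
  obtain C where C: "0 \<le> C" "\<And>t. norm (\<eta> t) \<le> C * (1 + \<bar>t\<bar>) powr (-2)"
    using compact_support_decay[where p = 2, OF C2_continuous[OF C] R zero_le_numeral] by blast
  have "integrable lborel (\<lambda>t. C * (1 + \<bar>t\<bar>) powr (-1 - 1))"
    by (intro integrable_mult_right integrable_powr_tail) auto
  then show ?thesis
    using C C2_continuous[OF \<open>C2 \<eta>\<close>]
    by (elim Bochner_Integration.integrable_bound) (auto intro!: borel_measurable_continuous_onI AE_I2)
qed

lemma C2c_partial_inv_fourier:
  assumes "C2 \<eta>" and R: "\<forall>t. \<bar>t\<bar> > R \<longrightarrow> \<eta> t = 0" and N: "R \<le> N"
  shows "partial_inv_fourier (\<lambda>t. complex_of_real (\<eta> t)) N s = (LINT t|lborel. cis (s * t) * of_real (\<eta> t)) / (2 * pi)"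
proof -
  have c: "continuous_on UNIV (\<lambda>t. cis (s * t) * complex_of_real (\<eta> t))"
    using C2_continuous[OF assms(1)] by (intro continuous_intros)
  have "C2c \<eta>" using assms unfolding C2c_def by blast
  have int: "integrable lborel (\<lambda>t. cis (s * t) * complex_of_real (\<eta> t))"
    by (rule Bochner_Integration.integrable_bound[OF C2c_integrable[OF \<open>C2c \<eta>\<close>]])
       (auto intro!: borel_measurable_continuous_onI c simp: norm_mult)
  have set: "set_integrable lborel {-N..N} (\<lambda>t. cis (s * t) * complex_of_real (\<eta> t))"
    unfolding set_integrable_def using int by (intro integrable_mult_indicator) auto
  have "integral {-N..N} (\<lambda>t. cis (s * t) * complex_of_real (\<eta> t)) =
      (LINT t|lborel. indicator {-N..N} t *\<^sub>R (cis (s * t) * complex_of_real (\<eta> t)))"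
    using set_borel_integral_eq_integral(2)[OF set] by (simp add: set_lebesgue_integral_def)
  also have "\<dots> = (LINT t|lborel. cis (s * t) * complex_of_real (\<eta> t))"
  proof (rule Bochner_Integration.integral_cong)
    fix t
    show "indicator {-N..N} t *\<^sub>R (cis (s * t) * complex_of_real (\<eta> t)) = cis (s * t) * complex_of_real (\<eta> t)"
      using R N by (cases "\<bar>t\<bar> \<le> N") (auto simp: indicator_def)
  qed simp
  finally show ?thesis by (simp add: partial_inv_fourier_def scaleR_conv_of_real)
qed

text \<open>Once the window contains the support, the truncations are constant in \<open>n\<close>.
  So the formula holds at every \<open>s\<close>, including 0.\<close>

lemma kern_eq:
  assumes "C2c \<eta>"
  shows "kern \<eta> s = (LINT t|lborel. cis (s * t) * of_real (\<eta> t)) / (2 * pi)"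
proof -
  obtain R where R: "\<forall>t. \<bar>t\<bar> > R \<longrightarrow> \<eta> t = 0" and C: "C2 \<eta>" using assms unfolding C2c_def by blast
  have "\<forall>\<^sub>F n in sequentially. (LINT t|lborel. cis (s * t) * of_real (\<eta> t)) / (2 * pi)
      = partial_inv_fourier (\<lambda>t. complex_of_real (\<eta> t)) (real n) s"
    using eventually_ge_at_top[of "nat \<lceil>R\<rceil>"]
    by eventually_elim (intro C2c_partial_inv_fourier[OF C R, symmetric], linarith)
  then have "(\<lambda>n. partial_inv_fourier (\<lambda>t. complex_of_real (\<eta> t)) (real n) s)
      \<longlonglongrightarrow> (LINT t|lborel. cis (s * t) * of_real (\<eta> t)) / (2 * pi)"
    by (rule Lim_transform_eventually[OF tendsto_const])
  then show ?thesis unfolding kern_def inv_fourier_def by (rule limI)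
qed

lemma kern_integrable:
  assumes "C2c \<eta>"
  shows "integrable lborel (kern \<eta>)"
proof -
  obtain R where R: "\<forall>t. \<bar>t\<bar> > R \<longrightarrow> \<eta> t = 0" and C: "C2 \<eta>" using assms unfolding C2c_def by blast
  obtain h1 h2 C where "fourier_symbol (\<lambda>t. complex_of_real (\<eta> t)) h1 h2 1 C"
    using C2_compact_fourier_symbol[OF C R] by blast
  then interpret fourier_symbol "\<lambda>t. complex_of_real (\<eta> t)" h1 h2 1 C .
  show ?thesis using integrable_inv_fourier simple_limit_borel_measurable[OF simple_limit_inv_fourier]
    unfolding kern_def by (simp add: integrable_norm_iff)
qed

lemma kern_isCont:
  assumes "C2c \<eta>" "s \<noteq> 0"
  shows "isCont (kern \<eta>) s"
proof -
  obtain R where R: "\<forall>t. \<bar>t\<bar> > R \<longrightarrow> \<eta> t = 0" and C: "C2 \<eta>" using assms unfolding C2c_def by blast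
  obtain h1 h2 C where "fourier_symbol (\<lambda>t. complex_of_real (\<eta> t)) h1 h2 1 C"
    using C2_compact_fourier_symbol[OF C R] by blast
  then interpret fourier_symbol "\<lambda>t. complex_of_real (\<eta> t)" h1 h2 1 C .
  show ?thesis using isCont_inv_fourier[OF assms(2)] unfolding kern_def .
qed

text \<open>The Gaussian factor makes the double integral absolutely convergent and turns the integral
  over \<open>s\<close> into the density of a normal distribution concentrating at \<open>w\<close>.\<close>

lemma gaussian_fourier:
  assumes "0 < \<sigma>"
  shows "(LINT s|lborel. cis (s * y) * of_real (exp (- (\<sigma> * s)\<^sup>2 / 2)))
    = of_real (sqrt (2 * pi) / \<sigma> * exp (- (y / \<sigma>)\<^sup>2 / 2))"
proof -
  have 1: "(LINT x|lborel. std_normal_density x *\<^sub>R iexp (y / \<sigma> * x)) = of_real (exp (- (y / \<sigma>)\<^sup>2 / 2))"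
    using fun_cong[OF char_std_normal_distribution, of "y / \<sigma>"]
    unfolding char_def by (subst (asm) integral_density) auto
  have "(LINT x|lborel. std_normal_density x *\<^sub>R iexp (y / \<sigma> * x))
      = \<sigma> *\<^sub>R (LINT s|lborel. std_normal_density (0 + \<sigma> * s) *\<^sub>R iexp (y / \<sigma> * (0 + \<sigma> * s)))"
    using lborel_integral_real_affine[of \<sigma> "\<lambda>x. std_normal_density x *\<^sub>R iexp (y / \<sigma> * x)" 0] assms by simp
  also have "(LINT s|lborel. std_normal_density (0 + \<sigma> * s) *\<^sub>R iexp (y / \<sigma> * (0 + \<sigma> * s)))
      = (LINT s|lborel. of_real (1 / sqrt (2 * pi)) * (cis (s * y) * of_real (exp (- (\<sigma> * s)\<^sup>2 / 2))))"
    using assms by (intro Bochner_Integration.integral_cong)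
      (auto simp: std_normal_density_def cis_conv_exp scaleR_conv_of_real mult_ac)
  also have "\<dots> = of_real (1 / sqrt (2 * pi)) * (LINT s|lborel. cis (s * y) * of_real (exp (- (\<sigma> * s)\<^sup>2 / 2)))"
    by (rule integral_mult_right_zero)
  finally show ?thesis
    using 1 assms by (simp add: scaleR_conv_of_real field_simps)
qed

lemma gaussian_integrable:
  assumes "0 < \<sigma>"
  shows "integrable lborel (\<lambda>s::real. exp (- (\<sigma> * s)\<^sup>2 / 2))"
proof -
  have "integrable lborel (\<lambda>s. sqrt (2 * pi) * std_normal_density (0 + \<sigma> * s))"
    using assms by (intro integrable_mult_right lborel_integrable_real_affine) auto
  then show ?thesis by (simp add: std_normal_density_def)
qed

text \<open>The second factor of the majorant may vary with \<open>x\<close> as long as its integral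
  stays below \<open>B\<close>. This covers translates \<open>b (y - x)\<close>, as they occur in
  convolutions.\<close>

lemma integrable_product_bound:
  fixes F :: "real \<times> real \<Rightarrow> 'b::{banach, second_countable_topology}"
  assumes F: "F \<in> borel_measurable (lborel \<Otimes>\<^sub>M lborel)"
    and a: "integrable lborel a" and b: "\<And>x. integrable lborel (b x)" and bI: "\<And>x. (LINT y|lborel. b x y) \<le> B"
    and le: "\<And>x y. norm (F (x, y)) \<le> a x * b x y" and a0: "\<And>x. 0 \<le> a x"
  shows "integrable (lborel \<Otimes>\<^sub>M lborel) F"
proof (rule lborel_pair.Fubini_integrable[OF F])
  have int2: "integrable lborel (\<lambda>y. F (x, y))" for x
    by (rule Bochner_Integration.integrable_bound[OF integrable_mult_right[OF b, of "a x" x]])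
       (use F le in \<open>auto intro!: AE_I2 order_trans[OF _ abs_ge_self] simp del: abs_mult\<close>)
  then show "AE x in lborel. integrable lborel (\<lambda>y. F (x, y))" by simp
  show "integrable lborel (\<lambda>x. LINT y|lborel. norm (F (x, y)))"
  proof (rule Bochner_Integration.integrable_bound[OF integrable_mult_left[OF a, of B]])
    show "(\<lambda>x. LINT y|lborel. norm (F (x, y))) \<in> borel_measurable lborel" using F by measurable
    have "(LINT y|lborel. norm (F (x, y))) \<le> a x * B" for x
    proof -
      have "(LINT y|lborel. norm (F (x, y))) \<le> (LINT y|lborel. a x * b x y)"
        using int2 b le by (intro integral_mono) auto
      also have "\<dots> \<le> a x * B" using bI[of x] a0[of x] by (simp add: mult_left_mono)
      finally show ?thesis .
    qed
    then show "AE x in lborel. norm (LINT y|lborel. norm (F (x, y))) \<le> norm (a x * B)"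
      by (intro AE_I2) (auto intro: order_trans[OF _ abs_ge_self] simp del: abs_mult)
  qed
qed

section \<open>Annihilation off the Beurling spectrum\<close>

lemma translation_continuous_L1:
  fixes G :: "real \<Rightarrow> 'b::real_normed_vector"
  assumes c: "\<And>s. s \<noteq> 0 \<Longrightarrow> isCont G s" and int: "integrable lborel (\<lambda>s. norm (G s))" and x: "x \<longlonglongrightarrow> 0"
  shows "(\<lambda>n. LINT s|lborel. norm (G (s + x n) - G s)) \<longlonglongrightarrow> 0"
proof -
  have sl: "simple_limit lborel G" by (rule simple_limit_continuous_off_0[OF c])
  have sls: "simple_limit lborel (\<lambda>s. G (s + y))" for y
    by (rule simple_limit_measurable_compose[OF sl]) simp
  have ints: "integrable lborel (\<lambda>s. norm (G (s + y)))" for y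
    by (rule integrable_real_shift[OF int])
  have Is: "(LINT s|lborel. norm (G (s + y))) = (LINT s|lborel. norm (G s))" for y
    by (rule integral_real_shift)
  have [measurable]: "(\<lambda>s. norm (G s)) \<in> borel_measurable lborel" "(\<lambda>s. norm (G (s + y))) \<in> borel_measurable lborel"
    "(\<lambda>s. norm (G (s + y) - G s)) \<in> borel_measurable lborel" for y
    by (intro simple_limit_norm_measurable simple_limit_diff sl sls)+
  have intd: "integrable lborel (\<lambda>s. norm (G (s + y) - G s))" for y
    by (rule Bochner_Integration.integrable_bound[OF Bochner_Integration.integrable_add[OF ints int]])
       (auto intro!: AE_I2 norm_triangle_ineq4)
  \<comment> \<open>Scheffe's argument. The translates have no common integrable majorant, but their
    norms have the same integral as \<open>norm (G s)\<close>. Capping at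
    \<open>2 * norm (G s)\<close> makes dominated convergence applicable to \<open>q\<close>, and
    the integral of \<open>q\<close> bounds that of the difference from the other side.\<close>
  define q where "q y s = min (norm (G (s + y)) + norm (G s) - norm (G (s + y) - G s)) (2 * norm (G s))" for y s
  have q0: "0 \<le> q y s" for y s unfolding q_def using norm_triangle_ineq4[of "G (s + y)" "G s"] by auto
  have qm[measurable]: "q y \<in> borel_measurable lborel" for y unfolding q_def by measurable
  have intq: "integrable lborel (q y)" for y
    by (rule Bochner_Integration.integrable_bound[OF integrable_mult_right[OF int, of 2]])
       (use q0 in \<open>auto intro!: AE_I2 simp: q_def\<close>)
  have "(\<lambda>n. LINT s|lborel. q (x n) s) \<longlonglongrightarrow> (LINT s|lborel. 2 * norm (G s))"
  proof (rule integral_dominated_convergence[where w = "\<lambda>s. 2 * norm (G s)"])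
    show "AE s in lborel. (\<lambda>n. q (x n) s) \<longlonglongrightarrow> 2 * norm (G s)"
    proof -
      have "(\<lambda>n. q (x n) s) \<longlonglongrightarrow> 2 * norm (G s)" if "s \<noteq> 0" for s
      proof -
        have "(\<lambda>n. s + x n) \<longlonglongrightarrow> s + 0" by (intro tendsto_intros x)
        then have g: "(\<lambda>n. G (s + x n)) \<longlonglongrightarrow> G s" using isCont_tendsto_compose[OF c[OF that]] by simp
        have "(\<lambda>n. q (x n) s) \<longlonglongrightarrow> min (norm (G s) + norm (G s) - norm (G s - G s)) (2 * norm (G s))"
          unfolding q_def by (intro tendsto_intros tendsto_min g)
        then show ?thesis by simp
      qed
      then show ?thesis using AE_lborel_singleton[of 0] by (auto elim!: eventually_mono)
    qed
    show "AE s in lborel. norm (q (x n) s) \<le> 2 * norm (G s)" for n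
      using q0 by (auto intro!: AE_I2 simp: q_def)
  qed (use int in auto)
  then have "(\<lambda>n. (LINT s|lborel. 2 * norm (G s)) - (LINT s|lborel. q (x n) s)) \<longlonglongrightarrow> (LINT s|lborel. 2 * norm (G s)) - (LINT s|lborel. 2 * norm (G s))"
    by (intro tendsto_intros)
  then have lim: "(\<lambda>n. (LINT s|lborel. 2 * norm (G s)) - (LINT s|lborel. q (x n) s)) \<longlonglongrightarrow> 0" by simp
  show ?thesis
  proof (rule Lim_null_comparison[OF always_eventually lim], rule allI)
    fix n
    have "(LINT s|lborel. q (x n) s) \<le> (LINT s|lborel. norm (G (s + x n)) + norm (G s) - norm (G (s + x n) - G s))"
      using intq ints int intd by (intro integral_mono) (auto simp: q_def)
    also have "\<dots> = (LINT s|lborel. 2 * norm (G s)) - (LINT s|lborel. norm (G (s + x n) - G s))"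
      using ints int intd by (simp add: Is)
    finally show "norm (LINT s|lborel. norm (G (s + x n) - G s))
        \<le> (LINT s|lborel. 2 * norm (G s)) - (LINT s|lborel. q (x n) s)" by simp
  qed
qed

lemma cis_measurable [measurable]: "cis \<in> borel_measurable borel"
  unfolding cis_conv_exp by (intro borel_measurable_continuous_onI continuous_intros)

lemma C2c_borel [measurable_dest]: "C2c \<eta> \<Longrightarrow> \<eta> \<in> borel_measurable borel"
  unfolding C2c_def by (auto intro: borel_measurable_continuous_onI C2_continuous)

lemma fourier_cis: "fourier f w = (LINT s|lborel. f s * cis (- (w * s)))"
  unfolding fourier_def by (simp add: cis_conv_exp mult.assoc)

lemma C2c_bounded:
  assumes "C2c \<eta>"
  obtains B where "\<And>t. \<bar>\<eta> t\<bar> \<le> B"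
proof -
  obtain R where R: "\<forall>t. \<bar>t\<bar> > R \<longrightarrow> \<eta> t = 0" and C: "C2 \<eta>" using assms unfolding C2c_def by blast
  obtain C where "0 \<le> C" "\<And>t. norm (\<eta> t) \<le> C * (1 + \<bar>t\<bar>) powr - 0"
    using compact_support_decay[where p = 0, OF C2_continuous[OF C] R order_refl] by blast
  moreover have "(1 + \<bar>t\<bar>) powr - 0 = 1" for t :: real by (simp add: add_nonneg_eq_0_iff)
  ultimately show ?thesis using that[of C] by (simp only: mult_1_right real_norm_def)
qed

text \<open>Fourier inversion by computing \<open>A \<sigma>\<close> twice. As a regularised
  transform of the kernel it tends to the left side; after Fubini it is an average of \<eta> around
  \<open>w\<close> with a Gaussian weight of width \<sigma>, which tends to
  \<open>\<eta> w\<close>.\<close>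

lemma fourier_kern:
  assumes \<eta>: "C2c \<eta>"
  shows "fourier (kern \<eta>) w = of_real (\<eta> w)"
proof -
  let ?k = "\<lambda>s. kern \<eta> s * cis (- (w * s))"
  let ?E = "\<lambda>\<sigma> s. complex_of_real (exp (- (\<sigma> * s)\<^sup>2 / 2))"
  note [measurable] = C2c_borel[OF \<eta>]
  note k = kern_integrable[OF \<eta>]
  note [measurable] = borel_measurable_integrable[OF k]
  obtain B where B: "\<And>t. \<bar>\<eta> t\<bar> \<le> B" using C2c_bounded[OF \<eta>] by blast
  define A where "A \<sigma> = (LINT s|lborel. ?k s * ?E \<sigma> s)" for \<sigma>
  let ?d = "\<lambda>\<sigma> t. 1 / \<sigma> * std_normal_density ((t - w) / \<sigma>)"
  have A: "A \<sigma> = of_real (LINT z|lborel. \<eta> (w + \<sigma> * z) * std_normal_density z)" if \<sigma>: "0 < \<sigma>" for \<sigma>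
  proof -
    define F where "F s t = cis (s * t) * of_real (\<eta> t) / (2 * pi) * cis (- (w * s)) * ?E \<sigma> s" for s t
    have "integrable (lborel \<Otimes>\<^sub>M lborel) (\<lambda>(s, t). F s t)"
    proof (rule integrable_product_bound[where b = "\<lambda>s t. \<bar>\<eta> t\<bar>", OF _ gaussian_integrable[OF \<sigma>] _ order_refl])
      show "integrable lborel (\<lambda>t. \<bar>\<eta> t\<bar>)" using C2c_integrable[OF \<eta>] by simp
      show "norm (case (s, t) of (s, t) \<Rightarrow> F s t) \<le> exp (- (\<sigma> * s)\<^sup>2 / 2) * \<bar>\<eta> t\<bar>" for s t
      proof -
        have "\<bar>\<eta> t\<bar> / (2 * pi) \<le> \<bar>\<eta> t\<bar> / 1" using pi_gt3 by (intro divide_left_mono) auto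
        then have "exp (- (\<sigma> * s)\<^sup>2 / 2) * (\<bar>\<eta> t\<bar> / (2 * pi)) \<le> exp (- (\<sigma> * s)\<^sup>2 / 2) * \<bar>\<eta> t\<bar>"
          by (intro mult_left_mono) auto
        then show ?thesis by (simp add: F_def norm_mult norm_divide mult.commute)
      qed
    qed (auto simp: F_def)
    note swap = lborel_pair.Fubini_integral[OF this]
    have "(LINT t|lborel. F s t) = ?k s * ?E \<sigma> s" for s
    proof -
      have "(LINT t|lborel. F s t) = (LINT t|lborel. (cis (s * t) * of_real (\<eta> t)) *
          (cis (- (w * s)) * ?E \<sigma> s / (2 * pi)))"
        unfolding F_def by (intro Bochner_Integration.integral_cong refl) (simp only: times_divide_eq_left times_divide_eq_right mult.assoc)
      then show ?thesis unfolding integral_mult_left_zero kern_eq[OF \<eta>]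
        by (simp only: times_divide_eq_left times_divide_eq_right mult.assoc)
    qed
    then have "A \<sigma> = (LINT s|lborel. LINT t|lborel. F s t)" by (simp only: A_def)
    also have "\<dots> = (LINT t|lborel. LINT s|lborel. F s t)" by (rule swap[symmetric])
    also have "\<dots> = (LINT t|lborel. of_real (\<eta> t / (2 * pi)) * (LINT s|lborel. cis (s * (t - w)) * ?E \<sigma> s))"
    proof (rule Bochner_Integration.integral_cong[OF refl])
      fix t
      have "(LINT s|lborel. F s t) = (LINT s|lborel. of_real (\<eta> t / (2 * pi)) * (cis (s * (t - w)) * ?E \<sigma> s))"
      proof (rule Bochner_Integration.integral_cong[OF refl])
        fix s
        have "cis (s * (t - w)) = cis (s * t) * cis (- (w * s))" by (simp add: cis_mult algebra_simps)
        then show "F s t = of_real (\<eta> t / (2 * pi)) * (cis (s * (t - w)) * ?E \<sigma> s)"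
          by (simp add: F_def)
      qed
      then show "(LINT s|lborel. F s t) = of_real (\<eta> t / (2 * pi)) * (LINT s|lborel. cis (s * (t - w)) * ?E \<sigma> s)"
        by simp
    qed
    also have "\<dots> = (LINT t|lborel. of_real (\<eta> t * ?d \<sigma> t))"
    proof (rule Bochner_Integration.integral_cong[OF refl])
      fix t
      have gen: "x / (r * r) * (r / \<sigma> * E) = x * (1 / \<sigma> * (1 / r * E))" if "r \<noteq> 0" for x r E :: real
        using that \<sigma> by (simp add: field_simps)
      have r: "sqrt (2 * pi) * sqrt (2 * pi) = 2 * pi" using pi_ge_zero by simp
      have "\<eta> t / (2 * pi) * (sqrt (2 * pi) / \<sigma> * exp (- ((t - w) / \<sigma>)\<^sup>2 / 2)) = \<eta> t * ?d \<sigma> t"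
        using gen[of "sqrt (2 * pi)" "\<eta> t" "exp (- ((t - w) / \<sigma>)\<^sup>2 / 2)"] unfolding std_normal_density_def r
        using pi_neq_zero by simp
      then show "of_real (\<eta> t / (2 * pi)) * (LINT s|lborel. cis (s * (t - w)) * ?E \<sigma> s)
        = of_real (\<eta> t * ?d \<sigma> t)"
        unfolding gaussian_fourier[OF \<sigma>] of_real_mult[symmetric] by simp
    qed
    also have "\<dots> = of_real (LINT t|lborel. \<eta> t * ?d \<sigma> t)"
      by (rule integral_complex_of_real)
    also have "(LINT t|lborel. \<eta> t * ?d \<sigma> t)
        = \<sigma> * (LINT z|lborel. \<eta> (w + \<sigma> * z) * ?d \<sigma> (w + \<sigma> * z))"
      using lborel_integral_real_affine[of \<sigma> "\<lambda>t. \<eta> t * ?d \<sigma> t" w] \<sigma> by simp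
    also have "\<dots> = (LINT z|lborel. \<eta> (w + \<sigma> * z) * std_normal_density z)"
    proof -
      have "\<sigma> * (x * ?d \<sigma> (w + \<sigma> * z)) = x * std_normal_density z" for x z
        using \<sigma> by simp
      then show ?thesis by (simp only: integral_mult_right_zero[symmetric])
    qed
    finally show ?thesis .
  qed
  define \<sigma> where "\<sigma> n = 1 / (real n + 1)" for n
  have \<sigma>: "0 < \<sigma> n" for n by (simp add: \<sigma>_def)
  have \<sigma>0: "\<sigma> \<longlonglongrightarrow> 0" unfolding \<sigma>_def by real_asymp
  have "(\<lambda>n. A (\<sigma> n)) \<longlonglongrightarrow> (LINT s|lborel. ?k s)"
    unfolding A_def
  proof (rule integral_dominated_convergence[where w = "\<lambda>s. norm (kern \<eta> s)"])
    show "AE s in lborel. (\<lambda>n. ?k s * ?E (\<sigma> n) s) \<longlonglongrightarrow> ?k s"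
    proof (rule AE_I2)
      fix s
      have "(\<lambda>n. ?k s * ?E (\<sigma> n) s) \<longlonglongrightarrow> ?k s * ?E 0 s"
        by (intro tendsto_intros \<sigma>0) auto
      then show "(\<lambda>n. ?k s * ?E (\<sigma> n) s) \<longlonglongrightarrow> ?k s" by simp
    qed
  qed (use k in \<open>auto simp: norm_mult mult_left_le intro!: AE_I2\<close>)
  moreover have "(\<lambda>n. A (\<sigma> n)) \<longlonglongrightarrow> of_real (LINT z|lborel. \<eta> w * std_normal_density z)"
    unfolding A[OF \<sigma>]
  proof (rule tendsto_of_real, rule integral_dominated_convergence[where w = "\<lambda>z. B * std_normal_density z"])
    show "AE z in lborel. (\<lambda>n. \<eta> (w + \<sigma> n * z) * std_normal_density z) \<longlonglongrightarrow> \<eta> w * std_normal_density z"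
    proof (rule AE_I2)
      fix z
      have "isCont \<eta> w" using \<eta> C2_continuous[of \<eta> UNIV] by (auto simp: C2c_def continuous_on_eq_continuous_at)
      moreover have "(\<lambda>n. w + \<sigma> n * z) \<longlonglongrightarrow> w + 0 * z" by (intro tendsto_intros \<sigma>0)
      ultimately have "(\<lambda>n. \<eta> (w + \<sigma> n * z)) \<longlonglongrightarrow> \<eta> w" using isCont_tendsto_compose by fastforce
      then show "(\<lambda>n. \<eta> (w + \<sigma> n * z) * std_normal_density z) \<longlonglongrightarrow> \<eta> w * std_normal_density z"
        by (intro tendsto_intros)
    qed
    show "AE z in lborel. norm (\<eta> (w + \<sigma> n * z) * std_normal_density z) \<le> B * std_normal_density z" for n
      using B by (intro AE_I2) (simp add: abs_mult mult_right_mono)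
  qed auto
  ultimately have "(LINT s|lborel. ?k s) = of_real (LINT z|lborel. \<eta> w * std_normal_density z)"
    by (rule LIMSEQ_unique)
  then show ?thesis by (simp add: fourier_cis)
qed

section \<open>Scalar convolutions and narrow approximate units\<close>

lemma integrable_mult_bounded:
  fixes a p :: "real \<Rightarrow> complex"
  assumes "integrable lborel a" "p \<in> borel_measurable borel" "\<And>s. norm (p s) \<le> B"
  shows "integrable lborel (\<lambda>s. a s * p s)"
proof (rule Bochner_Integration.integrable_bound)
  show "integrable lborel (\<lambda>s. norm (a s) * B)" using assms(1) by (intro integrable_mult_left) auto
  show "AE s in lborel. norm (a s * p s) \<le> norm (norm (a s) * B)"
    by (intro AE_I2) (metis abs_ge_self assms(3) mult_left_mono norm_ge_zero norm_mult order_trans real_norm_def)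
qed (use assms in measurable)

lemma convolution_assoc_scalar:
  fixes a b p :: "real \<Rightarrow> complex"
  assumes a: "integrable lborel a" and b: "integrable lborel b"
    and p[measurable]: "p \<in> borel_measurable borel" and B: "\<And>s. norm (p s) \<le> B"
  shows "(LINT r|lborel. a r * (LINT s|lborel. b s * p (t - r - s)))
    = (LINT s|lborel. (LINT r|lborel. a r * b (s - r)) * p (t - s))"
proof -
  note [measurable] = borel_measurable_integrable[OF a] borel_measurable_integrable[OF b]
  define F where "F r s = a r * b (s - r) * p (t - s)" for r s
  have "integrable (lborel \<Otimes>\<^sub>M lborel) (\<lambda>(r, s). F r s)"
  proof (rule integrable_product_bound[where a = "\<lambda>r. norm (a r)" and b = "\<lambda>r s. norm (b (s - r)) * B"
        and B = "(LINT s|lborel. norm (b s)) * B"])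
    show "norm (case (r, s) of (r, s) \<Rightarrow> F r s) \<le> norm (a r) * (norm (b (s - r)) * B)" for r s
      using B[of "t - s"] by (simp add: F_def norm_mult mult_left_mono mult.assoc)
    show "integrable lborel (\<lambda>s. norm (b (s - r)) * B)" for r
      using integrable_real_shift[of "\<lambda>s. norm (b s)" "- r"] b by simp
    show "(LINT s|lborel. norm (b (s - r)) * B) \<le> (LINT s|lborel. norm (b s)) * B" for r
      using integral_real_shift[of "\<lambda>s. norm (b s)" "- r"] by simp
  qed (use a b in \<open>auto simp: F_def\<close>)
  note swap = lborel_pair.Fubini_integral[OF this]
  have "(LINT s|lborel. b s * p (t - r - s)) = (LINT s|lborel. b (s - r) * p (t - s))" for r
    using integral_real_shift[of "\<lambda>s. b s * p (t - r - s)" "- r"] by simp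
  then have "(LINT r|lborel. a r * (LINT s|lborel. b s * p (t - r - s))) = (LINT r|lborel. LINT s|lborel. F r s)"
    by (simp add: F_def mult.assoc)
  also have "\<dots> = (LINT s|lborel. LINT r|lborel. F r s)" by (rule swap[symmetric])
  also have "\<dots> = (LINT s|lborel. (LINT r|lborel. a r * b (s - r)) * p (t - s))"
    unfolding F_def by simp
  finally show ?thesis .
qed

lemma convolution_commute_scalar:
  fixes a b p :: "real \<Rightarrow> complex"
  assumes "integrable lborel a" "integrable lborel b" "p \<in> borel_measurable borel" "\<And>s. norm (p s) \<le> B"
  shows "(LINT r|lborel. a r * (LINT s|lborel. b s * p (t - r - s)))
    = (LINT s|lborel. b s * (LINT r|lborel. a r * p (t - s - r)))"
proof -
  have "(LINT r|lborel. a r * b (s - r)) = (LINT r|lborel. b r * a (s - r))" for s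
    using integral_real_reflect[of "\<lambda>r. b r * a (s - r)" s] by (simp add: mult.commute)
  then show ?thesis
    using convolution_assoc_scalar[OF assms] convolution_assoc_scalar[OF assms(2,1,3,4)] by simp
qed

text \<open>A kernel of de la Vallee-Poussin type. Dilation by \<open>d\<close> and modulation by
  \<open>w\<close> make its transform \<open>bump ((t - w) / d)\<close>, which is 1 for
  \<open>\<bar>t - w\<bar> \<le> d\<close>.\<close>

definition approx_unit :: "real \<Rightarrow> real \<Rightarrow> real \<Rightarrow> complex" where
  "approx_unit d w s = of_real d * kern bump (d * s) * cis (w * s)"

lemma C2c_bump_affine: "0 < r \<Longrightarrow> C2c (\<lambda>t. bump ((t - w) / r))"
  unfolding C2c_def
proof (intro conjI exI[of _ "\<bar>w\<bar> + 2 * r"] allI impI)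
  fix t assume r: "0 < r" "\<bar>w\<bar> + 2 * r < \<bar>t\<bar>"
  then have "2 * r \<le> \<bar>t - w\<bar>" by linarith
  then have "2 \<le> \<bar>(t - w) / r\<bar>" using r by (simp add: abs_divide field_simps)
  then show "bump ((t - w) / r) = 0" by (rule bump_eq_0)
qed (rule C2_affine[OF C2_bump])

lemma C2c_bump: "C2c bump"
  using C2c_bump_affine[of 1 0] by simp

lemma approx_unit_integrable: "0 < d \<Longrightarrow> integrable lborel (approx_unit d w)"
proof -
  assume d: "0 < d"
  have "integrable lborel (\<lambda>s. kern bump (0 + d * s))"
    using d by (intro lborel_integrable_real_affine kern_integrable C2c_bump) auto
  then have "integrable lborel (\<lambda>s. of_real d * kern bump (d * s))" by simp
  then have "integrable lborel (\<lambda>s. (of_real d * kern bump (d * s)) * cis (w * s))"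
    by (rule integrable_mult_bounded[where B = 1]) auto
  then show ?thesis unfolding approx_unit_def .
qed

lemma fourier_approx_unit:
  assumes d: "0 < d"
  shows "(LINT s|lborel. approx_unit d w s * cis (- (t * s))) = of_real (bump ((t - w) / d))"
proof -
  let ?f = "\<lambda>x. kern bump x * cis (- ((t - w) / d * x))"
  have "of_real (bump ((t - w) / d)) = (LINT x|lborel. ?f x)"
    using fourier_kern[OF C2c_bump, of "(t - w) / d"] by (simp add: fourier_cis)
  also have "\<dots> = d *\<^sub>R (LINT s|lborel. ?f (0 + d * s))"
    using lborel_integral_real_affine[of d ?f 0] d by simp
  also have "\<dots> = (LINT s|lborel. of_real d * ?f (0 + d * s))" by (simp add: scaleR_conv_of_real)
  also have "\<dots> = (LINT s|lborel. approx_unit d w s * cis (- (t * s)))"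
  proof (rule Bochner_Integration.integral_cong[OF refl])
    fix s
    have "(t - w) / d * (0 + d * s) = (t - w) * s" using d by simp
    then have "cis (- ((t - w) / d * (0 + d * s))) = cis (w * s) * cis (- (t * s))"
      by (simp only: cis_mult) (simp add: algebra_simps)
    then show "of_real d * ?f (0 + d * s) = approx_unit d w s * cis (- (t * s))"
      by (simp add: approx_unit_def)
  qed
  finally show ?thesis by simp
qed

text \<open>On the Fourier side this is multiplication of \<eta> by a function that equals 1 on its
  support. Only the absolutely convergent formula \<open>kern_eq\<close> and one application of
  Fubini are used.\<close>

lemma kern_approx_unit:
  assumes \<eta>: "C2c \<eta>" and d: "0 < d" and supp: "\<forall>t. d < \<bar>t - w\<bar> \<longrightarrow> \<eta> t = 0"
  shows "(LINT r|lborel. approx_unit d w r * kern \<eta> (s - r)) = kern \<eta> s"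
proof -
  note [measurable] = C2c_borel[OF \<eta>] borel_measurable_integrable[OF approx_unit_integrable[OF d, of w]]
  define F where "F r t = approx_unit d w r * cis ((s - r) * t) * of_real (\<eta> t) / (2 * pi)" for r t
  have "integrable (lborel \<Otimes>\<^sub>M lborel) (\<lambda>(r, t). F r t)"
  proof (rule integrable_product_bound[where a = "\<lambda>r. norm (approx_unit d w r)" and b = "\<lambda>r t. \<bar>\<eta> t\<bar>", OF _ _ _ order_refl])
    show "norm (case (r, t) of (r, t) \<Rightarrow> F r t) \<le> norm (approx_unit d w r) * \<bar>\<eta> t\<bar>" for r t
    proof -
      have "(norm (approx_unit d w r) * \<bar>\<eta> t\<bar>) / (2 * pi) \<le> (norm (approx_unit d w r) * \<bar>\<eta> t\<bar>) / 1"
        using pi_gt3 by (intro divide_left_mono) auto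
      then show ?thesis by (simp add: F_def norm_mult norm_divide)
    qed
  qed (use C2c_integrable[OF \<eta>] approx_unit_integrable[OF d, of w] in \<open>auto simp: F_def\<close>)
  note swap = lborel_pair.Fubini_integral[OF this]
  have "(LINT t|lborel. F r t) = approx_unit d w r * kern \<eta> (s - r)" for r
  proof -
    have "(LINT t|lborel. F r t) = (LINT t|lborel. (cis ((s - r) * t) * of_real (\<eta> t)) * (approx_unit d w r / (2 * pi)))"
      unfolding F_def by (intro Bochner_Integration.integral_cong refl) (simp add: mult_ac)
    then show ?thesis unfolding integral_mult_left_zero kern_eq[OF \<eta>] by (simp only: times_divide_eq_left times_divide_eq_right mult.commute)
  qed
  then have "(LINT r|lborel. approx_unit d w r * kern \<eta> (s - r)) = (LINT r|lborel. LINT t|lborel. F r t)"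
    by (simp only:)
  also have "\<dots> = (LINT t|lborel. LINT r|lborel. F r t)" by (rule swap[symmetric])
  also have "\<dots> = (LINT t|lborel. cis (s * t) * of_real (\<eta> t) / (2 * pi))"
  proof (rule Bochner_Integration.integral_cong[OF refl])
    fix t
    have "(LINT r|lborel. F r t) = (LINT r|lborel. (cis (s * t) * of_real (\<eta> t) / (2 * pi)) * (approx_unit d w r * cis (- (t * r))))"
    proof (rule Bochner_Integration.integral_cong[OF refl])
      fix r
      have "cis ((s - r) * t) = cis (s * t) * cis (- (t * r))" by (simp add: cis_mult algebra_simps)
      then show "F r t = (cis (s * t) * of_real (\<eta> t) / (2 * pi)) * (approx_unit d w r * cis (- (t * r)))"
        by (simp add: F_def)
    qed
    also have "\<dots> = (cis (s * t) * of_real (\<eta> t) / (2 * pi)) * of_real (bump ((t - w) / d))"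
      by (simp only: integral_mult_right_zero fourier_approx_unit[OF d])
    also have "\<dots> = cis (s * t) * of_real (\<eta> t) / (2 * pi)"
    proof (cases "\<bar>t - w\<bar> \<le> d")
      case True
      then have "bump ((t - w) / d) = 1" using d by (intro bump_eq_1) (simp add: abs_divide)
      then show ?thesis by simp
    qed (use supp in auto)
    finally show "(LINT r|lborel. F r t) = cis (s * t) * of_real (\<eta> t) / (2 * pi)" .
  qed
  also have "\<dots> = kern \<eta> s" by (simp add: kern_eq[OF \<eta>])
  finally show ?thesis .
qed

text \<open>Iterating \<open>p = p * (v - f * v)\<close>, where \<open>v\<close> is a narrow approximate unit at \<open>w\<close>, forces \<open>p = 0\<close>
  as soon as the kernel has \<open>L\<^sup>1\<close> norm at most \<open>1/2\<close>.\<close>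

lemma local_annihilation:
  fixes p f :: "real \<Rightarrow> complex"
  assumes p[measurable]: "p \<in> borel_measurable borel" and B: "\<And>s. norm (p s) \<le> B"
    and f: "integrable lborel f" and pf: "\<And>t. (LINT s|lborel. f s * p (t - s)) = 0"
    and fw: "fourier f w \<noteq> 0"
  obtains d where "0 < d"
    "\<And>\<eta> t. C2c \<eta> \<Longrightarrow> \<forall>t. d < \<bar>t - w\<bar> \<longrightarrow> \<eta> t = 0 \<Longrightarrow> (LINT s|lborel. kern \<eta> s * p (t - s)) = 0"
proof -
  note [measurable] = borel_measurable_integrable[OF f]
  note kb = kern_integrable[OF C2c_bump]
  note [measurable] = borel_measurable_integrable[OF kb]
  define N where "N = (LINT s|lborel. norm (kern bump s))"
  have N0: "0 \<le> N" by (simp add: N_def)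
  \<comment> \<open>The modulus of continuity of the bump kernel under translation in
    \<open>L^1\<close>: bounded, and tending to 0 with \<open>x\<close>.\<close>
  define \<tau> where "\<tau> x = (LINT s|lborel. norm (kern bump (s + x) - kern bump s))" for x
  have kn: "integrable lborel (\<lambda>s. norm (kern bump s))" using kb by simp
  have ktn: "integrable lborel (\<lambda>s. norm (kern bump (s + x)))" for x
    by (rule integrable_real_shift[OF kn])
  have \<tau>m[measurable]: "\<tau> \<in> borel_measurable borel" unfolding \<tau>_def by measurable
  have \<tau>0: "0 \<le> \<tau> x" for x unfolding \<tau>_def by simp
  have \<tau>le: "\<tau> x \<le> 2 * N" for x
  proof -
    have "\<tau> x \<le> (LINT s|lborel. norm (kern bump (s + x)) + norm (kern bump s))"
      unfolding \<tau>_def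
    proof (rule integral_mono)
      show "integrable lborel (\<lambda>s. norm (kern bump (s + x) - kern bump s))"
        using integrable_real_shift[OF kb, of x] kb by simp
    qed (use kn ktn norm_triangle_ineq4 in auto)
    also have "\<dots> = 2 * N"
      unfolding N_def using kn ktn integral_real_shift[of "\<lambda>s. norm (kern bump s)" x] by simp
    finally show ?thesis .
  qed
  let ?w = "\<lambda>r. norm (f r) * (2 * N)"
  define d where "d n = 1 / (real n + 1)" for n
  have d: "0 < d n" for n by (simp add: d_def)
  have d0: "d \<longlonglongrightarrow> 0" unfolding d_def by real_asymp
  define c where "c = fourier f w"
  \<comment> \<open>With \<open>v\<close> the approximate unit of width \<open>d n\<close> at
    \<open>w\<close>, \<open>\<kappa> n\<close> will bound the \<open>L^1\<close> norm of
    \<open>c * v\<close> minus the convolution of \<open>f\<close> and \<open>v\<close>. A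
    translation of \<open>v\<close> by \<open>r\<close> is, up to a phase, a translation of the
    undilated bump kernel by \<open>d n * r\<close>, hence the argument of \<tau>. As
    \<open>d n\<close> tends to 0 so does \<open>\<kappa> n\<close>.\<close>
  let ?g = "\<lambda>n r. norm (f r) * \<tau> (- (d n * r))"
  define \<kappa> where "\<kappa> n = (LINT r|lborel. ?g n r)" for n
  have \<kappa>int: "integrable lborel (\<lambda>r. ?g n r)" for n
  proof (rule Bochner_Integration.integrable_bound)
    show "integrable lborel ?w"
      using f by (intro integrable_mult_left) auto
    show "AE r in lborel. norm (?g n r) \<le> norm (?w r)"
      using \<tau>0 \<tau>le N0 by (intro AE_I2) (auto simp: abs_mult intro!: mult_left_mono order_trans[OF _ abs_ge_self])
  qed measurable
  have "\<kappa> \<longlonglongrightarrow> (LINT r::real|lborel. 0)"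
    unfolding \<kappa>_def
  proof (rule integral_dominated_convergence[where w = ?w])
    show "AE r in lborel. (\<lambda>n. ?g n r) \<longlonglongrightarrow> 0"
    proof (rule AE_I2)
      fix r
      have "(\<lambda>n. - (d n * r)) \<longlonglongrightarrow> - (0 * r)" by (intro tendsto_intros d0)
      then have "(\<lambda>n. \<tau> (- (d n * r))) \<longlonglongrightarrow> 0"
        unfolding \<tau>_def by (intro translation_continuous_L1 kern_isCont C2c_bump kn) auto
      then have "(\<lambda>n. ?g n r) \<longlonglongrightarrow> norm (f r) * 0" by (intro tendsto_intros)
      then show "(\<lambda>n. ?g n r) \<longlonglongrightarrow> 0" by simp
    qed
    show "AE r in lborel. norm (?g n r) \<le> ?w r" for n
      using \<tau>0 \<tau>le N0 by (intro AE_I2) (auto simp: abs_mult intro!: mult_left_mono)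
    show "integrable lborel ?w"
      using f by (intro integrable_mult_left) auto
  qed auto
  then have "\<forall>\<^sub>F n in sequentially. \<kappa> n < norm c / 2"
    by (intro order_tendstoD(2)) (use fw in \<open>auto simp: c_def\<close>)
  then obtain n where n: "\<kappa> n < norm c / 2" by (auto simp: eventually_sequentially)
  define v where "v = approx_unit (d n) w"
  have v: "integrable lborel v" unfolding v_def by (rule approx_unit_integrable[OF d])
  note [measurable] = borel_measurable_integrable[OF v]
  \<comment> \<open>Integrated against \<open>f r\<close> over \<open>r\<close>, this gives
    \<open>c * v s\<close> minus the convolution of \<open>f\<close> and \<open>v\<close> at
    \<open>s\<close>, because \<open>c\<close> is the transform of \<open>f\<close> at
    \<open>w\<close>.\<close>
  let ?k = "\<lambda>r s. cis (- (w * r)) * v s - v (s - r)"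
  have v\<tau>: "(LINT s|lborel. norm (?k r s)) = \<tau> (- (d n * r))" for r
  proof -
    have "?k r s
        = of_real (d n) * cis (w * (s - r)) * (kern bump (d n * s) - kern bump (d n * s - d n * r))" for s
    proof -
      have "cis (- (w * r)) * cis (w * s) = cis (w * (s - r))" by (simp add: cis_mult algebra_simps)
      then have "cis (- (w * r)) * v s = of_real (d n) * kern bump (d n * s) * cis (w * (s - r))"
        unfolding v_def approx_unit_def by (metis mult.left_commute)
      then show ?thesis unfolding v_def approx_unit_def by (simp add: algebra_simps)
    qed
    then have "norm (?k r s) = d n * norm (kern bump (d n * s - d n * r) - kern bump (d n * s))" for s
      using d[of n] by (simp add: norm_mult norm_minus_commute)
    then have "(LINT s|lborel. norm (?k r s))
        = d n * (LINT s|lborel. norm (kern bump ((0 + d n * s) + - (d n * r)) - kern bump (0 + d n * s)))" by simp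
    also have "\<dots> = \<tau> (- (d n * r))"
      unfolding \<tau>_def using d[of n]
      by (subst lborel_integral_real_affine[of "d n" "\<lambda>x. norm (kern bump (x + - (d n * r)) - kern bump x)" 0]) simp_all
    finally show ?thesis .
  qed
  have "(LINT s|lborel. kern \<eta> s * p (t - s)) = 0"
    if \<eta>: "C2c \<eta>" and supp: "\<forall>t. d n < \<bar>t - w\<bar> \<longrightarrow> \<eta> t = 0" for \<eta> t
  proof -
    note g = kern_integrable[OF \<eta>]
    note [measurable] = borel_measurable_integrable[OF g]
    define q where "q t = (LINT s|lborel. kern \<eta> s * p (t - s))" for t
    have qm[measurable]: "q \<in> borel_measurable borel" unfolding q_def by measurable
    have qB: "norm (q t) \<le> (LINT s|lborel. norm (kern \<eta> s)) * B" for t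
    proof -
      have "norm (q t) \<le> (LINT s|lborel. norm (kern \<eta> s * p (t - s)))" unfolding q_def by (rule integral_norm_bound)
      also have "\<dots> \<le> (LINT s|lborel. norm (kern \<eta> s) * B)"
      proof (rule integral_mono)
        show "integrable lborel (\<lambda>s. norm (kern \<eta> s * p (t - s)))"
          using integrable_mult_bounded[OF g, of "\<lambda>s. p (t - s)" B] B by simp
        show "integrable lborel (\<lambda>s. norm (kern \<eta> s) * B)" using g by simp
      qed (simp add: norm_mult mult_left_mono B)
      finally show ?thesis by simp
    qed
    \<comment> \<open>Convolution with \<open>v\<close> reproduces \<open>q\<close> because the
      transform of \<open>v\<close> is 1 on the support of \<eta>; convolution with \<open>f\<close>
      kills \<open>q\<close> because it kills \<open>p\<close>.\<close>
    have qv: "(LINT s|lborel. v s * q (t - s)) = q t" for t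
      unfolding q_def convolution_assoc_scalar[OF v g p B]
      unfolding v_def kern_approx_unit[OF \<eta> d supp] ..
    have qf: "(LINT r|lborel. f r * q (t - r)) = 0" for t
      unfolding q_def convolution_commute_scalar[OF f g p B] by (simp add: pf)
    \<comment> \<open>Combines \<open>qv\<close> and \<open>qf\<close>: the part with
      \<open>v s\<close> returns \<open>c * q t\<close>, the part with the translate of
      \<open>v\<close> returns the convolution of \<open>f\<close> and \<open>q\<close>, which is 0.
      Keeping \<open>f\<close> outside avoids handling the convolution of \<open>f\<close> and
      \<open>v\<close> as a function.\<close>
    have cq: "c * q t = (LINT r|lborel. f r * (LINT s|lborel. ?k r s * q (t - s)))" for t
    proof -
      have inner: "(LINT s|lborel. ?k r s * q (t - s)) = cis (- (w * r)) * q t - q (t - r)" for r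
      proof -
        have i1: "integrable lborel (\<lambda>s. v s * q (t - s))"
          by (rule integrable_mult_bounded[OF v _ qB]) measurable
        have i2: "integrable lborel (\<lambda>s. v (s - r) * q (t - s))"
          using integrable_mult_bounded[OF integrable_real_shift[OF v, of "- r"] _ qB, of "\<lambda>s. t - s"] by simp
        have "(LINT s|lborel. v (s - r) * q (t - s)) = (LINT s|lborel. v s * q ((t - r) - s))"
          using integral_real_shift[of "\<lambda>s. v s * q ((t - r) - s)" "- r"] by simp
        also have "\<dots> = q (t - r)" by (rule qv)
        finally have e2: "(LINT s|lborel. v (s - r) * q (t - s)) = q (t - r)" .
        have "(LINT s|lborel. ?k r s * q (t - s))
            = (LINT s|lborel. cis (- (w * r)) * (v s * q (t - s)) - v (s - r) * q (t - s))"
          by (simp add: algebra_simps)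
        also have "\<dots> = cis (- (w * r)) * (LINT s|lborel. v s * q (t - s)) - (LINT s|lborel. v (s - r) * q (t - s))"
          using i1 i2 by simp
        finally show ?thesis unfolding qv e2 .
      qed
      have j1: "integrable lborel (\<lambda>r. f r * cis (- (w * r)))"
        by (rule integrable_mult_bounded[OF f, where B = 1]) auto
      have j2: "integrable lborel (\<lambda>r. f r * q (t - r))"
        by (rule integrable_mult_bounded[OF f _ qB]) measurable
      have "(LINT r|lborel. f r * (cis (- (w * r)) * q t - q (t - r)))
          = (LINT r|lborel. (f r * cis (- (w * r))) * q t - f r * q (t - r))"
        by (simp add: algebra_simps)
      also have "\<dots> = (LINT r|lborel. f r * cis (- (w * r))) * q t - (LINT r|lborel. f r * q (t - r))"
        using j1 j2 by simp
      finally show ?thesis unfolding inner qf by (simp add: c_def fourier_cis)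
    qed
    \<comment> \<open>Since \<open>\<kappa> n < norm c / 2\<close>, one use of \<open>cq\<close>
      halves any uniform bound of \<open>q\<close>; repetition drives it to 0.\<close>
    have step: "norm (q t) \<le> P / 2" if P: "\<And>t. norm (q t) \<le> P" for P t
    proof -
      have P0: "0 \<le> P" using order_trans[OF norm_ge_zero P] .
      have "norm c * norm (q t) = norm (c * q t)" by (simp add: norm_mult)
      also have "\<dots> \<le> (LINT r|lborel. ?g n r * P)"
        unfolding cq
      proof (rule order_trans[OF integral_norm_bound], rule integral_mono')
        show "integrable lborel (\<lambda>r. ?g n r * P)" using \<kappa>int by simp
        show "0 \<le> ?g n r * P" for r using \<tau>0 P0 by simp
        fix r
        have "norm (LINT s|lborel. ?k r s * q (t - s))
            \<le> (LINT s|lborel. norm (?k r s * q (t - s)))"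
          by (rule integral_norm_bound)
        also have "\<dots> \<le> (LINT s|lborel. norm (?k r s) * P)"
        proof (rule integral_mono')
          show "integrable lborel (\<lambda>s. norm (?k r s) * P)"
            using v integrable_real_shift[OF v, of "- r"] by (intro integrable_mult_left) auto
        qed (auto simp: norm_mult P P0 intro!: mult_left_mono)
        also have "\<dots> = \<tau> (- (d n * r)) * P" by (simp add: v\<tau>)
        finally show "norm (f r * (LINT s|lborel. ?k r s * q (t - s)))
            \<le> ?g n r * P"
          by (simp add: norm_mult mult.assoc mult_left_mono)
      qed
      also have "\<dots> = \<kappa> n * P" by (simp add: \<kappa>_def)
      also have "\<dots> \<le> norm c / 2 * P" using n P0 by (intro mult_right_mono) auto
      finally have "norm c * norm (q t) \<le> norm c * (P / 2)" by simp
      then show ?thesis using fw by (simp add: c_def)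
    qed
    have "norm (q t) \<le> ((LINT s|lborel. norm (kern \<eta> s)) * B) / 2 ^ k" for k t
    proof (induction k arbitrary: t)
      case (Suc k)
      show ?case using step[of "((LINT s|lborel. norm (kern \<eta> s)) * B) / 2 ^ k", OF Suc, of t] by (simp add: mult.commute)
    qed (use qB in auto)
    then have "norm (q t) \<le> 0" for t
    proof (intro LIMSEQ_le_const[of "\<lambda>k. ((LINT s|lborel. norm (kern \<eta> s)) * B) / 2 ^ k"])
      show "(\<lambda>k. ((LINT s|lborel. norm (kern \<eta> s)) * B) / 2 ^ k) \<longlonglongrightarrow> 0"
        by (rule LIMSEQ_divide_realpow_zero) auto
    qed auto
    then show ?thesis by (simp add: q_def)
  qed
  then show ?thesis using that d by blast
qed

lemma kern_add:
  assumes "C2c f" "C2c g" "C2c (\<lambda>t. f t + g t)"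
  shows "kern (\<lambda>t. f t + g t) s = kern f s + kern g s"
proof -
  have "integrable lborel (\<lambda>t. cis (s * t) * complex_of_real (f t))" if "C2c f" for f
  proof -
    have "integrable lborel (\<lambda>t. complex_of_real (f t) * cis (s * t))"
      by (rule integrable_mult_bounded[where B = 1]) (use C2c_integrable[OF that] in auto)
    then show ?thesis by (simp add: mult.commute)
  qed
  then show ?thesis using assms by (simp add: kern_eq distrib_left add_divide_distrib)
qed

text \<open>From local to global: \<open>local_annihilation\<close> gives a radius
  \<open>d w\<close> at each point of \<open>K\<close>, and finitely many balls of radius
  \<open>d w / 2\<close> cover \<open>K\<close>. Induction over these balls splits off from \<eta> a
  part supported near one centre and leaves a remainder covered by the other balls.\<close>

lemma spectral_annihilation:
  fixes p :: "real \<Rightarrow> complex"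
  assumes p[measurable]: "p \<in> borel_measurable borel" and B: "\<And>s. norm (p s) \<le> B"
    and K: "compact K"
    and f: "\<And>w. w \<in> K \<Longrightarrow> \<exists>f. integrable lborel f \<and> (\<forall>t. (LINT s|lborel. f s * p (t - s)) = 0) \<and> fourier f w \<noteq> 0"
    and \<eta>: "C2c \<eta>" and supp: "\<And>t. \<eta> t \<noteq> 0 \<Longrightarrow> t \<in> K"
  shows "(LINT s|lborel. kern \<eta> s * p (t - s)) = 0"
proof -
  have "\<exists>d>0. \<forall>\<eta>. C2c \<eta> \<longrightarrow> (\<forall>t. d < \<bar>t - w\<bar> \<longrightarrow> \<eta> t = 0) \<longrightarrow> (\<forall>t. (LINT s|lborel. kern \<eta> s * p (t - s)) = 0)"
    if "w \<in> K" for w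
  proof -
    obtain f where f': "integrable lborel f" "\<And>t. (LINT s|lborel. f s * p (t - s)) = 0" "fourier f w \<noteq> 0"
      using f[OF \<open>w \<in> K\<close>] by blast
    show ?thesis by (rule local_annihilation[OF p B f']) blast
  qed
  then obtain d where d: "\<And>w. w \<in> K \<Longrightarrow> d w > 0"
    and ann: "\<And>w \<eta> t. w \<in> K \<Longrightarrow> C2c \<eta> \<Longrightarrow> \<forall>t. d w < \<bar>t - w\<bar> \<longrightarrow> \<eta> t = 0 \<Longrightarrow> (LINT s|lborel. kern \<eta> s * p (t - s)) = 0"
    by metis
  have fin: "(LINT s|lborel. kern \<eta> s * p (t - s)) = 0"
    if "finite J" "J \<subseteq> K" "C2c \<eta>" "\<forall>t. \<eta> t \<noteq> 0 \<longrightarrow> (\<exists>w\<in>J. \<bar>t - w\<bar> < d w / 2)" for J \<eta> t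
    using that
  proof (induction J arbitrary: \<eta> t rule: finite_induct)
    case empty
    then have "\<eta> = (\<lambda>t. 0)" by auto
    then show ?case using empty.prems(2) by (simp add: kern_eq)
  next
    case (insert w J)
    have w: "w \<in> K" "d w > 0" using insert.prems d by auto
    \<comment> \<open>With scale \<open>d w / 2\<close>, \<beta> is 1 on the ball of the cover, so
      the remainder vanishes there, and it is 0 beyond \<open>d w\<close>, so \<open>ann\<close>
      applies to the part that is split off.\<close>
    define \<beta> where "\<beta> t = bump ((t - w) / (d w / 2))" for t
    have \<beta>: "C2 \<beta>" unfolding \<beta>_def by (rule C2_affine[OF C2_bump])
    have c1: "C2c (\<lambda>t. \<eta> t * \<beta> t)" by (rule C2c_mult[OF insert.prems(2) \<beta>])
    have c2: "C2c (\<lambda>t. \<eta> t * (1 - \<beta> t))" by (rule C2c_mult[OF insert.prems(2) C2_diff[OF C2_const \<beta>]])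
    have "(LINT s|lborel. kern (\<lambda>t. \<eta> t * \<beta> t) s * p (t - s)) = 0"
    proof (rule ann[OF w(1) c1], intro allI impI)
      fix t assume t: "d w < \<bar>t - w\<bar>"
      have "2 \<le> \<bar>t - w\<bar> / (d w / 2)" using t w(2) by (simp add: field_simps)
      then have "2 \<le> \<bar>(t - w) / (d w / 2)\<bar>" using w(2) by (simp only: abs_divide)
      then show "\<eta> t * \<beta> t = 0" by (simp add: \<beta>_def bump_eq_0)
    qed
    moreover have "(LINT s|lborel. kern (\<lambda>t. \<eta> t * (1 - \<beta> t)) s * p (t - s)) = 0"
    proof (rule insert.IH[OF _ c2])
      show "\<forall>t. \<eta> t * (1 - \<beta> t) \<noteq> 0 \<longrightarrow> (\<exists>w\<in>J. \<bar>t - w\<bar> < d w / 2)"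
      proof (intro allI impI)
        fix t assume t: "\<eta> t * (1 - \<beta> t) \<noteq> 0"
        have "\<not> \<bar>t - w\<bar> < d w / 2"
        proof
          assume "\<bar>t - w\<bar> < d w / 2"
          then have "\<bar>t - w\<bar> / \<bar>d w / 2\<bar> \<le> 1" using w(2) by (simp add: field_simps)
          then have "\<bar>(t - w) / (d w / 2)\<bar> \<le> 1" by (simp only: abs_divide)
          then show False using t bump_eq_1 by (simp add: \<beta>_def)
        qed
        then show "\<exists>w\<in>J. \<bar>t - w\<bar> < d w / 2" using t insert.prems(3) by auto
      qed
    qed (use insert.prems in auto)
    moreover have "(\<lambda>t. \<eta> t * \<beta> t + \<eta> t * (1 - \<beta> t)) = \<eta>" by (auto simp: algebra_simps)
    then have "kern \<eta> s = kern (\<lambda>t. \<eta> t * \<beta> t) s + kern (\<lambda>t. \<eta> t * (1 - \<beta> t)) s" for s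
      using kern_add[OF c1 c2] insert.prems(2) by metis
    moreover have "integrable lborel (\<lambda>s. kern (\<lambda>t. \<eta> t * \<beta> t) s * p (t - s))"
      "integrable lborel (\<lambda>s. kern (\<lambda>t. \<eta> t * (1 - \<beta> t)) s * p (t - s))"
      using integrable_mult_bounded[OF kern_integrable[OF c1], of "\<lambda>s. p (t - s)" B]
        integrable_mult_bounded[OF kern_integrable[OF c2], of "\<lambda>s. p (t - s)" B] B by simp_all
    ultimately show ?case by (simp add: distrib_right)
  qed
  have "K \<subseteq> \<Union> ((\<lambda>w. ball w (d w / 2)) ` K)" using d by force
  then obtain J where J: "J \<subseteq> K" "finite J" "K \<subseteq> \<Union> ((\<lambda>w. ball w (d w / 2)) ` J)"
    using compactE_image[OF K, of K "\<lambda>w. ball w (d w / 2)"] by auto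
  show ?thesis
  proof (rule fin[OF J(2,1) \<eta>], intro allI impI)
    fix t assume "\<eta> t \<noteq> 0"
    then obtain w where "w \<in> J" "t \<in> ball w (d w / 2)" using supp J(3) by blast
    then show "\<exists>w\<in>J. \<bar>t - w\<bar> < d w / 2" by (auto simp: dist_real_def abs_minus_commute)
  qed
qed

section \<open>Resolvents along the imaginary axis\<close>

text \<open>Caratheodory's form of differentiability: the resolvent identity delivers exactly such a
  factorisation of the difference.\<close>

lemma has_vector_derivative_caratheodory:
  fixes f :: "real \<Rightarrow> 'b::real_normed_vector"
  assumes eq: "\<forall>\<^sub>F t in at s. f t - f s = (t - s) *\<^sub>R g t" and g: "(g \<longlongrightarrow> d) (at s)"
  shows "(f has_vector_derivative d) (at s)"
  unfolding has_vector_derivative_def has_derivative_within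
proof
  show "bounded_linear (\<lambda>x. x *\<^sub>R d)" by (rule bounded_linear_scaleR_left)
  have "((\<lambda>t. norm (g t - d)) \<longlongrightarrow> 0) (at s)" using tendsto_norm_zero[OF LIM_zero[OF g]] .
  moreover have "\<forall>\<^sub>F t in at s. norm ((1 / norm (t - s)) *\<^sub>R (f t - (f s + (t - s) *\<^sub>R d))) \<le> norm (g t - d)"
    using eq eventually_neq_at_within[of s s UNIV]
  proof eventually_elim
    case (elim t)
    have "f t - (f s + (t - s) *\<^sub>R d) = (t - s) *\<^sub>R (g t - d)" using elim(1) by (simp add: algebra_simps)
    then show ?case using elim(2) by simp
  qed
  ultimately show "((\<lambda>y. (1 / norm (y - s)) *\<^sub>R (f y - (f s + (y - s) *\<^sub>R d))) \<longlongrightarrow> 0) (at s)"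
    by (rule Lim_null_comparison[rotated])
qed

locale complex_linear_operator =
  fixes D :: "'a::complex_banach set" and A :: "'a \<Rightarrow> 'a"
  assumes zero_mem: "0 \<in> D"
    and add_mem: "x \<in> D \<Longrightarrow> y \<in> D \<Longrightarrow> x + y \<in> D"
    and add: "x \<in> D \<Longrightarrow> y \<in> D \<Longrightarrow> A (x + y) = A x + A y"
    and scale_mem: "x \<in> D \<Longrightarrow> c *\<^sub>C x \<in> D"
    and scale: "x \<in> D \<Longrightarrow> A (c *\<^sub>C x) = c *\<^sub>C A x"
begin

text \<open>Turns the resolvent into an element of the operator space, so that norms and composition
  are at hand. It is meaningful only for \<open>z\<close> outside the spectrum; elsewhere
  \<open>Blinfun\<close> may be applied to a function that is not bounded linear.\<close>

definition Rz :: "complex \<Rightarrow> 'a \<Rightarrow>\<^sub>L 'a" where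
  "Rz z = Blinfun (resolvent D A z)"

lemma A_zero: "A 0 = 0"
  using scale[OF zero_mem, of 0] by (simp add: scaleC.zero_left)

lemma Rz_apply: "z \<notin> spectrum D A \<Longrightarrow> blinfun_apply (Rz z) = resolvent D A z"
  unfolding Rz_def by (rule bounded_linear_Blinfun_apply) (simp add: spectrum_def)

lemma norm_Rz: "z \<notin> spectrum D A \<Longrightarrow> norm (Rz z) = onorm (resolvent D A z)"
  by (simp add: norm_blinfun.rep_eq Rz_apply)

lemma Rz_right:
  assumes "z \<notin> spectrum D A"
  shows "Rz z y \<in> D" "z *\<^sub>C Rz z y - A (Rz z y) = y"
proof -
  have b: "bij_betw (\<lambda>x. z *\<^sub>C x - A x) D UNIV" using assms by (simp add: spectrum_def)
  then have y: "y \<in> (\<lambda>x. z *\<^sub>C x - A x) ` D" by (simp add: bij_betw_def)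
  show "Rz z y \<in> D" unfolding Rz_apply[OF assms] resolvent_def by (rule inv_into_into[OF y])
  show "z *\<^sub>C Rz z y - A (Rz z y) = y" unfolding Rz_apply[OF assms] resolvent_def
    using f_inv_into_f[OF y] .
qed

lemma Rz_unique:
  assumes "z \<notin> spectrum D A" "x \<in> D" "z *\<^sub>C x - A x = y"
  shows "Rz z y = x"
proof -
  have b: "inj_on (\<lambda>x. z *\<^sub>C x - A x) D" using assms by (simp add: spectrum_def bij_betw_def)
  show ?thesis unfolding Rz_apply[OF assms(1)] resolvent_def using inv_into_f_f[OF b assms(2)] assms(3) by simp
qed

lemma Rz_complex_linear:
  assumes "z \<notin> spectrum D A"
  shows "Rz z (c *\<^sub>C y) = c *\<^sub>C Rz z y"
proof (rule Rz_unique[OF assms])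
  show "z *\<^sub>C c *\<^sub>C Rz z y - A (c *\<^sub>C Rz z y) = c *\<^sub>C y"
    using Rz_right[OF assms, of y] by (metis mult.commute scale scaleC.diff_right scaleC_scaleC)
qed (rule scale_mem[OF Rz_right(1)[OF assms]])

lemma resolvent_identity:
  assumes "z \<notin> spectrum D A" "w \<notin> spectrum D A"
  shows "Rz z - Rz w = (w - z) *\<^sub>C (Rz z o\<^sub>L Rz w)"
proof (rule blinfun_eqI)
  fix y
  let ?x = "Rz w y"
  have "z *\<^sub>C ?x - A ?x = y + (z - w) *\<^sub>C ?x"
    using Rz_right(2)[OF assms(2), of y] by (simp add: scaleC.diff_left algebra_simps)
  then have "?x = Rz z (y + (z - w) *\<^sub>C ?x)"
    by (rule Rz_unique[OF assms(1) Rz_right(1)[OF assms(2)], symmetric])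
  also have "\<dots> = Rz z y + (z - w) *\<^sub>C Rz z ?x"
    by (simp add: blinfun.add_right Rz_complex_linear[OF assms(1)])
  finally have "?x - Rz z y = (Rz z y + (z - w) *\<^sub>C Rz z ?x) - Rz z y" by (rule arg_cong)
  then have "?x - Rz z y = (z - w) *\<^sub>C Rz z ?x" by (simp only: add_diff_cancel_left')
  then have "Rz z y - ?x = - ((z - w) *\<^sub>C Rz z ?x)" by (metis minus_diff_eq)
  then show "(Rz z - Rz w) y = ((w - z) *\<^sub>C (Rz z o\<^sub>L Rz w)) y"
    by (simp add: blinfun.diff_left scaleC_blinfun_apply scaleC.minus_left[symmetric])
qed

text \<open>The equation \<open>z *\<^sub>C x - A x = y\<close> with \<open>x\<close> in
  \<open>D\<close> is equivalent to the fixed point equation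
  \<open>x = Rz z0 (y - (z - z0) *\<^sub>C x)\<close>, whose right side is a contraction with
  constant \<open>q\<close>. Existence and uniqueness come at once from Banach's theorem, and the
  same equation bounds the inverse by \<open>norm (Rz z0) / (1 - q)\<close>.\<close>

lemma not_spectrum_near:
  assumes z0: "z0 \<notin> spectrum D A" and q: "cmod (z - z0) * norm (Rz z0) < 1"
  shows "z \<notin> spectrum D A"
proof -
  define q where "q = cmod (z - z0) * norm (Rz z0)"
  have q01: "0 \<le> q" "q < 1" using q by (auto simp: q_def)
  have iff: "x \<in> D \<and> z *\<^sub>C x - A x = y \<longleftrightarrow> Rz z0 (y - (z - z0) *\<^sub>C x) = x" for x y
  proof
    assume "x \<in> D \<and> z *\<^sub>C x - A x = y"
    then show "Rz z0 (y - (z - z0) *\<^sub>C x) = x"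
      by (intro Rz_unique[OF z0]) (auto simp: scaleC.diff_left)
  next
    assume *: "Rz z0 (y - (z - z0) *\<^sub>C x) = x"
    have "z0 *\<^sub>C x - A x = y - (z - z0) *\<^sub>C x" "x \<in> D"
      using Rz_right[OF z0, of "y - (z - z0) *\<^sub>C x"] * by auto
    then show "x \<in> D \<and> z *\<^sub>C x - A x = y" by (simp add: scaleC.diff_left algebra_simps)
  qed
  have ex1: "\<exists>!x. Rz z0 (y - (z - z0) *\<^sub>C x) = x" for y
  proof (rule banach_fix_type[OF q01], intro allI)
    fix x x'
    have "Rz z0 (y - (z - z0) *\<^sub>C x) - Rz z0 (y - (z - z0) *\<^sub>C x') = Rz z0 ((z - z0) *\<^sub>C (x' - x))"
      unfolding blinfun.diff_right[symmetric] by (simp add: scaleC.diff_right)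
    moreover have "norm (Rz z0 ((z - z0) *\<^sub>C (x' - x))) \<le> norm (Rz z0) * (cmod (z - z0) * norm (x' - x))"
      using norm_blinfun[of "Rz z0" "(z - z0) *\<^sub>C (x' - x)"] by (simp add: norm_scaleC)
    ultimately show "dist (Rz z0 (y - (z - z0) *\<^sub>C x)) (Rz z0 (y - (z - z0) *\<^sub>C x')) \<le> q * dist x x'"
      by (simp add: dist_norm q_def norm_minus_commute mult_ac)
  qed
  have bij: "bij_betw (\<lambda>x. z *\<^sub>C x - A x) D UNIV"
  proof (rule bij_betwI')
    fix x x' assume x: "x \<in> D" "x' \<in> D"
    show "(z *\<^sub>C x - A x = z *\<^sub>C x' - A x') = (x = x')"
    proof
      assume eq: "z *\<^sub>C x - A x = z *\<^sub>C x' - A x'"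
      have "Rz z0 ((z *\<^sub>C x - A x) - (z - z0) *\<^sub>C x) = x" "Rz z0 ((z *\<^sub>C x - A x) - (z - z0) *\<^sub>C x') = x'"
        using x eq[symmetric] iff[of x "z *\<^sub>C x - A x"] iff[of x' "z *\<^sub>C x - A x"] by blast+
      then show "x = x'" using ex1[of "z *\<^sub>C x - A x"] by blast
    qed simp
  next
    fix y
    obtain x where "Rz z0 (y - (z - z0) *\<^sub>C x) = x" using ex1[of y] by blast
    then show "\<exists>x\<in>D. y = z *\<^sub>C x - A x" using iff[of x y] by blast
  qed auto
  let ?R = "resolvent D A z"
  have R: "?R y \<in> D" "z *\<^sub>C ?R y - A (?R y) = y" for y
  proof -
    have y: "y \<in> (\<lambda>x. z *\<^sub>C x - A x) ` D" using bij by (simp add: bij_betw_def)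
    show "?R y \<in> D" unfolding resolvent_def by (rule inv_into_into[OF y])
    show "z *\<^sub>C ?R y - A (?R y) = y" unfolding resolvent_def using f_inv_into_f[OF y] .
  qed
  have uniq: "?R y = x" if "x \<in> D" "z *\<^sub>C x - A x = y" for x y
    using that R[of y] iff[of x y] iff[of "?R y" y] ex1[of y] by blast
  have "bounded_linear ?R"
  proof (rule bounded_linear_intro[where K = "norm (Rz z0) / (1 - q)"])
    fix x y :: 'a and r :: real
    show "?R (x + y) = ?R x + ?R y"
      by (rule uniq) (use R[of x] R[of y] add add_mem in \<open>auto simp: scaleC_add_right\<close>, simp add: algebra_simps)
    show "?R (r *\<^sub>R x) = r *\<^sub>R ?R x"
      unfolding scaleC_of_real[symmetric]
      by (rule uniq) (use R[of x] scale scale_mem in \<open>auto simp: scaleC.diff_right[symmetric] mult.commute scaleC_scaleC\<close>,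
        metis R(2) mult.commute scaleC.diff_right scaleC_scaleC)
    have "?R x = Rz z0 (x - (z - z0) *\<^sub>C ?R x)" using iff[of "?R x" x] R[of x] by simp
    then have "norm (?R x) \<le> norm (Rz z0) * norm (x - (z - z0) *\<^sub>C ?R x)" by (metis norm_blinfun)
    also have "\<dots> \<le> norm (Rz z0) * (norm x + cmod (z - z0) * norm (?R x))"
      using norm_triangle_ineq4[of x "(z - z0) *\<^sub>C ?R x"] by (intro mult_left_mono) (auto simp: norm_scaleC)
    finally have "(1 - q) * norm (?R x) \<le> norm (Rz z0) * norm x" by (simp add: q_def algebra_simps)
    then show "norm (?R x) \<le> norm x * (norm (Rz z0) / (1 - q))" using q01 by (simp add: field_simps)
  qed
  then show ?thesis using bij by (simp add: spectrum_def)
qed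

definition Rt :: "real \<Rightarrow> 'a \<Rightarrow>\<^sub>L 'a" where "Rt t = Rz (\<i> * complex_of_real t)"

definition K :: "real set" where "K = {t. \<i> * complex_of_real t \<in> spectrum D A}"

lemma Rt_identity: "s \<notin> K \<Longrightarrow> t \<notin> K \<Longrightarrow> Rt t - Rt s = (\<i> * of_real (s - t)) *\<^sub>C (Rt t o\<^sub>L Rt s)"
  unfolding Rt_def K_def using resolvent_identity[of "\<i> * of_real t" "\<i> * of_real s"] by (simp add: right_diff_distrib)

lemma not_K_near:
  assumes "s \<notin> K" "\<bar>t - s\<bar> * norm (Rt s) < 1"
  shows "t \<notin> K"
proof -
  have "\<i> * complex_of_real t - \<i> * complex_of_real s = \<i> * of_real (t - s)" by (simp add: right_diff_distrib)
  then have "cmod (\<i> * complex_of_real t - \<i> * complex_of_real s) = \<bar>t - s\<bar>"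
    by (simp only: norm_mult norm_of_real) simp
  then show ?thesis using assms not_spectrum_near[of "\<i> * of_real s" "\<i> * of_real t"] by (simp add: K_def Rt_def)
qed

lemma closed_K: "closed K"
  unfolding closed_def open_dist
proof
  fix s assume s: "s \<in> - K"
  show "\<exists>e>0. \<forall>t. dist t s < e \<longrightarrow> t \<in> - K"
  proof (intro exI[of _ "1 / (norm (Rt s) + 1)"] conjI allI impI)
    show "0 < 1 / (norm (Rt s) + 1)" by (simp add: add_nonneg_pos)
    fix t assume "dist t s < 1 / (norm (Rt s) + 1)"
    then have "\<bar>t - s\<bar> * (norm (Rt s) + 1) < 1" by (simp add: dist_real_def pos_less_divide_eq add_nonneg_pos)
    then have "\<bar>t - s\<bar> * norm (Rt s) < 1" by (simp add: algebra_simps)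
    then show "t \<in> - K" using not_K_near s by simp
  qed
qed

lemma isCont_Rt:
  assumes s: "s \<notin> K"
  shows "isCont Rt s"
  unfolding isCont_def
proof -
  define N where "N = norm (Rt s)"
  have ev: "\<forall>\<^sub>F t in at s. \<bar>t - s\<bar> * N < 1/2"
  proof -
    have "((\<lambda>t. \<bar>t - s\<bar> * N) \<longlongrightarrow> \<bar>s - s\<bar> * N) (at s)" by (intro tendsto_intros)
    then show ?thesis by (intro order_tendstoD(2)[of _ "0"]) auto
  qed
  \<comment> \<open>Absorption: the resolvent identity bounds the difference by
    \<open>\<bar>t - s\<bar> * N * norm (Rt t)\<close>. For factor below 1/2 the unknown
    \<open>norm (Rt t)\<close> is moved to the left, which gives
    \<open>norm (Rt t) \<le> 2 * N\<close>.\<close>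
  have le: "norm (Rt t - Rt s) \<le> \<bar>t - s\<bar> * (2 * N * N)" if t: "\<bar>t - s\<bar> * N < 1/2" for t
  proof -
    have tK: "t \<notin> K" using not_K_near[OF s] t by (simp add: N_def)
    have *: "norm (Rt t - Rt s) \<le> \<bar>t - s\<bar> * (norm (Rt t) * N)"
    proof -
      have "norm (Rt t - Rt s) = \<bar>s - t\<bar> * norm (Rt t o\<^sub>L Rt s)"
        unfolding Rt_identity[OF s tK] norm_scaleC by (simp only: norm_mult norm_of_real norm_ii mult_1_left)
      also have "\<dots> \<le> \<bar>s - t\<bar> * (norm (Rt t) * N)"
        unfolding N_def by (intro mult_left_mono norm_blinfun_compose) auto
      finally show ?thesis by (simp add: abs_minus_commute)
    qed
    have "norm (Rt t) \<le> norm (Rt t - Rt s) + N" unfolding N_def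
      by (metis add.commute norm_triangle_sub)
    also have "\<dots> \<le> (\<bar>t - s\<bar> * N) * norm (Rt t) + N" using * by (simp add: mult_ac)
    also have "\<dots> \<le> 1/2 * norm (Rt t) + N" using t by (intro add_right_mono mult_right_mono) auto
    finally have "norm (Rt t) \<le> 2 * N" by simp
    then have "\<bar>t - s\<bar> * (norm (Rt t) * N) \<le> \<bar>t - s\<bar> * (2 * N * N)"
      by (intro mult_left_mono mult_right_mono) (auto simp: N_def)
    then show ?thesis using * by linarith
  qed
  have "((\<lambda>t. \<bar>t - s\<bar> * (2 * N * N)) \<longlongrightarrow> \<bar>s - s\<bar> * (2 * N * N)) (at s)" by (intro tendsto_intros)
  then have "((\<lambda>t. \<bar>t - s\<bar> * (2 * N * N)) \<longlongrightarrow> 0) (at s)" by simp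
  then have "((\<lambda>t. Rt t - Rt s) \<longlongrightarrow> 0) (at s)"
    by (rule Lim_null_comparison[rotated]) (use ev le in \<open>auto elim: eventually_mono\<close>)
  then show "(Rt \<longlongrightarrow> Rt s) (at s)" by (rule LIM_zero_cancel)
qed

lemma Rt_derivative:
  assumes s: "s \<notin> K"
  shows "(Rt has_vector_derivative (- \<i>) *\<^sub>C (Rt s o\<^sub>L Rt s)) (at s)"
proof (rule has_vector_derivative_caratheodory)
  have "\<forall>\<^sub>F t in at s. t \<in> - K"
    using closed_K s by (intro eventually_at_in_open'[THEN eventually_mono]) (auto simp: closed_def)
  then show "\<forall>\<^sub>F t in at s. Rt t - Rt s = (t - s) *\<^sub>R ((- \<i>) *\<^sub>C (Rt t o\<^sub>L Rt s))"
  proof eventually_elim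
    case (elim t)
    then show ?case
      by (simp add: Rt_identity[OF s] scaleC_of_real[symmetric] scaleC_scaleC algebra_simps del: scaleC_of_real)
  qed
  show "((\<lambda>t. (- \<i>) *\<^sub>C (Rt t o\<^sub>L Rt s)) \<longlongrightarrow> (- \<i>) *\<^sub>C (Rt s o\<^sub>L Rt s)) (at s)"
    using isCont_Rt[OF s] unfolding isCont_def by (intro tendsto_intros bounded_bilinear.tendsto[OF bounded_bilinear_blinfun_compose])
qed

end

section \<open>The resolvent with cutoff as an admissible symbol\<close>

locale resolvent_symbol = complex_linear_operator D A for D :: "'a::complex_banach set" and A +
  fixes a \<theta> Q :: real and \<eta> :: "real \<Rightarrow> real" and W :: "real set"
  assumes a_pos: "0 < a" and K_bound: "K \<subseteq> {-a<..<a}" and theta: "1 / 2 < \<theta>"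
    and Rt_bound: "\<And>t. a \<le> \<bar>t\<bar> \<Longrightarrow> \<bar>t\<bar> powr \<theta> * norm (Rt t) \<le> Q"
    and C2c_cutoff: "C2c \<eta>" and open_W: "open W" and K_W: "K \<subseteq> W"
    and cutoff_1: "\<And>t. t \<in> W \<Longrightarrow> \<eta> t = 1"
begin

text \<open>Chosen so that \<open>1/2 + \<epsilon>\<close> is at most \<theta>. Then the resolvent
  decays with exponent \<open>1/2 + \<epsilon>\<close>, its square with
  \<open>1 + 2 * \<epsilon>\<close>, and its cube with \<open>3/2 + 3 * \<epsilon>\<close>, which
  exceeds \<open>1 + \<epsilon>\<close>. The cap of \<theta> at 1 guarantees
  \<open>\<epsilon> \<le> 1\<close>, as \<open>fourier_symbol\<close> demands.\<close>

definition \<epsilon> :: real where "\<epsilon> = min \<theta> 1 - 1 / 2"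

text \<open>On \<open>K\<close>, where \<open>Rt\<close> carries no information, the value is fixed
  as 0. As \<open>1 - \<eta>\<close> vanishes on the open set \<open>W\<close> around
  \<open>K\<close>, the symbol is 0 on all of \<open>W\<close>.\<close>

definition h :: "real \<Rightarrow> 'a \<Rightarrow>\<^sub>L 'a" where
  "h t = (if t \<in> K then 0 else (1 - \<eta> t) *\<^sub>R Rt t)"

lemma eps: "0 < \<epsilon>" "\<epsilon> \<le> 1" "\<epsilon> \<le> 1 / 2"
  using theta by (auto simp: \<epsilon>_def)

text \<open>Gluing by zero across \<open>K\<close>. The second conclusion passes the vanishing on
  \<open>W\<close> to the derivative, so that the lemma can be applied to \<open>f'\<close> in
  turn.\<close>

lemma extension_derivative:
  fixes f f' :: "real \<Rightarrow> 'b::real_normed_vector"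
  assumes d: "\<And>t. t \<notin> K \<Longrightarrow> (f has_vector_derivative f' t) (at t)"
    and z: "\<And>t. t \<in> W \<Longrightarrow> t \<notin> K \<Longrightarrow> f t = 0"
  shows "((\<lambda>t. if t \<in> K then 0 else f t) has_vector_derivative (if t \<in> K then 0 else f' t)) (at t)"
    "\<And>t. t \<in> W \<Longrightarrow> t \<notin> K \<Longrightarrow> f' t = 0"
proof -
  show "f' t = 0" if "t \<in> W" "t \<notin> K" for t
    using vector_derivative_eq_0_outside[OF d[OF that(2)], of "W - K"] z that open_W closed_K by (auto intro: open_Diff)
  show "((\<lambda>t. if t \<in> K then 0 else f t) has_vector_derivative (if t \<in> K then 0 else f' t)) (at t)"
  proof (cases "t \<in> K")
    case True
    have "((\<lambda>t. 0 :: 'b) has_vector_derivative 0) (at t)" by simp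
    then have "((\<lambda>t. if t \<in> K then 0 else f t) has_vector_derivative 0) (at t)"
      by (rule has_vector_derivative_transform_within_open[OF _ open_W]) (use True K_W z in auto)
    then show ?thesis using True by simp
  next
    case False
    have "((\<lambda>t. if t \<in> K then 0 else f t) has_vector_derivative f' t) (at t)"
      by (rule has_vector_derivative_transform_within_open[OF d[OF False], of "- K"])
         (use False closed_K in \<open>auto simp: open_Compl\<close>)
    then show ?thesis using False by simp
  qed
qed

lemma extension_continuous:
  fixes f :: "real \<Rightarrow> 'b::real_normed_vector"
  assumes d: "\<And>t. t \<notin> K \<Longrightarrow> isCont f t" and z: "\<And>t. t \<in> W \<Longrightarrow> t \<notin> K \<Longrightarrow> f t = 0"
  shows "continuous_on UNIV (\<lambda>t. if t \<in> K then 0 else f t)"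
proof (rule continuous_at_imp_continuous_on, rule ballI)
  fix t
  show "isCont (\<lambda>t. if t \<in> K then 0 else f t) t"
  proof (cases "t \<in> K")
    case True
    have "\<forall>\<^sub>F x in nhds t. (if x \<in> K then 0 else f x) = (0 :: 'b)"
    proof (rule eventually_mono[OF eventually_nhds_in_open[OF open_W]])
      show "t \<in> W" using True K_W by blast
    qed (use z in auto)
    then show ?thesis using isCont_cong[of "\<lambda>t. if t \<in> K then 0 else f t" "\<lambda>t. 0" t] by simp
  next
    case False
    have "\<forall>\<^sub>F x in nhds t. (if x \<in> K then 0 else f x) = f x"
      using eventually_nhds_in_open[of "- K" t] False closed_K by (auto elim: eventually_mono simp: open_Compl)
    then show ?thesis using isCont_cong[of "\<lambda>t. if t \<in> K then 0 else f t" f t] d[OF False] by simp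
  qed
qed

lemma Rt_decay:
  obtains q where "0 \<le> q" "\<And>t. max a 1 < \<bar>t\<bar> \<Longrightarrow> norm (Rt t) \<le> q * (1 + \<bar>t\<bar>) powr (- (1/2 + \<epsilon>))"
proof
  show "0 \<le> 2 * \<bar>Q\<bar>" by simp
  fix t :: real assume t: "max a 1 < \<bar>t\<bar>"
  define r where "r = 1/2 + \<epsilon>"
  have r: "0 < r" "r \<le> \<theta>" "r \<le> 1" using eps by (auto simp: r_def \<epsilon>_def)
  have "\<bar>t\<bar> powr r * norm (Rt t) \<le> \<bar>t\<bar> powr \<theta> * norm (Rt t)"
    using t r by (intro mult_right_mono powr_mono) auto
  also have "\<dots> \<le> \<bar>Q\<bar>" using Rt_bound[of t] t by auto
  finally have 1: "\<bar>t\<bar> powr r * norm (Rt t) \<le> \<bar>Q\<bar>" .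
  have "(1 + \<bar>t\<bar>) powr r \<le> (2 * \<bar>t\<bar>) powr r" using t r by (intro powr_mono2) auto
  also have "\<dots> = 2 powr r * \<bar>t\<bar> powr r" by (simp add: powr_mult)
  also have "\<dots> \<le> 2 powr 1 * \<bar>t\<bar> powr r" using r by (intro mult_right_mono powr_mono) auto
  finally have "(1 + \<bar>t\<bar>) powr r * norm (Rt t) \<le> (2 * \<bar>t\<bar> powr r) * norm (Rt t)" by (intro mult_right_mono) auto
  also have "\<dots> \<le> 2 * \<bar>Q\<bar>" using 1 by simp
  finally have "norm (Rt t) * (1 + \<bar>t\<bar>) powr r \<le> 2 * \<bar>Q\<bar>" by (simp add: mult.commute)
  then show "norm (Rt t) \<le> 2 * \<bar>Q\<bar> * (1 + \<bar>t\<bar>) powr (- (1/2 + \<epsilon>))"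
    unfolding r_def[symmetric] powr_minus by (simp add: field_simps add_pos_nonneg)
qed

text \<open>By the resolvent identity the derivatives of \<open>Rt\<close> are \<open>- \<i>\<close>
  times its square and \<open>- 2\<close> times its cube. Beyond \<open>L\<close> the cutoff has
  disappeared and the three decay bounds are those of the first three powers of \<open>Rt\<close>;
  the compact middle part is handled by \<open>continuous_decay\<close>.\<close>

lemma fourier_symbol_h: "\<exists>h1 h2 C. fourier_symbol h h1 h2 \<epsilon> C"
proof -
  obtain M where M: "\<forall>t. \<bar>t\<bar> > M \<longrightarrow> \<eta> t = 0" and C2: "C2 \<eta>" using C2c_cutoff unfolding C2c_def by blast
  obtain \<eta>1 \<eta>2 where e: "\<And>t. (\<eta> has_field_derivative \<eta>1 t) (at t)"
    "\<And>t. (\<eta>1 has_field_derivative \<eta>2 t) (at t)" "continuous_on UNIV \<eta>2" using C2E[OF C2] by blast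
  have op: "open {t::real. \<bar>t\<bar> > M}" by (intro open_Collect_less continuous_intros)
  have z1: "\<forall>t. \<bar>t\<bar> > M \<longrightarrow> \<eta>1 t = 0"
    using vector_derivative_eq_0_outside[OF _ op, of \<eta>] e(1) M
    by (auto simp: has_real_derivative_iff_has_vector_derivative)
  have z2: "\<forall>t. \<bar>t\<bar> > M \<longrightarrow> \<eta>2 t = 0"
    using vector_derivative_eq_0_outside[OF _ op, of \<eta>1] e(2) z1
    by (auto simp: has_real_derivative_iff_has_vector_derivative)
  define R1 where "R1 t = (- \<i>) *\<^sub>C (Rt t o\<^sub>L Rt t)" for t
  define R2 where "R2 t = (- \<i>) *\<^sub>C ((Rt t o\<^sub>L R1 t) + (R1 t o\<^sub>L Rt t))" for t
  have dR: "(Rt has_vector_derivative R1 t) (at t)" if "t \<notin> K" for t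
    unfolding R1_def using Rt_derivative[OF that] .
  have dR1: "(R1 has_vector_derivative R2 t) (at t)" if "t \<notin> K" for t
    unfolding R1_def[abs_def] R2_def
    using bounded_linear.has_vector_derivative[OF scaleC.bounded_linear_right
        bounded_bilinear.has_vector_derivative[OF bounded_bilinear_blinfun_compose dR[OF that] dR[OF that]], of "- \<i>"]
    by (simp add: R1_def)
  define f0 where "f0 t = (1 - \<eta> t) *\<^sub>R Rt t" for t
  define f1 where "f1 t = (1 - \<eta> t) *\<^sub>R R1 t + (- \<eta>1 t) *\<^sub>R Rt t" for t
  define f2 where "f2 t = ((1 - \<eta> t) *\<^sub>R R2 t + (- \<eta>1 t) *\<^sub>R R1 t) + ((- \<eta>1 t) *\<^sub>R R1 t + (- \<eta>2 t) *\<^sub>R Rt t)" for t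
  have de: "((\<lambda>t. 1 - \<eta> t) has_field_derivative - \<eta>1 t) (at t)" "((\<lambda>t. - \<eta>1 t) has_field_derivative - \<eta>2 t) (at t)" for t
    using DERIV_diff[OF DERIV_const[of 1] e(1)] DERIV_minus[OF e(2)] by simp_all
  have d0: "(f0 has_vector_derivative f1 t) (at t)" if "t \<notin> K" for t
    unfolding f0_def[abs_def] f1_def by (rule has_vector_derivative_scaleR[OF de(1) dR[OF that]])
  have d1: "(f1 has_vector_derivative f2 t) (at t)" if "t \<notin> K" for t
    unfolding f1_def[abs_def] f2_def
    by (intro has_vector_derivative_add has_vector_derivative_scaleR[OF de(1) dR1[OF that]]
        has_vector_derivative_scaleR[OF de(2) dR[OF that]])
  have zero0: "f0 t = 0" if "t \<in> W" "t \<notin> K" for t using that cutoff_1 by (simp add: f0_def)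
  note E0 = extension_derivative[OF d0 zero0]
  note E1 = extension_derivative[OF d1 E0(2)]
  let ?h1 = "\<lambda>t. if t \<in> K then 0 else f1 t" and ?h2 = "\<lambda>t. if t \<in> K then 0 else f2 t"
  have hf: "h = (\<lambda>t. if t \<in> K then 0 else f0 t)" by (auto simp: h_def f0_def)
  have D0: "(h has_vector_derivative ?h1 t) (at t)" for t unfolding hf by (rule E0(1))
  have D1: "(?h1 has_vector_derivative ?h2 t) (at t)" for t by (rule E1(1))
  have c2: "continuous_on UNIV ?h2"
  proof (rule extension_continuous)
    fix t assume t: "t \<notin> K"
    have "isCont \<eta>2 t" using e(3) by (simp add: continuous_on_eq_continuous_at)
    moreover have "isCont R2 t"
      unfolding R2_def[abs_def]
      by (intro continuous_intros bounded_bilinear.continuous[OF bounded_bilinear_blinfun_compose] has_vector_derivative_continuous[OF dR[OF t]]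
          has_vector_derivative_continuous[OF dR1[OF t]])
    ultimately show "isCont f2 t"
      unfolding f2_def[abs_def]
      by (intro continuous_intros has_vector_derivative_continuous[OF dR[OF t]]
          has_vector_derivative_continuous[OF dR1[OF t]] DERIV_isCont[OF e(1)] DERIV_isCont[OF e(2)])
  qed (rule E1(2))
  obtain q where q: "0 \<le> q" "\<And>t. max a 1 < \<bar>t\<bar> \<Longrightarrow> norm (Rt t) \<le> q * (1 + \<bar>t\<bar>) powr (- (1/2 + \<epsilon>))"
    using Rt_decay by blast
  define L where "L = max M (max a 1)"
  have R1le: "norm (R1 t) \<le> norm (Rt t) * norm (Rt t)" for t
    unfolding R1_def norm_scaleC using norm_blinfun_compose by simp
  have R2le: "norm (R2 t) \<le> 2 * (norm (Rt t) * (norm (Rt t) * norm (Rt t)))" for t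
  proof -
    have "norm (R2 t) \<le> norm (Rt t o\<^sub>L R1 t) + norm (R1 t o\<^sub>L Rt t)"
      unfolding R2_def norm_scaleC using norm_triangle_ineq by simp
    also have "\<dots> \<le> norm (Rt t) * norm (R1 t) + norm (R1 t) * norm (Rt t)"
      by (intro add_mono norm_blinfun_compose)
    also have "\<dots> \<le> norm (Rt t) * (norm (Rt t) * norm (Rt t)) + (norm (Rt t) * norm (Rt t)) * norm (Rt t)"
      by (intro add_mono mult_left_mono mult_right_mono R1le) auto
    finally show ?thesis by simp
  qed
  have far: "t \<notin> K" "f0 t = Rt t" "f1 t = R1 t" "f2 t = R2 t" "norm (Rt t) \<le> q * (1 + \<bar>t\<bar>) powr (- (1/2 + \<epsilon>))"
    if t: "L < \<bar>t\<bar>" for t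
  proof -
    show "t \<notin> K" using K_bound t by (force simp: L_def)
    have "\<eta> t = 0" "\<eta>1 t = 0" "\<eta>2 t = 0" using M z1 z2 t by (auto simp: L_def)
    then show "f0 t = Rt t" "f1 t = R1 t" "f2 t = R2 t" by (auto simp: f0_def f1_def f2_def)
    show "norm (Rt t) \<le> q * (1 + \<bar>t\<bar>) powr (- (1/2 + \<epsilon>))" using q(2) t by (auto simp: L_def)
  qed
  have b0: "norm (h t) \<le> q * (1 + \<bar>t\<bar>) powr (- \<epsilon>)" if "L < \<bar>t\<bar>" for t
  proof -
    have "norm (h t) \<le> q * (1 + \<bar>t\<bar>) powr (- (1/2 + \<epsilon>))" using far[OF that] by (simp add: hf)
    also have "\<dots> \<le> q * (1 + \<bar>t\<bar>) powr (- \<epsilon>)" using q(1) by (intro mult_left_mono powr_mono) auto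
    finally show ?thesis .
  qed
  have b1: "norm (?h1 t) \<le> q\<^sup>2 * (1 + \<bar>t\<bar>) powr (- (1 + 2 * \<epsilon>))" if "L < \<bar>t\<bar>" for t
  proof -
    have "norm (?h1 t) \<le> norm (Rt t) * norm (Rt t)" using far[OF that] R1le by simp
    also have "\<dots> \<le> (q * (1 + \<bar>t\<bar>) powr (- (1/2 + \<epsilon>))) * (q * (1 + \<bar>t\<bar>) powr (- (1/2 + \<epsilon>)))"
      using far(5)[OF that] q(1) by (intro mult_mono) auto
    also have "\<dots> = q\<^sup>2 * ((1 + \<bar>t\<bar>) powr (- (1/2 + \<epsilon>)) * (1 + \<bar>t\<bar>) powr (- (1/2 + \<epsilon>)))"
      by (simp add: power2_eq_square)
    also have "\<dots> = q\<^sup>2 * (1 + \<bar>t\<bar>) powr (- (1 + 2 * \<epsilon>))"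
    proof -
      have e: "- (1/2 + \<epsilon>) + - (1/2 + \<epsilon>) = - (1 + 2 * \<epsilon>)" by simp
      show ?thesis unfolding powr_add[symmetric] e ..
    qed
    finally show ?thesis .
  qed
  have b2: "norm (?h2 t) \<le> (2 * q ^ 3) * (1 + \<bar>t\<bar>) powr (- (1 + \<epsilon>))" if "L < \<bar>t\<bar>" for t
  proof -
    let ?x = "(1 + \<bar>t\<bar>) powr (- (1/2 + \<epsilon>))"
    have "norm (?h2 t) \<le> 2 * (norm (Rt t) * (norm (Rt t) * norm (Rt t)))" using far[OF that] R2le by simp
    also have "\<dots> \<le> 2 * ((q * ?x) * ((q * ?x) * (q * ?x)))"
      using far(5)[OF that] q(1) by (intro mult_left_mono mult_mono) auto
    also have "\<dots> = (2 * q ^ 3) * (?x * (?x * ?x))" by (simp add: power3_eq_cube)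
    also have "?x * (?x * ?x) = (1 + \<bar>t\<bar>) powr (- (3/2 + 3 * \<epsilon>))"
    proof -
      have e: "- (1/2 + \<epsilon>) + (- (1/2 + \<epsilon>) + - (1/2 + \<epsilon>)) = - (3/2 + 3 * \<epsilon>)" by simp
      show ?thesis unfolding powr_add[symmetric] e ..
    qed
    also have "(2 * q ^ 3) * (1 + \<bar>t\<bar>) powr (- (3/2 + 3 * \<epsilon>)) \<le> (2 * q ^ 3) * (1 + \<bar>t\<bar>) powr (- (1 + \<epsilon>))"
      using q(1) eps by (intro mult_left_mono powr_mono) auto
    finally show ?thesis .
  qed
  obtain C0 where C0: "0 \<le> C0" "\<And>t. norm (h t) \<le> C0 * (1 + \<bar>t\<bar>) powr (- \<epsilon>)"
    by (rule continuous_decay[OF continuous_on_vector_derivative[OF D0] b0]) (use eps in auto)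
  obtain C1 where C1: "0 \<le> C1" "\<And>t. norm (?h1 t) \<le> C1 * (1 + \<bar>t\<bar>) powr (- (1 + 2 * \<epsilon>))"
    by (rule continuous_decay[OF continuous_on_vector_derivative[OF D1] b1]) (use eps in auto)
  obtain C2 where C2: "0 \<le> C2" "\<And>t. norm (?h2 t) \<le> C2 * (1 + \<bar>t\<bar>) powr (- (1 + \<epsilon>))"
    by (rule continuous_decay[OF c2 b2]) (use eps in auto)
  have mono: "x \<le> c * y \<Longrightarrow> c \<le> C0 + C1 + C2 \<Longrightarrow> 0 \<le> y \<Longrightarrow> x \<le> (C0 + C1 + C2) * y" for x c y :: real
    by (meson mult_right_mono order_trans)
  have "fourier_symbol h ?h1 ?h2 \<epsilon> (C0 + C1 + C2)"
  proof (unfold_locales; (rule eps D0 D1 c2)?)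
    fix t
    show "norm (h t) \<le> (C0 + C1 + C2) * (1 + \<bar>t\<bar>) powr (- \<epsilon>)"
      by (rule mono[OF C0(2)]) (use C0 C1 C2 in auto)
    have "norm (?h1 t) \<le> (C0 + C1 + C2) * (1 + \<bar>t\<bar>) powr (- (1 + 2 * \<epsilon>))"
      by (rule mono[OF C1(2)]) (use C0 C1 C2 in auto)
    then show "norm (?h1 t) \<le> (C0 + C1 + C2) * (1 + \<bar>t\<bar>) powr (- 1 - 2 * \<epsilon>)" by simp
    have "norm (?h2 t) \<le> (C0 + C1 + C2) * (1 + \<bar>t\<bar>) powr (- (1 + \<epsilon>))"
      by (rule mono[OF C2(2)]) (use C0 C1 C2 in auto)
    then show "norm (?h2 t) \<le> (C0 + C1 + C2) * (1 + \<bar>t\<bar>) powr (- 1 - \<epsilon>)" by simp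
  qed
  then show ?thesis by blast
qed

end

section \<open>The operator-valued kernel\<close>

lemma partial_inv_fourier_linear:
  fixes L :: "'e::complex_banach \<Rightarrow> 'f::complex_banach"
  assumes L: "bounded_linear L" "\<And>c x. L (c *\<^sub>C x) = c *\<^sub>C L x" and g: "continuous_on UNIV g"
  shows "L (partial_inv_fourier g N s) = partial_inv_fourier (\<lambda>t. L (g t)) N s"
  using integral_linear[OF scaleC_cis_integrable(2)[OF g] L(1), of "-N" N s]
  by (simp add: partial_inv_fourier_def comp_def L(2) linear_scale[OF bounded_linear.linear[OF L(1)]])

lemma partial_inv_fourier_add:
  assumes "continuous_on UNIV f" "continuous_on UNIV g"
  shows "partial_inv_fourier (\<lambda>t. f t + g t) N s = partial_inv_fourier f N s + partial_inv_fourier g N s"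
  using Henstock_Kurzweil_Integration.integral_add[OF scaleC_cis_integrable(2)[OF assms(1)] scaleC_cis_integrable(2)[OF assms(2)]]
  by (simp add: partial_inv_fourier_def scaleC_add_right scaleR_add_right)

lemma partial_inv_fourier_diff:
  assumes "continuous_on UNIV f" "continuous_on UNIV g"
  shows "partial_inv_fourier (\<lambda>t. f t - g t) N s = partial_inv_fourier f N s - partial_inv_fourier g N s"
  using Henstock_Kurzweil_Integration.integral_diff[OF scaleC_cis_integrable(2)[OF assms(1)] scaleC_cis_integrable(2)[OF assms(2)]]
  by (simp add: partial_inv_fourier_def scaleC.diff_right scaleR_diff_right)

text \<open>The Dirichlet kernel, written with \<open>sinc\<close> to include \<open>s = 0\<close>.
  Its primitive is a multiple of \<open>Si\<close>, which is how the point mass enters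
  below.\<close>

lemma partial_inv_fourier_one:
  assumes N: "0 \<le> N"
  shows "partial_inv_fourier (\<lambda>t. 1 :: complex) N s = of_real (N * sinc (N * s) / pi)"
proof (cases "s = 0 \<or> N = 0")
  case True
  have "integral {-N..N} (\<lambda>t. cis 0 :: complex) = of_real (2 * N)"
    using N by (simp add: scaleR_conv_of_real)
  then show ?thesis using True by (auto simp: partial_inv_fourier_def scaleR_conv_of_real)
next
  case False
  have "(\<i> * of_real s) * integral {-N..N} (\<lambda>t. cis (s * t)) = cis (s * N) - cis (- (s * N))"
    using fourier_integral_by_parts[OF has_vector_derivative_const[of "1 :: complex"] continuous_on_const N, of s] by simp
  also have "\<dots> = (\<i> * of_real s) * of_real (2 * sin (s * N) / s)"
    using False by (simp add: complex_eq_iff)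
  finally have eq: "(\<i> * of_real s) * integral {-N..N} (\<lambda>t. cis (s * t)) = (\<i> * of_real s) * of_real (2 * sin (s * N) / s)" .
  have "\<i> * complex_of_real s \<noteq> 0" using False by simp
  from mult_left_cancel[OF this, THEN iffD1, OF eq]
  have "integral {-N..N} (\<lambda>t. cis (s * t)) = of_real (2 * sin (s * N) / s)" .
  then have "partial_inv_fourier (\<lambda>t. 1 :: complex) N s = of_real ((1 / (2 * pi)) * (2 * sin (s * N) / s))"
    by (simp add: partial_inv_fourier_def scaleR_conv_of_real)
  also have "(1 / (2 * pi)) * (2 * sin (s * N) / s) = N * sinc (N * s) / pi"
    using False by (simp add: mult.commute)
  finally show ?thesis .
qed

lemma C2c_kern_partial:
  assumes "C2c \<eta>"
  obtains n0 where "\<And>n. n0 \<le> n \<Longrightarrow> partial_inv_fourier (\<lambda>t. complex_of_real (\<eta> t)) (real n) = kern \<eta>"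
proof -
  obtain R where R: "\<forall>t. \<bar>t\<bar> > R \<longrightarrow> \<eta> t = 0" and C: "C2 \<eta>" using assms unfolding C2c_def by blast
  have "partial_inv_fourier (\<lambda>t. complex_of_real (\<eta> t)) (real n) = kern \<eta>" if n: "nat \<lceil>R\<rceil> \<le> n" for n
  proof
    fix s
    have "R \<le> real n" using n by linarith
    then show "partial_inv_fourier (\<lambda>t. complex_of_real (\<eta> t)) (real n) s = kern \<eta> s"
      using C2c_partial_inv_fourier[OF C R] kern_eq[OF assms] by simp
  qed
  then show ?thesis using that by blast
qed

text \<open>The kernel equals one of its truncations, which is differentiable everywhere. This
  includes \<open>s = 0\<close>, where \<open>isCont_inv_fourier\<close> is silent.\<close>

lemma kern_continuous:
  assumes "C2c \<eta>"
  shows "continuous_on UNIV (kern \<eta>)"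
proof -
  obtain R where R: "\<forall>t. \<bar>t\<bar> > R \<longrightarrow> \<eta> t = 0" and C: "C2 \<eta>" using assms unfolding C2c_def by blast
  obtain h1 h2 C where "fourier_symbol (\<lambda>t. complex_of_real (\<eta> t)) h1 h2 1 C"
    using C2_compact_fourier_symbol[OF C R] by blast
  then interpret fourier_symbol "\<lambda>t. complex_of_real (\<eta> t)" h1 h2 1 C .
  obtain n0 where "partial_inv_fourier (\<lambda>t. complex_of_real (\<eta> t)) (real n0) = kern \<eta>"
    using C2c_kern_partial[OF assms] by (metis order_refl)
  then show ?thesis using continuous_on_vector_derivative[OF partial_derivative] by metis
qed

text \<open>The jump of size pi across \<open>x = 0\<close>, divided by pi, is the unit mass of the
  delta at 0.\<close>

lemma Si_limit:
  assumes "x \<noteq> 0"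
  shows "(\<lambda>n. Si (real n * x)) \<longlonglongrightarrow> sgn x * (pi / 2)"
proof -
  have pos: "(\<lambda>n. Si (real n * x)) \<longlonglongrightarrow> pi / 2" if "0 < x" for x
    by (rule filterlim_compose[OF Si_at_top]) (use that in real_asymp)
  show ?thesis
  proof (cases "0 < x")
    case False
    have "(\<lambda>n. - Si (real n * (- x))) \<longlonglongrightarrow> - (pi / 2)" using pos[of "-x"] False assms by (intro tendsto_minus) auto
    moreover have "- Si (real n * (- x)) = Si (real n * x)" for n
      using Si_neg[of "real n * (- x)"] False by (simp add: mult_nonneg_nonpos)
    ultimately show ?thesis using False assms by simp
  qed (use pos in simp)
qed

lemma integrable_powr_interval:
  assumes "0 < \<epsilon>"
  shows "integrable lborel (\<lambda>s::real. indicator {b..c} s * \<bar>s\<bar> powr (\<epsilon> - 1))"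
proof (rule Bochner_Integration.integrable_bound)
  show "integrable lborel (\<lambda>s::real. indicator {-1..1} s * \<bar>s\<bar> powr (\<epsilon> - 1) + indicator {b..c} s * (1 + \<bar>b\<bar> + \<bar>c\<bar>) powr \<epsilon>)"
    by (intro Bochner_Integration.integrable_add integrable_powr_min assms integrable_mult_left integrable_real_indicator)
       (auto simp: emeasure_lborel_Icc_eq)
  have "indicator {b..c} s * \<bar>s\<bar> powr (\<epsilon> - 1) \<le> indicator {-1..1} s * \<bar>s\<bar> powr (\<epsilon> - 1) + indicator {b..c} s * (1 + \<bar>b\<bar> + \<bar>c\<bar>) powr \<epsilon>" for s :: real
  proof (cases "s \<in> {b..c} \<and> s \<notin> {-1..1}")
    case True
    then have s: "1 \<le> \<bar>s\<bar>" "\<bar>s\<bar> \<le> 1 + \<bar>b\<bar> + \<bar>c\<bar>" by auto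
    have "\<bar>s\<bar> powr (\<epsilon> - 1) \<le> \<bar>s\<bar> powr \<epsilon>" using s by (intro powr_mono) auto
    also have "\<dots> \<le> (1 + \<bar>b\<bar> + \<bar>c\<bar>) powr \<epsilon>" using s assms by (intro powr_mono2) auto
    finally show ?thesis using True by simp
  qed (auto simp: indicator_def)
  then show "AE s in lborel. norm (indicator {b..c} s * \<bar>s\<bar> powr (\<epsilon> - 1))
      \<le> norm (indicator {-1..1} s * \<bar>s\<bar> powr (\<epsilon> - 1) + indicator {b..c} s * (1 + \<bar>b\<bar> + \<bar>c\<bar>) powr \<epsilon>)"
    by (intro AE_I2) (auto intro!: order_trans[OF _ abs_ge_self])
qed measurable

context resolvent_symbol
begin

text \<open>At \<open>0\<close> the limit defining \<open>inv_fourier h\<close> need not exist.\<close>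

definition G :: "real \<Rightarrow> 'a \<Rightarrow>\<^sub>L 'a" where
  "G s = (if s = 0 then 0 else inv_fourier h s)"

text \<open>The regularising resolvent at the point \<open>\<i> * a\<close>, which is outside the
  spectrum by \<open>a_not_K\<close>.\<close>

definition R0 :: "'a \<Rightarrow>\<^sub>L 'a" where "R0 = Rt a"

lemma a_not_K: "a \<notin> K"
  using K_bound by auto

lemma h_continuous: "continuous_on A' h"
  using fourier_symbol_h by (auto intro: fourier_symbol.c0)

lemma G_isCont:
  assumes "s \<noteq> 0"
  shows "isCont G s"
proof -
  obtain h1 h2 C where "fourier_symbol h h1 h2 \<epsilon> C" using fourier_symbol_h by blast
  then have "isCont (inv_fourier h) s" by (rule fourier_symbol.isCont_inv_fourier[OF _ assms])
  moreover have "\<forall>\<^sub>F x in nhds s. G x = inv_fourier h x"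
    using t1_space_nhds[OF assms] by eventually_elim (simp add: G_def)
  ultimately show ?thesis using isCont_cong[of G] by auto
qed

lemma G_simple_limit: "simple_limit lborel G"
  by (rule simple_limit_continuous_off_0[OF G_isCont])

lemma G_integrable: "integrable lborel (\<lambda>s. norm (G s))"
proof -
  obtain h1 h2 C where "fourier_symbol h h1 h2 \<epsilon> C" using fourier_symbol_h by blast
  then have int: "integrable lborel (\<lambda>s. norm (inv_fourier h s))" by (rule fourier_symbol.integrable_inv_fourier)
  show ?thesis
    by (rule Bochner_Integration.integrable_bound[OF int simple_limit_norm_measurable[OF G_simple_limit]])
       (auto simp: G_def)
qed

lemma G_limit:
  assumes "s \<noteq> 0"
  shows "(\<lambda>n. partial_inv_fourier h (real n) s) \<longlonglongrightarrow> G s"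
proof -
  obtain h1 h2 C where "fourier_symbol h h1 h2 \<epsilon> C" using fourier_symbol_h by blast
  then show ?thesis using fourier_symbol.partial_limit[OF _ assms] assms by (simp add: G_def)
qed

lemma h_complex_linear: "h t (c *\<^sub>C x) = c *\<^sub>C h t x"
proof (cases "t \<in> K")
  case False
  then have "Rt t (c *\<^sub>C x) = c *\<^sub>C Rt t x"
    unfolding Rt_def K_def by (intro Rz_complex_linear) simp
  then show ?thesis using False
    by (simp add: h_def blinfun.scaleR_left scaleC.scaleR_right)
qed (simp add: h_def scaleC.zero_right)

text \<open>For fixed \<open>c\<close> and \<open>x\<close> the defect of complex linearity is a
  bounded, complex-homogeneous map of the operator. It vanishes on every \<open>h t\<close>, hence
  on the truncated integrals and on their limit.\<close>

lemma G_complex_linear: "G s (c *\<^sub>C x) = c *\<^sub>C G s x"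
proof (cases "s = 0")
  case False
  define L :: "('a \<Rightarrow>\<^sub>L 'a) \<Rightarrow> 'a" where "L T = T (c *\<^sub>C x) - c *\<^sub>C T x" for T
  have L: "bounded_linear L"
    unfolding L_def
    by (intro bounded_linear_sub blinfun.bounded_linear_left
        bounded_linear_compose[OF scaleC.bounded_linear_right blinfun.bounded_linear_left])
  have "L (d *\<^sub>C T) = d *\<^sub>C L T" for d T
    unfolding L_def by (simp add: scaleC_blinfun_apply scaleC.diff_right scaleC_scaleC mult.commute)
  then have "L (partial_inv_fourier h (real n) s) = partial_inv_fourier (\<lambda>t. L (h t)) (real n) s" for n
    by (rule partial_inv_fourier_linear[OF L _ h_continuous])
  moreover have "L (h t) = 0" for t by (simp add: L_def h_complex_linear)
  ultimately have "L (partial_inv_fourier h (real n) s) = 0" for n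
    by (simp add: partial_inv_fourier_def scaleC.zero_right)
  moreover have "(\<lambda>n. L (partial_inv_fourier h (real n) s)) \<longlonglongrightarrow> L (G s)"
    by (rule bounded_linear.tendsto[OF L G_limit[OF False]])
  ultimately have "L (G s) = 0" using LIMSEQ_unique[OF tendsto_const] by force
  then show ?thesis by (simp add: L_def)
qed (simp add: G_def scaleC.zero_right)

lemma R0_scaleC: "R0 o\<^sub>L (c *\<^sub>C T) = c *\<^sub>C (R0 o\<^sub>L T)"
  by (rule blinfun_eqI)
     (use a_not_K in \<open>simp add: R0_def Rt_def scaleC_blinfun_apply Rz_complex_linear K_def\<close>)

text \<open>This is the resolvent identity for \<open>h\<close>: it removes the unbounded operator from
  \<open>i t h(t) = A h(t) + 1 - \<eta>(t)\<close>.\<close>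

lemma symbol_identity:
  "R0 o\<^sub>L ((\<i> * of_real t) *\<^sub>C h t)
    = of_real (1 - \<eta> t) *\<^sub>C R0 + ((\<i> * of_real a) *\<^sub>C (R0 o\<^sub>L h t) - h t)"
proof (cases "t \<in> K")
  case True
  then have "\<eta> t = 1" using K_W cutoff_1 by blast
  then show ?thesis using True by (simp add: h_def scaleC.zero_right scaleC.zero_left)
next
  case False
  have "Rt a - Rt t = (\<i> * of_real (t - a)) *\<^sub>C (Rt a o\<^sub>L Rt t)" by (rule Rt_identity[OF False a_not_K])
  also have "\<dots> = (\<i> * of_real t) *\<^sub>C (R0 o\<^sub>L Rt t) - (\<i> * of_real a) *\<^sub>C (R0 o\<^sub>L Rt t)"
    by (simp add: R0_def right_diff_distrib scaleC.diff_left)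
  finally have eq: "(\<i> * of_real t) *\<^sub>C (R0 o\<^sub>L Rt t) = R0 + ((\<i> * of_real a) *\<^sub>C (R0 o\<^sub>L Rt t) - Rt t)"
    by (simp add: R0_def algebra_simps)
  have h: "h t = of_real (1 - \<eta> t) *\<^sub>C Rt t" unfolding scaleC_of_real using False by (simp add: h_def)
  have "R0 o\<^sub>L ((\<i> * of_real t) *\<^sub>C h t) = of_real (1 - \<eta> t) *\<^sub>C ((\<i> * of_real t) *\<^sub>C (R0 o\<^sub>L Rt t))"
    unfolding h R0_scaleC scaleC_scaleC by (simp only: mult.commute)
  also have "\<dots> = of_real (1 - \<eta> t) *\<^sub>C R0 + ((\<i> * of_real a) *\<^sub>C (R0 o\<^sub>L h t) - h t)"
    unfolding eq h R0_scaleC scaleC_add_right scaleC.diff_right scaleC_scaleC by (simp only: mult.commute)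
  finally show ?thesis .
qed

text \<open>The equation for the kernel after multiplication by \<open>R0\<close>, integrated over
  \<open>{b..c}\<close> and tested with \<open>l\<close>. The last term is the contribution of the
  delta, present exactly when 0 lies inside the interval. The endpoints avoid 0 because convergence
  to \<open>G\<close> is known only there.\<close>

lemma key_identity:
  fixes l :: "('a \<Rightarrow>\<^sub>L 'a) \<Rightarrow> real"
  assumes l: "bounded_linear l" and bc: "b < c" "b \<noteq> 0" "c \<noteq> 0"
  shows "(LINT s|lborel. indicator {b..c} s * (l ((\<i> * of_real a) *\<^sub>C (R0 o\<^sub>L G s) - G s) - l (kern \<eta> s *\<^sub>C R0)))
    = l (R0 o\<^sub>L G c) - l (R0 o\<^sub>L G b) - (if b < 0 \<and> 0 < c then l R0 else 0)"
proof -
  interpret l: bounded_linear l by fact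
  obtain h1 h2 C where fs: "fourier_symbol h h1 h2 \<epsilon> C" using fourier_symbol_h by blast
  interpret fs: fourier_symbol h h1 h2 \<epsilon> C by (rule fs)
  define P where "P n = partial_inv_fourier h (real n)" for n
  have bl: "bounded_linear (\<lambda>T. R0 o\<^sub>L T)"
    by (rule bounded_bilinear.bounded_linear_right[OF bounded_bilinear_blinfun_compose])
  define V where "V T = l ((\<i> * of_real a) *\<^sub>C (R0 o\<^sub>L T) - T)" for T
  have V: "bounded_linear V" unfolding V_def
    by (intro bounded_linear_compose[OF l] bounded_linear_sub bounded_linear_ident
        bounded_linear_compose[OF scaleC.bounded_linear_right bl])
  define U where "U s = l (kern \<eta> s *\<^sub>C R0)" for s
  have U: "continuous_on A' U" for A'
    unfolding U_def
    by (intro l.continuous_on scaleC.continuous_on continuous_on_const continuous_on_subset[OF kern_continuous[OF C2c_cutoff]]) auto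
  have Pc: "continuous_on A' (P n)" for A' n
    unfolding P_def by (rule continuous_on_vector_derivative[OF fs.partial_derivative])
  have VP: "continuous_on A' (\<lambda>s. V (P n s))" for A' n
    by (rule bounded_linear.continuous_on[OF V Pc])
  obtain n0 where n0: "\<And>n. n0 \<le> n \<Longrightarrow> partial_inv_fourier (\<lambda>t. complex_of_real (\<eta> t)) (real n) = kern \<eta>"
    using C2c_kern_partial[OF C2c_cutoff] by blast
  have \<eta>c: "continuous_on UNIV (\<lambda>t. complex_of_real (\<eta> t))"
    using C2c_cutoff by (intro continuous_intros C2_continuous) (simp add: C2c_def)
  \<comment> \<open>Differentiation multiplies the symbol by \<open>\<i> * t\<close>, and
    \<open>symbol_identity\<close> splits the result into three transforms: that of 1, the Dirichlet
    kernel; that of \<eta>, equal to \<open>kern \<eta>\<close> once \<open>n \<ge> n0\<close>; and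
    a bounded operator applied to \<open>P n s\<close>.\<close>
  have deriv: "l (R0 o\<^sub>L partial_inv_fourier (\<lambda>t. (\<i> * of_real t) *\<^sub>C h t) (real n) s)
      = real n * sinc (real n * s) / pi * l R0 - U s + V (P n s)" if n: "n0 \<le> n" for n s
  proof -
    have c1: "continuous_on UNIV (\<lambda>t. (\<i> * complex_of_real t) *\<^sub>C h t)"
      by (intro continuous_intros h_continuous)
    have c2: "continuous_on UNIV (\<lambda>t. complex_of_real (1 - \<eta> t))"
      using \<eta>c by (simp add: continuous_intros)
    have c3: "continuous_on UNIV (\<lambda>t. R0 o\<^sub>L h t)" by (rule bounded_linear.continuous_on[OF bl h_continuous])
    have c4: "continuous_on UNIV (\<lambda>t. (\<i> * of_real a) *\<^sub>C (R0 o\<^sub>L h t) - h t)"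
      by (intro continuous_intros c3 h_continuous)
    have c5: "continuous_on UNIV (\<lambda>t. of_real (1 - \<eta> t) *\<^sub>C R0)" by (intro continuous_intros c2)
    have "R0 o\<^sub>L partial_inv_fourier (\<lambda>t. (\<i> * of_real t) *\<^sub>C h t) (real n) s
        = partial_inv_fourier (\<lambda>t. of_real (1 - \<eta> t) *\<^sub>C R0 + ((\<i> * of_real a) *\<^sub>C (R0 o\<^sub>L h t) - h t)) (real n) s"
      unfolding partial_inv_fourier_linear[OF bl R0_scaleC c1] symbol_identity ..
    also have "\<dots> = partial_inv_fourier (\<lambda>t. of_real (1 - \<eta> t) *\<^sub>C R0) (real n) s
        + partial_inv_fourier (\<lambda>t. (\<i> * of_real a) *\<^sub>C (R0 o\<^sub>L h t) - h t) (real n) s"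
      by (rule partial_inv_fourier_add[OF c5 c4])
    also have "partial_inv_fourier (\<lambda>t. of_real (1 - \<eta> t) *\<^sub>C R0) (real n) s
        = partial_inv_fourier (\<lambda>t. of_real (1 - \<eta> t)) (real n) s *\<^sub>C R0"
      by (rule partial_inv_fourier_linear[OF scaleC.bounded_linear_left _ c2, symmetric]) (simp add: scaleC_scaleC)
    also have "partial_inv_fourier (\<lambda>t. complex_of_real (1 - \<eta> t)) (real n) s
        = of_real (real n * sinc (real n * s) / pi) - kern \<eta> s"
      using partial_inv_fourier_diff[OF continuous_on_const \<eta>c, of 1 "real n" s] n0[OF n]
      by (simp add: partial_inv_fourier_one del: of_real_divide of_real_mult)
    also have "partial_inv_fourier (\<lambda>t. (\<i> * of_real a) *\<^sub>C (R0 o\<^sub>L h t) - h t) (real n) s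
        = (\<i> * of_real a) *\<^sub>C (R0 o\<^sub>L P n s) - P n s"
    proof -
      have "bounded_linear (\<lambda>T. (\<i> * of_real a) *\<^sub>C (R0 o\<^sub>L T) - T)"
        by (intro bounded_linear_sub bounded_linear_ident bounded_linear_compose[OF scaleC.bounded_linear_right bl])
      then show ?thesis unfolding P_def
        by (rule partial_inv_fourier_linear[OF _ _ h_continuous, symmetric])
           (simp add: R0_scaleC scaleC.diff_right scaleC_scaleC mult.commute)
    qed
    finally show ?thesis
      unfolding scaleC.diff_left scaleC_of_real by (simp add: l.add l.diff l.scaleR U_def V_def)
  qed
  define X where "X n = (l (R0 o\<^sub>L P n c) - l (R0 o\<^sub>L P n b)) - (Si (real n * c) - Si (real n * b)) / pi * l R0" for n
  have int: "(LINT s|lborel. indicator {b..c} s * (V (P n s) - U s)) = X n" if n: "n0 \<le> n" for n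
  proof -
    have 1: "((\<lambda>s. l (R0 o\<^sub>L partial_inv_fourier (\<lambda>t. (\<i> * of_real t) *\<^sub>C h t) (real n) s)) has_integral
        (l (R0 o\<^sub>L P n c) - l (R0 o\<^sub>L P n b))) {b..c}"
      unfolding P_def
      using bc(1) by (intro fundamental_theorem_of_calculus bounded_linear.has_vector_derivative[OF bounded_linear_compose[OF l bl]]
          fs.partial_derivative) auto
    have 2: "((\<lambda>s. real n * sinc (real n * s)) has_integral (Si (real n * c) - Si (real n * b))) {b..c}"
    proof (rule fundamental_theorem_of_calculus)
      fix s
      have "((\<lambda>s. real n * s) has_real_derivative real n) (at s within {b..c})" by (auto intro!: derivative_eq_intros)
      from DERIV_chain2[OF DERIV_Si this]
      show "((\<lambda>s. Si (real n * s)) has_vector_derivative real n * sinc (real n * s)) (at s within {b..c})"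
        unfolding has_real_derivative_iff_has_vector_derivative[symmetric] by (simp only: mult.commute)
    qed (use bc in auto)
    have 3: "((\<lambda>s. (real n * sinc (real n * s)) * (1 / pi * l R0)) has_integral ((Si (real n * c) - Si (real n * b)) * (1 / pi * l R0))) {b..c}"
      by (rule has_integral_mult_left[OF 2])
    have "((\<lambda>s. V (P n s) - U s) has_integral X n) {b..c}"
      using has_integral_diff[OF 1 3] unfolding deriv[OF n] X_def by (simp add: algebra_simps diff_divide_distrib)
    moreover have set: "set_integrable lborel {b..c} (\<lambda>s. V (P n s) - U s)"
      by (intro borel_integrable_atLeastAtMost' continuous_intros VP U)
    ultimately show ?thesis
      using set_borel_integral_eq_integral(2)[OF set] integral_unique by (simp add: set_lebesgue_integral_def)
  qed
  have Xlim: "X \<longlonglongrightarrow> l (R0 o\<^sub>L G c) - l (R0 o\<^sub>L G b) - (if b < 0 \<and> 0 < c then l R0 else 0)"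
  proof -
    have "X \<longlonglongrightarrow> (l (R0 o\<^sub>L G c) - l (R0 o\<^sub>L G b)) - (sgn c * (pi / 2) - sgn b * (pi / 2)) / pi * l R0"
      unfolding X_def P_def
      by (intro tendsto_intros Si_limit bc bounded_linear.tendsto[OF bounded_linear_compose[OF l bl]] G_limit) auto
    moreover have "(sgn c * (pi / 2) - sgn b * (pi / 2)) / pi * l R0 = (if b < 0 \<and> 0 < c then l R0 else 0)"
      using bc by (auto simp: sgn_real_def field_simps)
    ultimately show ?thesis by simp
  qed
  obtain KV where KV: "\<And>T. norm (V T) \<le> norm T * KV" "0 \<le> KV"
    using bounded_linear.nonneg_bounded[OF V] by blast
  define B where "B = 4 * C + 2 * fs.M0"
  have B: "norm (P n s) \<le> B * \<bar>s\<bar> powr (\<epsilon> - 1)" if "s \<noteq> 0" for n s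
    unfolding P_def B_def by (rule fs.partial_bound[OF of_nat_0_le_iff that])
  have Usi: "integrable lborel (\<lambda>s. indicator {b..c} s * \<bar>U s\<bar>)"
    using borel_integrable_atLeastAtMost'[of b c "\<lambda>s. \<bar>U s\<bar>"] U
    by (simp add: set_integrable_def continuous_intros)
  have mU: "U \<in> borel_measurable borel" and mVP: "(\<lambda>s. V (P n s)) \<in> borel_measurable borel" for n
    by (intro borel_measurable_continuous_onI U VP)+
  have "simple_limit lborel (\<lambda>s. V (G s))"
    by (intro simple_limit_compose[OF G_simple_limit] bounded_linear.continuous_on[OF V] continuous_on_id)
  then have mV: "(\<lambda>s. V (G s)) \<in> borel_measurable borel" using simple_limit_borel_measurable by force
  have "(\<lambda>n. LINT s|lborel. indicator {b..c} s * (V (P n s) - U s)) \<longlonglongrightarrow> (LINT s|lborel. indicator {b..c} s * (V (G s) - U s))"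
  \<comment> \<open>The majorant comes from \<open>partial_bound\<close>, which is uniform in
    \<open>n\<close>, and is integrable across 0. So the limit is allowed also when the interval
    contains 0, where no convergence of \<open>P n\<close> is claimed.\<close>
  proof (rule integral_dominated_convergence[where w = "\<lambda>s. KV * B * (indicator {b..c} s * \<bar>s\<bar> powr (\<epsilon> - 1)) + indicator {b..c} s * \<bar>U s\<bar>"])
    show "(\<lambda>s. indicator {b..c} s * (V (G s) - U s)) \<in> borel_measurable lborel"
      using mU mV by measurable
    show "(\<lambda>s. indicator {b..c} s * (V (P n s) - U s)) \<in> borel_measurable lborel" for n
      using mU mVP[of n] by measurable
    show "integrable lborel (\<lambda>s. KV * B * (indicator {b..c} s * \<bar>s\<bar> powr (\<epsilon> - 1)) + indicator {b..c} s * \<bar>U s\<bar>)"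
      by (intro Bochner_Integration.integrable_add integrable_mult_right integrable_powr_interval eps Usi)
    show "AE s in lborel. (\<lambda>n. indicator {b..c} s * (V (P n s) - U s)) \<longlonglongrightarrow> indicator {b..c} s * (V (G s) - U s)"
    proof -
      have "(\<lambda>n. indicator {b..c} s * (V (P n s) - U s)) \<longlonglongrightarrow> indicator {b..c} s * (V (G s) - U s)" if "s \<noteq> 0" for s
        unfolding P_def by (intro tendsto_intros bounded_linear.tendsto[OF V] G_limit that)
      then show ?thesis using AE_lborel_singleton[of 0] by (auto elim!: eventually_mono)
    qed
    show "AE s in lborel. norm (indicator {b..c} s * (V (P n s) - U s))
        \<le> KV * B * (indicator {b..c} s * \<bar>s\<bar> powr (\<epsilon> - 1)) + indicator {b..c} s * \<bar>U s\<bar>" for n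
    proof -
      have "norm (indicator {b..c} s * (V (P n s) - U s))
        \<le> KV * B * (indicator {b..c} s * \<bar>s\<bar> powr (\<epsilon> - 1)) + indicator {b..c} s * \<bar>U s\<bar>" if "s \<noteq> 0" for s
      proof -
        have "\<bar>V (P n s) - U s\<bar> \<le> \<bar>V (P n s)\<bar> + \<bar>U s\<bar>" by (rule abs_triangle_ineq4)
        also have "\<bar>V (P n s)\<bar> \<le> norm (P n s) * KV" using KV(1)[of "P n s"] by simp
        also have "\<dots> \<le> (B * \<bar>s\<bar> powr (\<epsilon> - 1)) * KV" by (rule mult_right_mono[OF B[OF that] KV(2)])
        finally have "\<bar>V (P n s) - U s\<bar> \<le> KV * B * \<bar>s\<bar> powr (\<epsilon> - 1) + \<bar>U s\<bar>" by (simp add: mult_ac)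
        then show ?thesis by (auto simp: indicator_def)
      qed
      then show ?thesis using AE_lborel_singleton[of 0] by (auto elim!: eventually_mono)
    qed
  qed
  moreover have "\<forall>\<^sub>F n in sequentially. (LINT s|lborel. indicator {b..c} s * (V (P n s) - U s)) = X n"
    using eventually_ge_at_top[of n0] by eventually_elim (rule int)
  ultimately have "X \<longlonglongrightarrow> (LINT s|lborel. indicator {b..c} s * (V (G s) - U s))"
    by (rule Lim_transform_eventually)
  from LIMSEQ_unique[OF this Xlim] show ?thesis unfolding V_def U_def .
qed

end

section \<open>The convolution operator\<close>

lemma C2_prod: "finite J \<Longrightarrow> (\<And>j. j \<in> J \<Longrightarrow> C2 (f j)) \<Longrightarrow> C2 (\<lambda>t. \<Prod>j\<in>J. f j t)"
  by (induction J rule: finite_induct) (auto intro: C2_const C2_mult)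

text \<open>Finitely many balls with radius \<open>r k\<close> cover \<open>K\<close> while the
  closed balls with twice the radius avoid \<open>F\<close>. One minus the product of the factors
  \<open>1 - bump\<close> equals 1 wherever one of the bumps does and 0 where all of them vanish, so
  it is a smooth substitute for their maximum.\<close>

lemma exists_cutoff:
  fixes K F :: "real set"
  assumes K: "compact K" and F: "closed F" and disj: "K \<inter> F = {}"
  obtains \<eta> W C where "C2c \<eta>" "open W" "K \<subseteq> W" "\<And>t. t \<in> W \<Longrightarrow> \<eta> t = 1"
    "compact C" "C \<inter> F = {}" "\<And>t. \<eta> t \<noteq> 0 \<Longrightarrow> t \<in> C"
proof -
  have "\<exists>r>0. cball k (2 * r) \<inter> F = {}" if "k \<in> K" for k
  proof -
    have "k \<in> - F" "open (- F)" using that disj F by auto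
    then obtain e where e: "e > 0" "ball k e \<subseteq> - F" by (meson openE)
    then have "cball k (2 * (e / 4)) \<inter> F = {}" by (force simp: subset_iff)
    then show ?thesis using e by (intro exI[of _ "e / 4"]) auto
  qed
  then obtain r where r: "\<And>k. k \<in> K \<Longrightarrow> r k > 0" "\<And>k. k \<in> K \<Longrightarrow> cball k (2 * r k) \<inter> F = {}" by metis
  have "K \<subseteq> \<Union> ((\<lambda>k. ball k (r k)) ` K)" using r(1) by force
  then obtain J where J: "J \<subseteq> K" "finite J" "K \<subseteq> \<Union> ((\<lambda>k. ball k (r k)) ` J)"
    using compactE_image[OF K, of K "\<lambda>k. ball k (r k)"] by auto
  define \<eta> where "\<eta> t = 1 - (\<Prod>j\<in>J. 1 - bump ((t - j) / r j))" for t
  define C where "C = \<Union> ((\<lambda>k. cball k (2 * r k)) ` J)"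
  have supp: "t \<in> C" if "\<eta> t \<noteq> 0" for t
  proof (rule ccontr)
    assume "t \<notin> C"
    have "bump ((t - j) / r j) = 0" if "j \<in> J" for j
    proof (rule bump_eq_0)
      have "2 * r j < \<bar>t - j\<bar>" using \<open>t \<notin> C\<close> that by (auto simp: C_def dist_real_def abs_minus_commute not_le)
      moreover have "0 < r j" using r(1) J(1) that by blast
      ultimately show "2 \<le> \<bar>(t - j) / r j\<bar>" by (simp add: abs_divide field_simps)
    qed
    then show False using that by (simp add: \<eta>_def)
  qed
  have C: "compact C" unfolding C_def using J by (intro compact_UN) auto
  obtain R where R: "\<And>t. t \<in> C \<Longrightarrow> \<bar>t\<bar> \<le> R" using compact_imp_bounded[OF C] by (auto simp: bounded_iff)
  have "C2 \<eta>" unfolding \<eta>_def[abs_def] by (intro C2_diff C2_const C2_prod J C2_affine C2_bump)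
  then have "C2c \<eta>" unfolding C2c_def using supp R by (meson not_le)
  moreover have "\<eta> t = 1" if t: "t \<in> \<Union> ((\<lambda>k. ball k (r k)) ` J)" for t
  proof -
    obtain j where j: "j \<in> J" "t \<in> ball j (r j)" using t by blast
    then have "\<bar>t - j\<bar> < r j" by (simp add: dist_real_def abs_minus_commute)
    then have "bump ((t - j) / r j) = 1"
      using r(1) J(1) by (intro bump_eq_1) (auto simp: abs_divide field_simps)
    then show ?thesis using j(1) J(2) by (auto simp: \<eta>_def)
  qed
  moreover have "C \<inter> F = {}" unfolding C_def using r(2) J(1) by blast
  ultimately show ?thesis
    using that[of \<eta> "\<Union> ((\<lambda>k. ball k (r k)) ` J)" C] J(3) C supp by blast
qed

lemma C0_generator_linear:
  fixes T :: "real \<Rightarrow> 'a::complex_banach \<Rightarrow>\<^sub>L 'a"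
  assumes T: "C0_semigroup T" and gen: "is_generator T D A"
  shows "complex_linear_operator D A"
proof -
  define q where "q x h = (1 / h) *\<^sub>R (T h x - x)" for x and h :: real
  have D: "D = {x. \<exists>y. (q x \<longlongrightarrow> y) (at_right 0)}" and A: "\<And>x. x \<in> D \<Longrightarrow> (q x \<longlongrightarrow> A x) (at_right 0)"
    using gen by (simp_all add: is_generator_def q_def[abs_def])
  have lim: "x \<in> D \<and> A x = y" if "(q x \<longlongrightarrow> y) (at_right 0)" for x y
  proof -
    have "x \<in> D" using that D by blast
    then show ?thesis using tendsto_unique[OF _ A that] by simp
  qed
  have qadd: "q (x + y) = (\<lambda>h. q x h + q y h)" for x y
    by (auto simp: q_def blinfun.add_right algebra_simps)
  have add: "x + y \<in> D \<and> A (x + y) = A x + A y" if "x \<in> D" "y \<in> D" for x y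
    by (rule lim) (unfold qadd, intro tendsto_intros A that)
  have scale: "c *\<^sub>C x \<in> D \<and> A (c *\<^sub>C x) = c *\<^sub>C A x" if x: "x \<in> D" for c x
  proof (rule lim)
    have "\<forall>\<^sub>F h in at_right 0. c *\<^sub>C q x h = q (c *\<^sub>C x) h"
    \<comment> \<open>Complex linearity of \<open>T h\<close> is assumed for nonnegative
      \<open>h\<close>, and the limit from the right only looks at positive
      \<open>h\<close>.\<close>
    proof (rule eventually_at_right_less[THEN eventually_mono])
      fix h :: real assume "0 < h"
      then have "T h (c *\<^sub>C x) = c *\<^sub>C T h x" using T by (simp add: C0_semigroup_def complex_linear_def)
      then show "c *\<^sub>C q x h = q (c *\<^sub>C x) h" by (simp add: q_def scaleC.scaleR_right scaleC.diff_right)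
    qed
    then show "(q (c *\<^sub>C x) \<longlongrightarrow> c *\<^sub>C A x) (at_right 0)"
      by (rule Lim_transform_eventually[rotated]) (intro tendsto_intros A x)
  qed
  have "q 0 = (\<lambda>h. 0)" by (auto simp: q_def blinfun.zero_right)
  then have "0 \<in> D" using lim[of 0 0] by simp
  then show ?thesis by unfold_locales (use add scale in auto)
qed

lemma convolution_scaleC_functional:
  fixes l :: "'a::complex_banach \<Rightarrow> 'c::{banach, second_countable_topology}"
  assumes f: "integrable lborel f" and p: "simple_limit lborel p" "\<And>t. norm (p t) \<le> B" and l: "bounded_linear l"
  shows "l (convolution (\<lambda>x c. c *\<^sub>C x) p f t) = (LINT s|lborel. l (f (t - s) *\<^sub>C p s))"
proof -
  have f': "simple_limit lborel (\<lambda>s. f (t - s))" "integrable lborel (\<lambda>s. norm (f (t - s)))"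
    using borel_measurable_simple_limit[OF borel_measurable_integrable[OF integrable_real_reflect[OF f, of t]]]
      integrable_real_reflect[OF f, of t] by auto
  note b = integrable_norm_bilinear[OF scaleC_bounded_bilinear f' p]
  show ?thesis unfolding convolution_def
    by (rule Bochner_integral_functional(2)[OF b(1) Bochner_integrableI[OF b] l])
qed

text \<open>Each \<open>w\<close> outside the Beurling spectrum provides, by definition, an
  integrable \<open>f\<close> with vanishing convolution and nonzero transform at \<open>w\<close>.
  A complex-linear \<open>l\<close> passes through the scalars \<open>f (t - s)\<close>, so the
  scalar function \<open>l \<circ> p\<close> satisfies the hypothesis of
  \<open>spectral_annihilation\<close>.\<close>

lemma beurling_spectrum_annihilates:
  fixes p :: "real \<Rightarrow> 'a::complex_banach" and l :: "'a \<Rightarrow> complex"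
  assumes p: "simple_limit lborel p" "\<And>t. norm (p t) \<le> B"
    and C: "compact C" "C \<inter> beurling_spectrum p = {}"
    and \<eta>: "C2c \<eta>" "\<And>t. \<eta> t \<noteq> 0 \<Longrightarrow> t \<in> C"
    and l: "bounded_linear l" "\<And>c x. l (c *\<^sub>C x) = c * l x"
  shows "(LINT s|lborel. kern \<eta> s * l (p (t - s))) = 0"
proof -
  interpret l: bounded_linear l by fact
  obtain Kl where Kl: "\<And>x. norm (l x) \<le> norm x * Kl" "0 \<le> Kl" using l.nonneg_bounded by blast
  have pm: "(\<lambda>s. l (p s)) \<in> borel_measurable lborel"
    by (intro simple_limit_borel_measurable simple_limit_compose[OF p(1)] l.continuous_on continuous_on_id)
  show ?thesis
  proof (rule spectral_annihilation[where p = "\<lambda>s. l (p s)", OF _ _ C(1) _ \<eta>])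
    show "(\<lambda>s. l (p s)) \<in> borel_measurable borel" using pm by simp
    show "norm (l (p s)) \<le> B * Kl" for s
      using Kl(1)[of "p s"] mult_right_mono[OF p(2)[of s] Kl(2)] by linarith
    fix w assume "w \<in> C"
    then have "w \<notin> beurling_spectrum p" using C(2) by blast
    then obtain f where f: "integrable lborel f" "\<And>t. convolution (\<lambda>x c. c *\<^sub>C x) p f t = 0" "fourier f w \<noteq> 0"
      by (auto simp: beurling_spectrum_def)
    have "(LINT s|lborel. f s * l (p (t - s))) = 0" for t
    proof -
      have "(LINT s|lborel. f s * l (p (t - s))) = (LINT s|lborel. f (t - s) * l (p s))"
        using integral_real_reflect[of "\<lambda>s. f s * l (p (t - s))" t] by simp
      also have "\<dots> = l (convolution (\<lambda>x c. c *\<^sub>C x) p f t)"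
        unfolding convolution_scaleC_functional[OF f(1) p l(1)] by (simp add: l(2))
      finally show ?thesis by (simp add: f(2) l.zero)
    qed
    then show "\<exists>f. integrable lborel f \<and> (\<forall>t. (LINT s|lborel. f s * l (p (t - s))) = 0) \<and> fourier f w \<noteq> 0"
      using f by blast
  qed
qed

text \<open>The inclusion of the Beurling spectrum in \<open>F\<close> enters only through
  \<open>kern_phi\<close>, the weak form of the statement that the kernel of the cutoff annihilates
  \<phi>. The input is a representative that is measurable and bounded at every point.\<close>

locale convolution_input = resolvent_symbol D A a \<theta> Q \<eta> W
  for D :: "'a::complex_banach set" and A a \<theta> Q \<eta> W +
  fixes \<phi> :: "real \<Rightarrow> 'a" and B :: real
  assumes phi: "simple_limit lborel \<phi>" and phi_bound: "\<And>t. norm (\<phi> t) \<le> B"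
    and kern_phi: "\<And>(l :: 'a \<Rightarrow> complex) t. bounded_linear l \<Longrightarrow> (\<And>c x. l (c *\<^sub>C x) = c * l x) \<Longrightarrow>
      (LINT s|lborel. kern \<eta> s * l (\<phi> (t - s))) = 0"
begin

definition u :: "real \<Rightarrow> 'a" where "u = convolution blinfun_apply G \<phi>"

lemma u_integrand: "simple_limit lborel (\<lambda>s. G s (\<phi> (t - s)))" "integrable lborel (\<lambda>s. norm (G s (\<phi> (t - s))))"
  using integrable_norm_bilinear[OF bounded_bilinear_blinfun_apply G_simple_limit G_integrable
      simple_limit_reflect[OF phi, of t] phi_bound] by auto

lemma u_functional:
  fixes l :: "'a \<Rightarrow> 'c::{banach, second_countable_topology}"
  assumes "bounded_linear l"
  shows "l (u t) = (LINT s|lborel. l (G s (\<phi> (t - s))))" "integrable lborel (\<lambda>s. l (G s (\<phi> (t - s))))"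
  using Bochner_integral_functional[OF u_integrand(1) Bochner_integrableI[OF u_integrand] assms]
  by (simp_all add: u_def convolution_def)

lemma u_functional':
  fixes l :: "'a \<Rightarrow> 'c::{banach, second_countable_topology}"
  assumes "bounded_linear l"
  shows "l (u t) = (LINT r|lborel. l (G (t - r) (\<phi> r)))" "integrable lborel (\<lambda>r. l (G (t - r) (\<phi> r)))"
  using u_functional[OF assms, of t] integral_real_reflect[of "\<lambda>s. l (G s (\<phi> (t - s)))" t]
    integrable_real_reflect[of "\<lambda>s. l (G s (\<phi> (t - s)))" t] by simp_all

lemma u_bound: "norm (u t) \<le> (LINT s|lborel. norm (G s)) * B"
proof -
  have "norm (u t) \<le> (LINT s|lborel. norm (G s (\<phi> (t - s))))"
    unfolding u_def convolution_def by (rule norm_Bochner_integral_le[OF u_integrand])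
  also have "\<dots> \<le> (LINT s|lborel. norm (G s) * B)"
  proof (rule integral_mono[OF u_integrand(2)])
    show "integrable lborel (\<lambda>s. norm (G s) * B)" using G_integrable by simp
    show "norm (G s (\<phi> (t - s))) \<le> norm (G s) * B" for s
      by (rule order_trans[OF norm_blinfun]) (intro mult_left_mono phi_bound, simp)
  qed
  finally show ?thesis by simp
qed

text \<open>The increment is moved by a change of variables from \<phi>, which need not be
  continuous, to \<open>G\<close>, whose translations are continuous in \<open>L^1\<close>.\<close>

lemma u_increment: "norm (u t - u t') \<le> (LINT s|lborel. norm (G (s + (t' - t)) - G s)) * B"
proof -
  obtain l :: "'a \<Rightarrow> real" where l: "bounded_linear l" "l (u t - u t') = norm (u t - u t')"
     "\<And>y. \<bar>l y\<bar> \<le> norm y" using hahn_banach_norming by blast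
  interpret l: bounded_linear l by fact
  let ?y = "t' - t"
  have sl: "simple_limit lborel (\<lambda>s. G (s + ?y))" by (rule simple_limit_measurable_compose[OF G_simple_limit]) simp
  have int: "integrable lborel (\<lambda>s. norm (G (s + ?y) - G s))"
    by (rule Bochner_Integration.integrable_bound[OF Bochner_Integration.integrable_add[OF integrable_real_shift[OF G_integrable] G_integrable]
          simple_limit_norm_measurable[OF simple_limit_diff[OF sl G_simple_limit]]])
       (auto intro!: AE_I2 norm_triangle_ineq4)
  have e': "l (u t') = (LINT s|lborel. l (G (s + ?y) (\<phi> (t - s))))"
    "integrable lborel (\<lambda>s. l (G (s + ?y) (\<phi> (t - s))))"
    using u_functional[OF l(1), of t'] integral_real_shift[of "\<lambda>s. l (G s (\<phi> (t' - s)))" ?y]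
      integrable_real_shift[of "\<lambda>s. l (G s (\<phi> (t' - s)))" ?y] by (simp_all add: algebra_simps)
  have "norm (u t - u t') = (LINT s|lborel. l (G s (\<phi> (t - s))) - l (G (s + ?y) (\<phi> (t - s))))"
    unfolding l(2)[symmetric] l.diff e'(1) u_functional(1)[OF l(1), of t]
    using e'(2) u_functional(2)[OF l(1), of t] by simp
  also have "\<dots> \<le> (LINT s|lborel. norm (G (s + ?y) - G s) * B)"
  proof (rule integral_mono)
    show "integrable lborel (\<lambda>s. l (G s (\<phi> (t - s))) - l (G (s + ?y) (\<phi> (t - s))))"
      using e'(2) u_functional(2)[OF l(1), of t] by simp
    show "integrable lborel (\<lambda>s. norm (G (s + ?y) - G s) * B)" using int by simp
    fix s
    have "l (G s (\<phi> (t - s))) - l (G (s + ?y) (\<phi> (t - s))) = l ((G s - G (s + ?y)) (\<phi> (t - s)))"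
      by (simp add: l.diff blinfun.diff_left)
    also have "\<dots> \<le> norm ((G s - G (s + ?y)) (\<phi> (t - s)))" using l(3) abs_le_D1 by blast
    also have "\<dots> \<le> norm (G (s + ?y) - G s) * B"
      by (rule order_trans[OF norm_blinfun]) (use phi_bound in \<open>auto simp: norm_minus_commute intro!: mult_left_mono\<close>)
    finally show "l (G s (\<phi> (t - s))) - l (G (s + ?y) (\<phi> (t - s))) \<le> norm (G (s + ?y) - G s) * B" .
  qed
  finally show ?thesis by simp
qed

lemma u_uniformly_continuous: "uniformly_continuous_on UNIV u"
  unfolding uniformly_continuous_on_sequentially
proof (intro allI impI)
  fix x y :: "nat \<Rightarrow> real"
  assume "(\<forall>n. x n \<in> UNIV) \<and> (\<forall>n. y n \<in> UNIV) \<and> (\<lambda>n. dist (x n) (y n)) \<longlonglongrightarrow> 0"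
  then have "(\<lambda>n. x n - y n) \<longlonglongrightarrow> 0"
    by (auto simp: dist_real_def tendsto_rabs_zero_iff)
  then have "(\<lambda>n. y n - x n) \<longlonglongrightarrow> 0" using tendsto_minus by force
  then have "(\<lambda>n. LINT s|lborel. norm (G (s + (y n - x n)) - G s)) \<longlonglongrightarrow> 0"
    by (intro translation_continuous_L1 G_isCont G_integrable)
  then have "(\<lambda>n. (LINT s|lborel. norm (G (s + (y n - x n)) - G s)) * B) \<longlonglongrightarrow> 0 * B"
    by (intro tendsto_intros)
  then have lim: "(\<lambda>n. (LINT s|lborel. norm (G (s + (y n - x n)) - G s)) * B) \<longlonglongrightarrow> 0" by simp
  show "(\<lambda>n. dist (u (x n)) (u (y n))) \<longlonglongrightarrow> 0"
    by (rule Lim_null_comparison[OF always_eventually lim]) (simp add: dist_norm u_increment)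
qed

lemma u_continuous: "continuous_on A' u"
  using uniformly_continuous_imp_continuous[OF u_uniformly_continuous] continuous_on_subset by blast

end

lemma interval_integral_functional:
  fixes f :: "real \<Rightarrow> 'a::banach" and l :: "'a \<Rightarrow> 'c::{banach, second_countable_topology}"
  assumes f: "simple_limit lborel f" "\<And>t. norm (f t) \<le> B" and l: "bounded_linear l"
  shows "l (Bochner_integral lborel (\<lambda>s. indicator {p..q} s *\<^sub>R f s)) = (LINT s|lborel. indicator {p..q} s *\<^sub>R l (f s))"
    "integrable lborel (\<lambda>s. indicator {p..q} s *\<^sub>R l (f s))"
proof -
  interpret l: bounded_linear l by fact
  have i: "simple_limit lborel (indicator {p..q} :: real \<Rightarrow> real)" by (rule borel_measurable_simple_limit) simp
  have i': "integrable lborel (\<lambda>s. norm (indicator {p..q} s :: real))"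
    by (intro integrable_norm integrable_real_indicator) (auto simp: emeasure_lborel_Icc_eq)
  note b = integrable_norm_bilinear[OF bounded_bilinear_scaleR i i' f]
  show "l (Bochner_integral lborel (\<lambda>s. indicator {p..q} s *\<^sub>R f s)) = (LINT s|lborel. indicator {p..q} s *\<^sub>R l (f s))"
    "integrable lborel (\<lambda>s. indicator {p..q} s *\<^sub>R l (f s))"
    using Bochner_integral_functional[OF b(1) Bochner_integrableI[OF b] l] by (simp_all add: l.scaleR)
qed

section \<open>The mild equation and the spectrum of the solution\<close>

lemma translation_measurable: "(\<lambda>(t, r). t - r) \<in> measurable (lborel \<Otimes>\<^sub>M lborel) (lborel :: real measure)"
  by measurable

lemma snd_lborel_measurable: "snd \<in> measurable (lborel \<Otimes>\<^sub>M lborel) (lborel :: real measure)"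
  by measurable

context convolution_input
begin

lemma u_simple_limit: "simple_limit lborel u"
  by (rule simple_limit_continuous[OF u_continuous])

lemma R0_complex_linear: "R0 (c *\<^sub>C x) = c *\<^sub>C R0 x"
  using a_not_K by (simp add: R0_def Rt_def Rz_complex_linear K_def)

text \<open>\<open>kern_phi\<close> is stated for complex-linear functionals, whereas the equation
  is tested with real ones. Taking the real part after \<open>complexify\<close> mediates between
  the two.\<close>

lemma kern_phi_real:
  fixes l :: "'a \<Rightarrow> real"
  assumes l: "bounded_linear l"
  shows "(LINT r|lborel. l (kern \<eta> (t - r) *\<^sub>C \<phi> r)) = 0"
    "integrable lborel (\<lambda>r. l (kern \<eta> (t - r) *\<^sub>C \<phi> r))"
proof -
  let ?L = "complexify l"
  note L = complexify[OF l]
  interpret L: bounded_linear ?L by (rule L(1))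
  obtain K where K: "\<And>x. norm (?L x) \<le> norm x * K" "0 \<le> K" using L.nonneg_bounded by blast
  have m: "(\<lambda>s. ?L (\<phi> (t - s))) \<in> borel_measurable borel"
    using simple_limit_borel_measurable[OF simple_limit_compose[OF simple_limit_reflect[OF phi] L.continuous_on[OF continuous_on_id]]] by simp
  have i: "integrable lborel (\<lambda>s. kern \<eta> s * ?L (\<phi> (t - s)))"
  proof (rule integrable_mult_bounded[OF kern_integrable[OF C2c_cutoff] m])
    show "norm (?L (\<phi> (t - s))) \<le> B * K" for s
      using K(1)[of "\<phi> (t - s)"] mult_right_mono[OF phi_bound[of "t - s"] K(2)] by linarith
  qed
  have Re: "l x = Re (?L x)" for x by (simp add: complexify_def)
  have "(LINT r|lborel. l (kern \<eta> (t - r) *\<^sub>C \<phi> r)) = (LINT s|lborel. Re (kern \<eta> s * ?L (\<phi> (t - s))))"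
    using integral_real_reflect[of "\<lambda>s. Re (kern \<eta> s * ?L (\<phi> (t - s)))" t] by (simp add: Re L(2))
  also have "\<dots> = Re (LINT s|lborel. kern \<eta> s * ?L (\<phi> (t - s)))" by (rule integral_Re[OF i])
  also have "\<dots> = 0" using kern_phi[OF L] by simp
  finally show "(LINT r|lborel. l (kern \<eta> (t - r) *\<^sub>C \<phi> r)) = 0" .
  show "integrable lborel (\<lambda>r. l (kern \<eta> (t - r) *\<^sub>C \<phi> r))"
    using integrable_real_reflect[OF integrable_Re[OF i], of t] by (simp add: Re L(2))
qed

text \<open>The integrated equation for \<open>u\<close> multiplied by \<open>R0\<close>. It is
  Fubini's theorem for \<open>F\<close> on the strip over \<open>{p..q}\<close>, with
  \<open>key_identity\<close> evaluating one of the iterated integrals and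
  \<open>kern_phi_real\<close> simplifying the other.\<close>

lemma mild_functional:
  fixes l :: "'a \<Rightarrow> real"
  assumes l: "bounded_linear l" and pq: "p < q"
  shows "l (R0 (u q)) - l (R0 (u p)) - (LINT r|lborel. indicator {p..q} r * l (R0 (\<phi> r)))
    = (LINT t|lborel. indicator {p..q} t * l ((\<i> * of_real a) *\<^sub>C R0 (u t) - u t))"
proof -
  interpret l: bounded_linear l by fact
  define V where "V x = l ((\<i> * of_real a) *\<^sub>C R0 x - x)" for x
  define Y where "Y x = l (R0 x)" for x
  have V: "bounded_linear V" unfolding V_def
    by (intro bounded_linear_compose[OF l] bounded_linear_sub bounded_linear_ident
        bounded_linear_compose[OF scaleC.bounded_linear_right blinfun.bounded_linear_right])
  have Y: "bounded_linear Y" unfolding Y_def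
    by (intro bounded_linear_compose[OF l] blinfun.bounded_linear_right)
  obtain K1 where K1: "\<And>x. norm (V x) \<le> norm x * K1" "0 \<le> K1" using bounded_linear.nonneg_bounded[OF V] by blast
  obtain K2 where K2: "\<And>x. norm (Y x) \<le> norm x * K2" "0 \<le> K2" using bounded_linear.nonneg_bounded[OF Y] by blast
  \<comment> \<open>Integrated over \<open>r\<close>, the first term gives \<open>V (u t)\<close>
    and the second vanishes by \<open>kern_phi_real\<close>.\<close>
  define Z where "Z t r = V (G (t - r) (\<phi> r)) - Y (kern \<eta> (t - r) *\<^sub>C \<phi> r)" for t r
  define F where "F t r = indicator {p..q} t * Z t r" for t r
  note kint = kern_integrable[OF C2c_cutoff]
  have F: "integrable (lborel \<Otimes>\<^sub>M lborel) (\<lambda>(t, r). F t r)"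
  proof (rule integrable_product_bound[where a = "indicator {p..q}"
        and b = "\<lambda>t r. norm (G (t - r)) * (B * K1) + norm (kern \<eta> (t - r)) * (B * K2)"])
    have "simple_limit (lborel \<Otimes>\<^sub>M lborel) (\<lambda>z. V (G (case z of (t, r) \<Rightarrow> t - r) (\<phi> (snd z))))"
      by (intro simple_limit_compose[OF bounded_bilinear.simple_limit_prod[OF bounded_bilinear_blinfun_apply]]
          simple_limit_measurable_compose[OF G_simple_limit translation_measurable]
          simple_limit_measurable_compose[OF phi snd_lborel_measurable] bounded_linear.continuous_on[OF V] continuous_on_id)
    from simple_limit_borel_measurable[OF this]
    have m1: "(\<lambda>z. V (G (case z of (t, r) \<Rightarrow> t - r) (\<phi> (snd z)))) \<in> borel_measurable (lborel \<Otimes>\<^sub>M lborel)" .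
    have "simple_limit (lborel \<Otimes>\<^sub>M lborel) (\<lambda>z. Y (kern \<eta> (case z of (t, r) \<Rightarrow> t - r) *\<^sub>C \<phi> (snd z)))"
      by (intro simple_limit_compose[OF scaleC.simple_limit_prod]
          simple_limit_measurable_compose[OF borel_measurable_simple_limit[OF borel_measurable_integrable[OF kint]] translation_measurable]
          simple_limit_measurable_compose[OF phi snd_lborel_measurable] bounded_linear.continuous_on[OF Y] continuous_on_id)
    from simple_limit_borel_measurable[OF this]
    have m2: "(\<lambda>z. Y (kern \<eta> (case z of (t, r) \<Rightarrow> t - r) *\<^sub>C \<phi> (snd z))) \<in> borel_measurable (lborel \<Otimes>\<^sub>M lborel)" .
    have "(\<lambda>z. indicator {p..q} (fst z) * (V (G (case z of (t, r) \<Rightarrow> t - r) (\<phi> (snd z)))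
        - Y (kern \<eta> (case z of (t, r) \<Rightarrow> t - r) *\<^sub>C \<phi> (snd z)))) \<in> borel_measurable (lborel \<Otimes>\<^sub>M lborel)"
      using m1 m2 by measurable
    then show "(\<lambda>(t, r). F t r) \<in> borel_measurable (lborel \<Otimes>\<^sub>M lborel)"
      by (simp add: F_def Z_def case_prod_beta)
    show "integrable lborel (indicator {p..q} :: real \<Rightarrow> real)"
      by (intro integrable_real_indicator) (auto simp: emeasure_lborel_Icc_eq)
    have g: "integrable lborel (\<lambda>r. norm (G (t - r)))" "integrable lborel (\<lambda>r. norm (kern \<eta> (t - r)))" for t
      using integrable_real_reflect[OF G_integrable, of t] integrable_real_reflect[OF integrable_norm[OF kint], of t] by auto
    show "integrable lborel (\<lambda>r. norm (G (t - r)) * (B * K1) + norm (kern \<eta> (t - r)) * (B * K2))" for t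
      using g[of t] by simp
    show "(LINT r|lborel. norm (G (t - r)) * (B * K1) + norm (kern \<eta> (t - r)) * (B * K2))
      \<le> (LINT r|lborel. norm (G r)) * (B * K1) + (LINT r|lborel. norm (kern \<eta> r)) * (B * K2)" for t
      using g[of t] integral_real_reflect[of "\<lambda>r. norm (G r)" t] integral_real_reflect[of "\<lambda>r. norm (kern \<eta> r)" t] by simp
    fix t r
    have "norm (V (G (t - r) (\<phi> r))) \<le> (norm (G (t - r)) * B) * K1"
      by (intro order_trans[OF K1(1)] mult_right_mono K1(2) order_trans[OF norm_blinfun] mult_left_mono phi_bound) auto
    moreover have "norm (Y (kern \<eta> (t - r) *\<^sub>C \<phi> r)) \<le> (norm (kern \<eta> (t - r)) * B) * K2"
      by (intro order_trans[OF K2(1)] mult_right_mono K2(2)) (auto simp: norm_scaleC intro!: mult_left_mono phi_bound)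
    moreover have "norm (Z t r) \<le> norm (V (G (t - r) (\<phi> r))) + norm (Y (kern \<eta> (t - r) *\<^sub>C \<phi> r))"
      unfolding Z_def by (rule norm_triangle_ineq4)
    ultimately show "norm (case (t, r) of (t, r) \<Rightarrow> F t r)
        \<le> indicator {p..q} t * (norm (G (t - r)) * (B * K1) + norm (kern \<eta> (t - r)) * (B * K2))"
      by (auto simp: F_def indicator_def mult.assoc)
  qed auto
  \<comment> \<open>The shift by \<open>r\<close> turns the interval into
    \<open>{p - r..q - r}\<close>, so the delta term is present exactly for \<open>r\<close>
    strictly between \<open>p\<close> and \<open>q\<close> and becomes the integrand of the integral
    of \<phi>. The two exceptional \<open>r\<close> are those for which an endpoint would be
    0.\<close>
  have inner: "(LINT t|lborel. F t r) = Y (G (q - r) (\<phi> r)) - Y (G (p - r) (\<phi> r)) - indicator {p..q} r * Y (\<phi> r)"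
    if r: "r \<noteq> p" "r \<noteq> q" for r
  proof -
    have L: "bounded_linear (\<lambda>T. l (blinfun_apply T (\<phi> r)))"
      by (rule bounded_linear_compose[OF l blinfun.bounded_linear_left])
    have ind: "indicator {p..q} (s + r) = (indicator {p - r..q - r} s :: real)" for s
      by (auto simp: indicator_def)
    have "(LINT t|lborel. F t r) = (LINT s|lborel. F (s + r) r)"
      using integral_real_shift[of "\<lambda>t. F t r" r] by simp
    also have "\<dots> = (LINT s|lborel. indicator {p - r..q - r} s *
        (l (blinfun_apply ((\<i> * of_real a) *\<^sub>C (R0 o\<^sub>L G s) - G s) (\<phi> r)) - l (blinfun_apply (kern \<eta> s *\<^sub>C R0) (\<phi> r))))"
      by (simp add: F_def Z_def V_def Y_def ind blinfun.diff_left scaleC_blinfun_apply R0_complex_linear)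
    also have "\<dots> = Y (G (q - r) (\<phi> r)) - Y (G (p - r) (\<phi> r)) - (if p - r < 0 \<and> 0 < q - r then Y (\<phi> r) else 0)"
      using key_identity[OF L, of "p - r" "q - r"] pq r by (simp add: Y_def)
    also have "(if p - r < 0 \<and> 0 < q - r then Y (\<phi> r) else 0) = indicator {p..q} r * Y (\<phi> r)"
      using r by (auto simp: indicator_def)
    finally show ?thesis .
  qed
  note Yu = u_functional'[OF Y] and Yp = interval_integral_functional[OF phi phi_bound Y, of p q]
  have "(LINT r|lborel. LINT t|lborel. F t r)
      = (LINT r|lborel. Y (G (q - r) (\<phi> r)) - Y (G (p - r) (\<phi> r)) - indicator {p..q} r * Y (\<phi> r))"
  proof (rule integral_cong_AE)
    show "(\<lambda>r. LINT t|lborel. F t r) \<in> borel_measurable lborel"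
      by (rule borel_measurable_integrable[OF lborel_pair.integrable_snd[OF F]])
    show "(\<lambda>r. Y (G (q - r) (\<phi> r)) - Y (G (p - r) (\<phi> r)) - indicator {p..q} r * Y (\<phi> r)) \<in> borel_measurable lborel"
      using Yu(2)[of q] Yu(2)[of p] Yp(2) by (intro borel_measurable_diff borel_measurable_integrable) auto
    show "AE r in lborel. (LINT t|lborel. F t r) = Y (G (q - r) (\<phi> r)) - Y (G (p - r) (\<phi> r)) - indicator {p..q} r * Y (\<phi> r)"
      using AE_lborel_singleton[of p] AE_lborel_singleton[of q] by eventually_elim (rule inner)
  qed
  also have "\<dots> = Y (u q) - Y (u p) - (LINT r|lborel. indicator {p..q} r * Y (\<phi> r))"
    unfolding Yu(1) using Yu(2)[of q] Yu(2)[of p] Yp(2) by simp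
  finally have lhs: "(LINT r|lborel. LINT t|lborel. F t r) = Y (u q) - Y (u p) - (LINT r|lborel. indicator {p..q} r * Y (\<phi> r))" .
  have "(LINT r|lborel. Z t r) = V (u t)" for t
    unfolding Z_def u_functional'(1)[OF V]
    using u_functional'(2)[OF V, of t] kern_phi_real[OF Y, of t] by simp
  then have "(LINT t|lborel. LINT r|lborel. F t r) = (LINT t|lborel. indicator {p..q} t * V (u t))"
    by (simp add: F_def)
  with lborel_pair.Fubini_integral[OF F] lhs show ?thesis by (simp add: V_def Y_def)
qed

abbreviation I :: "(real \<Rightarrow> 'a) \<Rightarrow> real \<Rightarrow> real \<Rightarrow> 'a" where
  "I f p q \<equiv> Bochner_integral lborel (\<lambda>s. indicator {p..q} s *\<^sub>R f s)"

text \<open>Undoes the multiplication by \<open>R0\<close>: the tested identity is solved for the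
  integral of \<open>u\<close>, which then appears as a value of the resolvent.\<close>

lemma mild_interval:
  assumes pq: "p < q"
  shows "I u p q \<in> D" "u q - u p = A (I u p q) + I \<phi> p q"
proof -
  let ?z = "\<i> * complex_of_real a"
  have z: "?z \<notin> spectrum D A" using a_not_K by (simp add: K_def)
  have "R0 (u q - u p - I \<phi> p q) = ?z *\<^sub>C R0 (I u p q) - I u p q"
  proof (rule functionals_separate)
    fix l :: "'a \<Rightarrow> real" assume l: "bounded_linear l"
    interpret l: bounded_linear l by fact
    have 1: "bounded_linear (\<lambda>x. l (R0 x))" by (intro bounded_linear_compose[OF l] blinfun.bounded_linear_right)
    have 2: "bounded_linear (\<lambda>x. l (?z *\<^sub>C R0 x - x))"
      by (intro bounded_linear_compose[OF l] bounded_linear_sub bounded_linear_ident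
        bounded_linear_compose[OF scaleC.bounded_linear_right blinfun.bounded_linear_right])
    show "l (R0 (u q - u p - I \<phi> p q)) = l (?z *\<^sub>C R0 (I u p q) - I u p q)"
      using mild_functional[OF l pq] interval_integral_functional(1)[OF phi phi_bound 1, of p q]
        interval_integral_functional(1)[OF u_simple_limit u_bound 2, of p q]
      by (simp add: blinfun.diff_right l.diff)
  qed
  \<comment> \<open>Being of the form \<open>R0 y\<close>, the integral lies in \<open>D\<close>,
    and applying \<open>?z - A\<close> to it returns \<open>y\<close>.\<close>
  then have eq: "R0 (?z *\<^sub>C I u p q - (u q - u p - I \<phi> p q)) = I u p q"
    by (simp add: blinfun.diff_right R0_complex_linear)
  have R0: "R0 = Rz ?z" by (simp add: R0_def Rt_def)
  show "I u p q \<in> D" using Rz_right(1)[OF z, of "?z *\<^sub>C I u p q - (u q - u p - I \<phi> p q)"] eq R0 by simp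
  have "?z *\<^sub>C I u p q - A (I u p q) = ?z *\<^sub>C I u p q - (u q - u p - I \<phi> p q)"
    using Rz_right(2)[OF z, of "?z *\<^sub>C I u p q - (u q - u p - I \<phi> p q)"] eq R0 by simp
  then show "u q - u p = A (I u p q) + I \<phi> p q" by (simp add: algebra_simps)
qed

lemma u_mild: "mild_solution D A \<phi> u"
  unfolding mild_solution_def
proof (intro conjI allI u_continuous)
  fix t
  have neg: "- x \<in> D" "A (- x) = - A x" if "x \<in> D" for x
    using scale_mem[OF that, of "-1"] scale[OF that, of "-1"] scaleC.minus_left[of 1 x] scaleC.minus_left[of 1 "A x"] by simp_all
  have "oriented_integral 0 t u \<in> D \<and> u t = u 0 + A (oriented_integral 0 t u) + oriented_integral 0 t \<phi>"
  proof -
    consider "t > 0" | "t = 0" | "t < 0" by linarith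
    then show ?thesis
    proof cases
      case 1
      have "u t = u 0 + (u t - u 0)" by simp
      then show ?thesis using 1 mild_interval[of 0 t] by (simp add: oriented_integral_def add.assoc)
    next
      case 2
      \<comment> \<open>At \<open>t = 0\<close> the oriented integral runs over the closed interval
        from 0 to 0, whose indicator is nonzero at one point but vanishes almost everywhere.\<close>
      have "I f 0 0 = 0" if "simple_limit lborel f" "\<And>t. norm (f t) \<le> C" for f C
      proof (rule functionals_separate)
        fix l :: "'a \<Rightarrow> real" assume l: "bounded_linear l"
        interpret l: bounded_linear l by fact
        have "(LINT s|lborel. indicator {0..0} s *\<^sub>R l (f s)) = (LINT s::real|lborel. 0)"
        proof (rule integral_cong_AE)
          show "AE s in lborel. indicator {0..0} s *\<^sub>R l (f s) = 0"
            using AE_lborel_singleton[of 0] by eventually_elim auto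
        qed (use interval_integral_functional(2)[OF that l, of 0 0] in auto)
        then show "l (I f 0 0) = l 0"
          using interval_integral_functional(1)[OF that l, of 0 0] by (simp add: l.zero)
      qed
      from this[OF u_simple_limit u_bound] this[OF phi phi_bound] show ?thesis
        using 2 by (simp add: oriented_integral_def zero_mem A_zero)
    next
      case 3
      have "u 0 - u t = A (I u t 0) + I \<phi> t 0" "I u t 0 \<in> D" using mild_interval[OF 3] by auto
      then have "u t = u 0 + - A (I u t 0) + - I \<phi> t 0" by (simp add: algebra_simps)
      then show ?thesis using 3 neg[OF \<open>I u t 0 \<in> D\<close>] by (simp add: oriented_integral_def)
    qed
  qed
  then show "oriented_integral 0 t u \<in> D" "u t = u 0 + A (oriented_integral 0 t u) + oriented_integral 0 t \<phi>" by auto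
qed

text \<open>If \<open>f\<close> annihilates \<phi>, it annihilates \<open>u\<close> too, since the
  convolutions with \<open>f\<close> and \<open>G\<close> may be interchanged. So the transforms
  tested for \<phi> are among those tested for \<open>u\<close>.\<close>

lemma u_spectrum: "beurling_spectrum u \<subseteq> beurling_spectrum \<phi>"
proof
  fix w assume w: "w \<in> beurling_spectrum u"
  have "fourier f w = 0"
    if f: "integrable lborel f" and zero: "\<And>t. convolution (\<lambda>x c. c *\<^sub>C x) \<phi> f t = 0" for f
  proof -
    note [measurable] = borel_measurable_integrable[OF f]
    have "convolution (\<lambda>x c. c *\<^sub>C x) u f t = 0" for t
    proof (rule complex_functionals_separate)
      fix l :: "'a \<Rightarrow> complex" assume l: "bounded_linear l" and lc: "\<And>c x. l (c *\<^sub>C x) = c * l x"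
      interpret l: bounded_linear l by fact
      obtain K where K: "\<And>x. norm (l x) \<le> norm x * K" "0 \<le> K" using l.nonneg_bounded by blast
      \<comment> \<open>Integrating over \<open>r\<close> first gives the convolution of
        \<open>u\<close> with \<open>f\<close>. Integrating over \<open>s\<close> first gives,
        because \<open>G r\<close> is complex-linear, \<open>l (G r y)\<close> with \<open>y\<close>
        the convolution of \<phi> with \<open>f\<close> at \<open>t - r\<close>, which is 0.\<close>
      define F where "F s r = f (t - s) * l (G r (\<phi> (s - r)))" for s r
      have F: "integrable (lborel \<Otimes>\<^sub>M lborel) (\<lambda>(s, r). F s r)"
      proof (rule integrable_product_bound[where a = "\<lambda>s. norm (f (t - s))" and b = "\<lambda>s r. norm (G r) * (B * K)", OF _ _ _ order_refl])
        have "simple_limit (lborel \<Otimes>\<^sub>M lborel) (\<lambda>z. l (G (snd z) (\<phi> (case z of (t, r) \<Rightarrow> t - r))))"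
          by (intro simple_limit_compose[OF bounded_bilinear.simple_limit_prod[OF bounded_bilinear_blinfun_apply]]
              simple_limit_measurable_compose[OF phi translation_measurable]
              simple_limit_measurable_compose[OF G_simple_limit snd_lborel_measurable] l.continuous_on continuous_on_id)
        note [measurable] = simple_limit_borel_measurable[OF this]
        have "(\<lambda>z. f (t - fst z) * l (G (snd z) (\<phi> (case z of (t, r) \<Rightarrow> t - r)))) \<in> borel_measurable (lborel \<Otimes>\<^sub>M lborel)"
          by measurable
        then show "(\<lambda>(s, r). F s r) \<in> borel_measurable (lborel \<Otimes>\<^sub>M lborel)"
          by (simp add: F_def case_prod_beta)
        show "integrable lborel (\<lambda>s. norm (f (t - s)))" using integrable_real_reflect[OF f, of t] by simp
        show "integrable lborel (\<lambda>r. norm (G r) * (B * K))" using G_integrable by simp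
        fix s r
        have "norm (l (G r (\<phi> (s - r)))) \<le> (norm (G r) * B) * K"
          by (intro order_trans[OF K(1)] mult_right_mono K(2) order_trans[OF norm_blinfun] mult_left_mono phi_bound) auto
        then show "norm (case (s, r) of (s, r) \<Rightarrow> F s r) \<le> norm (f (t - s)) * (norm (G r) * (B * K))"
          by (auto simp: F_def norm_mult mult.assoc intro!: mult_left_mono)
      qed auto
      have "(LINT s|lborel. F s r) = 0" for r
      proof -
        have b: "bounded_linear (\<lambda>x. l (G r x))" by (rule bounded_linear_compose[OF l blinfun.bounded_linear_right])
        have "(LINT s|lborel. F s r) = (LINT s|lborel. F (s + r) r)"
          using integral_real_shift[of "\<lambda>s. F s r" r] by simp
        also have "\<dots> = (LINT s|lborel. l (G r (f ((t - r) - s) *\<^sub>C \<phi> s)))"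
          by (simp add: F_def G_complex_linear lc algebra_simps)
        also have "\<dots> = 0"
          using convolution_scaleC_functional[OF f phi phi_bound b, of "t - r"] by (simp add: zero blinfun.zero_right l.zero)
        finally show ?thesis .
      qed
      then have 0: "(LINT s|lborel. LINT r|lborel. F s r) = 0"
        using lborel_pair.Fubini_integral[OF F] by simp
      have "l (convolution (\<lambda>x c. c *\<^sub>C x) u f t) = (LINT s|lborel. f (t - s) * l (u s))"
        using convolution_scaleC_functional[OF f u_simple_limit u_bound l, of t] by (simp add: lc)
      also have "\<dots> = (LINT s|lborel. LINT r|lborel. F s r)"
        by (simp add: u_functional(1)[OF l] F_def)
      finally show "l (convolution (\<lambda>x c. c *\<^sub>C x) u f t) = l 0" using 0 by (simp add: l.zero)
    qed
    then show ?thesis using w f by (auto simp: beurling_spectrum_def)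
  qed
  then show "w \<in> beurling_spectrum \<phi>" by (auto simp: beurling_spectrum_def)
qed

end

theorem theorem5p2:
  fixes T :: "real \<Rightarrow> 'a::complex_banach \<Rightarrow>\<^sub>L 'a"
    and D :: "'a set" and A :: "'a \<Rightarrow> 'a"
    and K F :: "real set" and a \<theta> :: real
  assumes "C0_semigroup T" and "is_generator T D A"
    and "K = {t. \<i> * complex_of_real t \<in> spectrum D A}"
    and "0 < a" and "K \<subseteq> {-a<..<a}"
    and "1 / 2 < \<theta>"
    and "bdd_above ((\<lambda>t. \<bar>t\<bar> powr \<theta> * onorm (resolvent D A (\<i> * complex_of_real t)))
           ` (UNIV - {-a<..<a}))"
    and "closed F" and "F \<subseteq> UNIV - K"
  shows "\<exists>G :: real \<Rightarrow> 'a \<Rightarrow>\<^sub>L 'a.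
    (\<forall>s. complex_linear (G s)) \<and> Bochner_integrable lborel G \<and>
    (\<forall>\<phi> \<in> L_infinity. beurling_spectrum \<phi> \<subseteq> F \<longrightarrow>
      (let u = convolution blinfun_apply G \<phi> in
        mild_solution D A \<phi> u \<and>
        bounded (range u) \<and> uniformly_continuous_on UNIV u \<and>
        beurling_spectrum u \<subseteq> beurling_spectrum \<phi> \<and> beurling_spectrum \<phi> \<subseteq> F))"
proof -
  interpret lin: complex_linear_operator D A by (rule C0_generator_linear[OF assms(1,2)])
  have K: "lin.K = K" by (simp add: lin.K_def assms(3))
  have "bounded K" by (rule bounded_subset[OF _ assms(5)]) simp
  then have "compact K" using lin.closed_K unfolding K by (simp add: compact_eq_bounded_closed)
  moreover have "K \<inter> F = {}" using assms(9) by blast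
  ultimately obtain \<eta> W C where \<eta>: "C2c \<eta>" "open W" "K \<subseteq> W" "\<And>t. t \<in> W \<Longrightarrow> \<eta> t = 1"
    and C: "compact C" "C \<inter> F = {}" "\<And>t. \<eta> t \<noteq> 0 \<Longrightarrow> t \<in> C"
    using exists_cutoff[OF _ assms(8)] by metis
  obtain Q where Q: "\<And>t. t \<in> UNIV - {-a<..<a} \<Longrightarrow> \<bar>t\<bar> powr \<theta> * onorm (resolvent D A (\<i> * complex_of_real t)) \<le> Q"
    using assms(7) unfolding bdd_above_def by blast
  interpret resolvent_symbol D A a \<theta> Q \<eta> W
  proof
    show "0 < a" "1 / 2 < \<theta>" "C2c \<eta>" "open W" by (fact assms \<eta>)+
    show "lin.K \<subseteq> {-a<..<a}" "lin.K \<subseteq> W" unfolding K by (fact assms \<eta>)+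
    show "\<eta> t = 1" if "t \<in> W" for t using \<eta>(4) that .
    fix t assume t: "a \<le> \<bar>t\<bar>"
    then have "t \<in> UNIV - {-a<..<a}" by auto
    \<comment> \<open>Such \<open>t\<close> lie outside \<open>K\<close>, so the operator norm of
      \<open>Rt t\<close> is the \<open>onorm\<close> of the resolvent in the hypothesis.\<close>
    moreover from this have "\<i> * complex_of_real t \<notin> spectrum D A" using assms(3,5) by blast
    ultimately show "\<bar>t\<bar> powr \<theta> * norm (lin.Rt t) \<le> Q" using Q by (simp add: lin.Rt_def lin.norm_Rz)
  qed
  have main: "mild_solution D A \<phi> v \<and> bounded (range v) \<and> uniformly_continuous_on UNIV v \<and>
      beurling_spectrum v \<subseteq> beurling_spectrum \<phi>"
    if \<phi>: "\<phi> \<in> L_infinity" and sp: "beurling_spectrum \<phi> \<subseteq> F" and v: "v = convolution blinfun_apply G \<phi>" for \<phi> v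
  proof -
    \<comment> \<open>All objects of the claim are unchanged when \<phi> is replaced by an almost
      everywhere equal function: the Beurling spectrum, the convolution at every point, and the
      oriented integrals in the mild equation.\<close>
    obtain \<phi>' B where \<phi>': "simple_limit lborel \<phi>'" "\<And>t. norm (\<phi>' t) \<le> B" "AE t in lborel. \<phi>' t = \<phi> t"
      by (rule L_infinity_version[OF \<phi>]) blast
    have sp': "beurling_spectrum \<phi>' = beurling_spectrum \<phi>"
      unfolding beurling_spectrum_def using convolution_cong_AE[OF \<phi>'(3) AE_I2[OF refl]] by metis
    interpret convolution_input D A a \<theta> Q \<eta> W \<phi>' B
    proof
      fix l :: "'a \<Rightarrow> complex" and t
      assume "bounded_linear l" "\<And>c x. l (c *\<^sub>C x) = c * l x"
      then show "(LINT s|lborel. kern \<eta> s * l (\<phi>' (t - s))) = 0"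
        using sp sp' C by (intro beurling_spectrum_annihilates[OF \<phi>'(1,2) C(1) _ \<eta>(1)]) auto
    qed (fact \<phi>')+
    have vu: "v = u"
      unfolding u_def v by (rule convolution_cong_AE) (use \<phi>'(3) in \<open>auto elim: eventually_mono\<close>)
    have int: "oriented_integral 0 t \<phi>' = oriented_integral 0 t \<phi>" for t
    proof -
      have "AE s in lborel. indicator S s *\<^sub>R \<phi>' s = indicator S s *\<^sub>R \<phi> s" for S :: "real set"
        using \<phi>'(3) by eventually_elim simp
      from Bochner_integral_cong_AE(2)[OF this] show ?thesis by (simp add: oriented_integral_def)
    qed
    have "mild_solution D A \<phi> v" using u_mild unfolding vu mild_solution_def int .
    moreover have "bounded (range v)" unfolding vu bounded_iff using u_bound by blast
    ultimately show ?thesis using u_uniformly_continuous u_spectrum unfolding vu sp' by blast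
  qed
  have "Bochner_integrable lborel G" by (rule Bochner_integrableI[OF G_simple_limit G_integrable])
  moreover have "complex_linear (G s)" for s by (simp add: complex_linear_def G_complex_linear)
  ultimately show ?thesis using main unfolding Let_def by blast
qed

end
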